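(* There exists a universal constant $C<\infty$ such that the following holds for every integer $n\ge2$, every $p\in[0,1]$ with $p\ge\frac{2\log n}{n}$, and every $M>0$. (i) (Generalized Bradley–Terry model.) Let $F$ be a distribution function on $\mathbb R$ with $F(x)+F(-x)=1$ for all $x$, having a continuous strictly positive density $f$, and set $L=\sup_{|x|\le2M}f(x)$, $L'=\inf_{|x|\le2M}f(x)$. Then, for data from the tournament model, $$\sup_{\theta^*}\frac1{n^2}\,\mathbb E\|\hat\theta-\theta^*\|^2\le C\Big[\Big(\frac L{L'}\Big)^2\frac{\log n}{np}+\frac{(\log n)^2}{np}\Big],$$ where the supremum is over all matrices $\theta^*$ with $\theta^*_{ii}=0$ and $\theta^*_{ij}=F(w_i-w_j)$ for $i\ne j$, for some $w_1,\dots,w_n\in[-M,M]$. (ii) (Generalized $\beta$ model.) Let $F$ be a distribution function on $\mathbb R$ having a continuous strictly positive density $f$, and set $L=\sup_{|x|\le2M}f(x)$, $L'=\inf_{|x|\le2M}f(x)$. Then, for data from the graph model, the same bound holds with the supremum over all matrices $\theta^*$ with $\theta^*_{ii}=0$ and $\theta^*_{ij}=F(w_i+w_j)$ for $i\ne j$, for some $w_1,\dots,w_n\in[-M,M]$.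
   Context: Notation: $[n]=\{1,\dots,n\}$; for an $n\times n$ matrix $\theta$ and a permutation $\pi$ of $[n]$, $(\theta\circ\pi)_{ij}=\theta_{\pi(i),\pi(j)}$; $\|\cdot\|$ is the Frobenius norm; $\log$ is the natural logarithm. $\mathcal T$ is the set of $\theta\in[0,1]^{n\times n}$ such that $\theta_{ij}\le\theta_{ik}$ whenever $i\ne k$, $i\ne j$, $k<j$; $\theta_{ji}=1-\theta_{ij}$ for all $i\neq j$; $\theta_{ii}=0$ for all $i$; and $\theta_{ij}\le\frac12$ for all $i<j$. $\mathcal G$ is the set of $\theta\in[0,1]^{n\times n}$ such that $\theta_{ij}\le\theta_{ik}$ whenever $i\ne k$, $i\ne j$, $j<k$; $\theta_{ji}=\theta_{ij}$ for all $i\ne j$; and $\theta_{ii}=0$ for all $i$. Data with true parameter $\theta^*$ and observation probability $p$: for $i<j$ there are independent outcomes with law $\mathrm{Bern}(\theta^*_{ij})$; each above-diagonal entry is observed with probability $p$, independently over entries and independently of the outcomes. For $i<j$ set $y_{ij}$ equal to the outcome if it is observed and $y_{ij}=\frac12$ if it is missing. The lower triangle is $y_{ji}=1-y_{ij}$ in the tournament model and $y_{ji}=y_{ij}$ in the graph model ($i<j$), and $y_{ii}=0$. Let $\hat p$ be the number of observed above-diagonal entries divided by $\binom n2$. Estimator (it does not use $F$): let $r_i=\sum_{j=1}^n y_{ij}$ and let $\hat\sigma$ be a permutation with $r_{\hat\sigma(1)}\le\dots\le r_{\hat\sigma(n)}$, ties being broken uniformly at random. Let $J$ be the $n\times n$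 matrix with $J_{ij}=1$ for $i\ne j$ and $J_{ii}=0$. Let $\mathrm{Proj}$ be the Euclidean (Frobenius) projection onto the closed convex set $\mathcal T$ in the tournament model, and onto $\mathcal G$ in the graph model. Then $$\hat\theta=\mathrm{Proj}\Big(\big(\tfrac{y-J/2}{\hat p}+\tfrac J2\big)\circ\hat\sigma\Big)\circ\hat\sigma^{-1}\ \text{ if }\hat p\ge\tfrac1n,\qquad \hat\theta=\tfrac J2\ \text{ otherwise}.$$ *)

theory Defs
  imports "HOL-Probability.Probability" "HOL-Combinatorics.Permutations"
begin

text \<open>An n-by-n matrix is an extensional function on {1..n} with values in extensional functions
  on {1..n}, so that equality of matrices is equality of entries. Intermediate matrices, on which
  only the entries with indices in {1..n} matter, are left as plain functions.\<close>

definition matrices :: "nat \<Rightarrow> real set \<Rightarrow> (nat \<Rightarrow> nat \<Rightarrow> real) set" where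
  "matrices n S = {1..n} \<rightarrow>\<^sub>E ({1..n} \<rightarrow>\<^sub>E S)"

definition mat_perm :: "(nat \<Rightarrow> nat \<Rightarrow> real) \<Rightarrow> (nat \<Rightarrow> nat) \<Rightarrow> nat \<Rightarrow> nat \<Rightarrow> real" where
  "mat_perm \<theta> \<pi> = (\<lambda>i j. \<theta> (\<pi> i) (\<pi> j))"

definition frob_norm :: "nat \<Rightarrow> (nat \<Rightarrow> nat \<Rightarrow> real) \<Rightarrow> real" where
  "frob_norm n A = L2_set (\<lambda>(i, j). A i j) ({1..n} \<times> {1..n})"

definition frob_dist :: "nat \<Rightarrow> (nat \<Rightarrow> nat \<Rightarrow> real) \<Rightarrow> (nat \<Rightarrow> nat \<Rightarrow> real) \<Rightarrow> real" where
  "frob_dist n A B = frob_norm n (\<lambda>i j. A i j - B i j)"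

text \<open>The counterpart of \<^const>\<open>closest_point\<close> for the Frobenius distance; the latter
  is not the metric of a type class instance, since n is not a type. The minimizer is unique for
  the sets below, which are nonempty, closed and convex.\<close>

definition frob_proj ::
    "nat \<Rightarrow> (nat \<Rightarrow> nat \<Rightarrow> real) set \<Rightarrow> (nat \<Rightarrow> nat \<Rightarrow> real) \<Rightarrow> nat \<Rightarrow> nat \<Rightarrow> real" where
  "frob_proj n K A = (SOME B. B \<in> K \<and> (\<forall>B'\<in>K. frob_dist n A B \<le> frob_dist n A B'))"

definition tournament_set :: "nat \<Rightarrow> (nat \<Rightarrow> nat \<Rightarrow> real) set" where
  "tournament_set n = {\<theta> \<in> matrices n {0..1}.
     (\<forall>i\<in>{1..n}. \<forall>j\<in>{1..n}. \<forall>k\<in>{1..n}. i \<noteq> k \<and> i \<noteq> j \<and> k < j \<longrightarrow> \<theta> i j \<le> \<theta> i k) \<and>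
     (\<forall>i\<in>{1..n}. \<forall>j\<in>{1..n}. i \<noteq> j \<longrightarrow> \<theta> j i = 1 - \<theta> i j) \<and>
     (\<forall>i\<in>{1..n}. \<theta> i i = 0) \<and>
     (\<forall>i\<in>{1..n}. \<forall>j\<in>{1..n}. i < j \<longrightarrow> \<theta> i j \<le> 1 / 2)}"

definition graph_set :: "nat \<Rightarrow> (nat \<Rightarrow> nat \<Rightarrow> real) set" where
  "graph_set n = {\<theta> \<in> matrices n {0..1}.
     (\<forall>i\<in>{1..n}. \<forall>j\<in>{1..n}. \<forall>k\<in>{1..n}. i \<noteq> k \<and> i \<noteq> j \<and> j < k \<longrightarrow> \<theta> i j \<le> \<theta> i k) \<and>
     (\<forall>i\<in>{1..n}. \<forall>j\<in>{1..n}. i \<noteq> j \<longrightarrow> \<theta> j i = \<theta> i j) \<and>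
     (\<forall>i\<in>{1..n}. \<theta> i i = 0)}"

datatype model = Tournament | Graph

fun model_set :: "model \<Rightarrow> nat \<Rightarrow> (nat \<Rightarrow> nat \<Rightarrow> real) set" where
  "model_set Tournament n = tournament_set n"
| "model_set Graph n = graph_set n"

fun reflect :: "model \<Rightarrow> real \<Rightarrow> real" where
  "reflect Tournament t = 1 - t"
| "reflect Graph t = t"

definition above_diag :: "nat \<Rightarrow> (nat \<times> nat) set" where
  "above_diag n = {(i, j). 1 \<le> i \<and> i < j \<and> j \<le> n}"

text \<open>A data point assigns to each above-diagonal position the pair (outcome, observed?).\<close>

type_synonym data = "nat \<times> nat \<Rightarrow> bool \<times> bool"

definition data_pmf :: "nat \<Rightarrow> real \<Rightarrow> (nat \<Rightarrow> nat \<Rightarrow> real) \<Rightarrow> data pmf" where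
  "data_pmf n p \<theta> = Pi_pmf (above_diag n) (False, False)
     (\<lambda>(i, j). pair_pmf (bernoulli_pmf (\<theta> i j)) (bernoulli_pmf p))"

definition y_upper :: "data \<Rightarrow> nat \<Rightarrow> nat \<Rightarrow> real" where
  "y_upper \<omega> i j = (if snd (\<omega> (i, j)) then of_bool (fst (\<omega> (i, j))) else 1 / 2)"

definition y_mat :: "model \<Rightarrow> data \<Rightarrow> nat \<Rightarrow> nat \<Rightarrow> real" where
  "y_mat m \<omega> i j =
     (if i < j then y_upper \<omega> i j else if j < i then reflect m (y_upper \<omega> j i) else 0)"

definition p_hat :: "nat \<Rightarrow> data \<Rightarrow> real" where
  "p_hat n \<omega> = real (card {e \<in> above_diag n. snd (\<omega> e)}) / real (n choose 2)"

definition row_sum :: "nat \<Rightarrow> (nat \<Rightarrow> nat \<Rightarrow> real) \<Rightarrow> nat \<Rightarrow> real" where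
  "row_sum n y i = (\<Sum>j=1..n. y i j)"

definition sorting_perms :: "nat \<Rightarrow> (nat \<Rightarrow> real) \<Rightarrow> (nat \<Rightarrow> nat) set" where
  "sorting_perms n r = {\<sigma>. \<sigma> permutes {1..n} \<and> mono_on {1..n} (\<lambda>k. r (\<sigma> k))}"

definition J :: "nat \<Rightarrow> nat \<Rightarrow> real" where
  "J i j = (if i = j then 0 else 1)"

definition estimate :: "model \<Rightarrow> nat \<Rightarrow> data \<Rightarrow> (nat \<Rightarrow> nat) \<Rightarrow> nat \<Rightarrow> nat \<Rightarrow> real" where
  "estimate m n \<omega> \<sigma> =
     (if p_hat n \<omega> \<ge> 1 / real n
      then mat_perm
             (frob_proj n (model_set m n)
               (mat_perm (\<lambda>i j. (y_mat m \<omega> i j - J i j / 2) / p_hat n \<omega> + J i j / 2) \<sigma>))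
             (inv \<sigma>)
      else (\<lambda>i j. J i j / 2))"

text \<open>Uniform tie-breaking: given the data, the permutation is uniform over all permutations that
  sort the row sums.\<close>

definition estimator_pmf ::
    "model \<Rightarrow> nat \<Rightarrow> real \<Rightarrow> (nat \<Rightarrow> nat \<Rightarrow> real) \<Rightarrow> (nat \<Rightarrow> nat \<Rightarrow> real) pmf" where
  "estimator_pmf m n p \<theta> =
     bind_pmf (data_pmf n p \<theta>) (\<lambda>\<omega>.
       map_pmf (estimate m n \<omega>) (pmf_of_set (sorting_perms n (row_sum n (y_mat m \<omega>)))))"

definition mse :: "model \<Rightarrow> nat \<Rightarrow> real \<Rightarrow> (nat \<Rightarrow> nat \<Rightarrow> real) \<Rightarrow> real" where
  "mse m n p \<theta> = measure_pmf.expectation (estimator_pmf m n p \<theta>)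
     (\<lambda>\<theta>'. (frob_norm n (\<lambda>i j. \<theta>' i j - \<theta> i j))\<^sup>2)"

definition cdf_with_cont_pos_density :: "(real \<Rightarrow> real) \<Rightarrow> (real \<Rightarrow> real) \<Rightarrow> bool" where
  "cdf_with_cont_pos_density F f \<longleftrightarrow>
     (\<exists>\<mu>. real_distribution \<mu> \<and> F = cdf \<mu> \<and> \<mu> = density lborel (\<lambda>x. ennreal (f x))) \<and>
     continuous_on UNIV f \<and> (\<forall>x. 0 < f x)"

definition gen_bradley_terry :: "nat \<Rightarrow> (real \<Rightarrow> real) \<Rightarrow> real \<Rightarrow> (nat \<Rightarrow> nat \<Rightarrow> real) set" where
  "gen_bradley_terry n F M = {\<theta> \<in> matrices n UNIV. \<exists>w \<in> {1..n} \<rightarrow> {-M..M}.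
     (\<forall>i\<in>{1..n}. \<theta> i i = 0) \<and>
     (\<forall>i\<in>{1..n}. \<forall>j\<in>{1..n}. i \<noteq> j \<longrightarrow> \<theta> i j = F (w i - w j))}"

definition gen_beta :: "nat \<Rightarrow> (real \<Rightarrow> real) \<Rightarrow> real \<Rightarrow> (nat \<Rightarrow> nat \<Rightarrow> real) set" where
  "gen_beta n F M = {\<theta> \<in> matrices n UNIV. \<exists>w \<in> {1..n} \<rightarrow> {-M..M}.
     (\<forall>i\<in>{1..n}. \<theta> i i = 0) \<and>
     (\<forall>i\<in>{1..n}. \<forall>j\<in>{1..n}. i \<noteq> j \<longrightarrow> \<theta> i j = F (w i + w j))}"

end

theory Submission
  imports Defs
begin

text \<open>Divide the centered data by p to get a noise matrix with entries bounded by 1/p and variances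
  at most 1/p. The row sums of the noise are O(sqrt (n log n / p)), so the estimated ordering
  misplaces weights by O(sqrt (log n / (n p)) / L') only; this costs n log n (L/L')^2 / p in squared
  distance, by the Lipschitz bound on F. Minimality of the projection then bounds the
  remaining squared error by the pairing of the reordered noise with H = B - A, where B and A are two
  members of the model set.

  To bound this pairing for all orderings at once, split H into its dyadic martingale differences.
  At scale s = 2^k, monotonicity makes the block coefficients of each of A and B sum to O(n/s) by
  telescoping. Coefficients above 1/s live on O(n) blocks; the others are dominated by signs times 1/s
  on O(n) blocks. Hence exp (O(n log n)) test matrices G per scale suffice, even with arbitrary
  permutations, and for each of them Bernstein's inequality in the form
  noise(G) <= |G|^2/32 + 64 u/p, with failure probability exp (-u), applies with u of order n log n.
  By orthogonality, the terms |G|^2 add up to at most |H|^2 over all scales and are absorbed, leaving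
  O(log n) times n log n / p.\<close>

section \<open>Dyadic averages of bimonotone matrices\<close>

text \<open>The obstacle is that both the ordering \<sigma> and the projection \<open>B\<close> are
  functions of the very noise that they are paired with, so a tail bound for a fixed matrix says
  nothing about this pairing. The test matrices must be fixed beforehand and be few enough for a
  union bound, yet rich enough to control every \<open>B - A\<close>.

  The constants fit together as follows. The weight 1/32 of the squared norm doubles to 1/16 when
  the diagonal is filled in, doubles again because the noise enters with a factor p / p_hat of at
  most 2, and joins the 1/8 spent on the other error terms; after the factor 2 from the projection,
  half of the squared error is absorbed and half remains. Dividing the data by the estimated rate
  instead of \<open>p\<close> adds a bias of squared norm O(log n / p). The concentration events
  fail with probability at most 5/n; as the loss never exceeds n^2, this costs at most 5 n, which
  the (log n)^2 term covers because p \<le> 1. For n < 32 the trivial bound on the loss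
  suffices.\<close>

definition cell :: "nat \<Rightarrow> nat \<Rightarrow> nat \<times> nat \<Rightarrow> (nat \<times> nat) set" where
  "cell n k x = {y \<in> {..<n} \<times> {..<n}. fst y div 2 ^ k = fst x div 2 ^ k \<and> snd y div 2 ^ k = snd x div 2 ^ k}"

text \<open>Conditional expectation under the uniform law on the square, given the partition into
  dyadic cells of side 2^k. Cells at the border are cut off by the square, hence the division by the
  actual size.\<close>

definition cell_avg :: "nat \<Rightarrow> nat \<Rightarrow> (nat \<times> nat \<Rightarrow> real) \<Rightarrow> nat \<times> nat \<Rightarrow> real" where
  "cell_avg n k f x = (\<Sum>y\<in>cell n k x. f y) / real (card (cell n k x))"

lemma finite_cell [simp]: "finite (cell n k x)"
  unfolding cell_def by (rule finite_subset[of _ "{..<n} \<times> {..<n}"]) auto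

lemma cell_self: "x \<in> {..<n} \<times> {..<n} \<Longrightarrow> x \<in> cell n k x"
  unfolding cell_def by auto

lemma cell_sym: "x \<in> {..<n} \<times> {..<n} \<Longrightarrow> y \<in> cell n k x \<Longrightarrow> x \<in> cell n k y"
  unfolding cell_def by auto

lemma card_cell_pos: "x \<in> {..<n} \<times> {..<n} \<Longrightarrow> 0 < card (cell n k x)"
  using cell_self[of x n k] by (auto simp: card_gt_0_iff)

lemma cell_eq: "y \<in> cell n k x \<Longrightarrow> cell n k y = cell n k x"
  unfolding cell_def by auto

lemma cell_mono:
  assumes "k \<le> l" shows "cell n k x \<subseteq> cell n l x"
proof -
  have *: "a div 2 ^ l = a div 2 ^ k div 2 ^ (l - k)" for a :: nat
    using assms by (simp add: div_mult2_eq[symmetric] power_add[symmetric])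
  show ?thesis unfolding cell_def by (auto simp: *)
qed

lemma cell_avg_cong: "y \<in> cell n k x \<Longrightarrow> cell_avg n k f y = cell_avg n k f x"
  unfolding cell_avg_def by (simp add: cell_eq)

text \<open>Tower property: an average over the coarser cells is already constant on each finer
  cell.\<close>

lemma cell_avg_cell_avg:
  assumes "k \<le> l" "x \<in> {..<n} \<times> {..<n}"
  shows "cell_avg n k (cell_avg n l f) x = cell_avg n l f x"
proof -
  have "(\<Sum>y\<in>cell n k x. cell_avg n l f y) = (\<Sum>y\<in>cell n k x. cell_avg n l f x)"
    by (intro sum.cong refl cell_avg_cong subsetD[OF cell_mono[OF assms(1)]])
  then show ?thesis
    unfolding cell_avg_def[of n k] using card_cell_pos[OF assms(2), of k] by auto
qed

text \<open>The averaging kernel is symmetric: lying in a common cell is an equivalence relation,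
  and equivalent points have cells of the same size.\<close>

lemma cell_avg_self_adjoint:
  "(\<Sum>x\<in>{..<n} \<times> {..<n}. cell_avg n k f x * g x) = (\<Sum>x\<in>{..<n} \<times> {..<n}. f x * cell_avg n k g x)"
proof -
  let ?X = "{..<n} \<times> {..<n}"
  have expand: "(\<Sum>x\<in>?X. cell_avg n k f x * g x)
      = (\<Sum>x\<in>?X. \<Sum>y | y \<in> ?X \<and> y \<in> cell n k x. f y * g x / real (card (cell n k x)))" for f g
    unfolding cell_avg_def
    by (intro sum.cong refl) (auto simp: sum_divide_distrib sum_distrib_right cell_def intro!: sum.cong)
  have "(\<Sum>x\<in>?X. cell_avg n k f x * g x)
      = (\<Sum>y\<in>?X. \<Sum>x | x \<in> ?X \<and> y \<in> cell n k x. f y * g x / real (card (cell n k x)))"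
    unfolding expand by (rule sum.swap_restrict) auto
  also have "\<dots> = (\<Sum>y\<in>?X. \<Sum>x | x \<in> ?X \<and> x \<in> cell n k y. g x * f y / real (card (cell n k y)))"
  proof (rule sum.cong[OF refl])
    fix y assume y: "y \<in> ?X"
    have "{x. x \<in> ?X \<and> y \<in> cell n k x} = {x. x \<in> ?X \<and> x \<in> cell n k y}"
      using y cell_sym by blast
    then show "(\<Sum>x | x \<in> ?X \<and> y \<in> cell n k x. f y * g x / real (card (cell n k x)))
        = (\<Sum>x | x \<in> ?X \<and> x \<in> cell n k y. g x * f y / real (card (cell n k y)))"
      by (rule sum.cong) (metis (mono_tags, lifting) cell_eq mem_Collect_eq mult.commute)
  qed
  also have "\<dots> = (\<Sum>x\<in>?X. cell_avg n k g x * f x)" unfolding expand ..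
  finally show ?thesis by (simp add: mult.commute)
qed

text \<open>Self-adjointness and the tower property make the coarse average an orthogonal projection
  of the fine one, so the mixed term equals the squared norm of the coarse average.\<close>

lemma cell_avg_pythagoras:
  assumes "k \<le> l"
  shows "(\<Sum>x\<in>{..<n} \<times> {..<n}. (cell_avg n k f x - cell_avg n l f x)\<^sup>2)
    = (\<Sum>x\<in>{..<n} \<times> {..<n}. (cell_avg n k f x)\<^sup>2) - (\<Sum>x\<in>{..<n} \<times> {..<n}. (cell_avg n l f x)\<^sup>2)"
proof -
  let ?X = "{..<n} \<times> {..<n}"
  have inner: "(\<Sum>x\<in>?X. cell_avg n j f x * cell_avg n l f x) = (\<Sum>x\<in>?X. f x * cell_avg n l f x)"
    if "j \<le> l" for j
    unfolding cell_avg_self_adjoint by (intro sum.cong refl) (simp add: cell_avg_cell_avg[OF that])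
  have "(\<Sum>x\<in>?X. (cell_avg n k f x - cell_avg n l f x)\<^sup>2)
     = (\<Sum>x\<in>?X. (cell_avg n k f x)\<^sup>2) + (\<Sum>x\<in>?X. (cell_avg n l f x)\<^sup>2)
       - 2 * (\<Sum>x\<in>?X. cell_avg n k f x * cell_avg n l f x)"
    by (simp add: power2_diff sum.distrib sum_subtractf sum_distrib_left mult.assoc)
  also have "(\<Sum>x\<in>?X. cell_avg n k f x * cell_avg n l f x) = (\<Sum>x\<in>?X. (cell_avg n l f x)\<^sup>2)"
    using inner[OF assms] inner[of l] by (simp add: power2_eq_square)
  finally show ?thesis by simp
qed

lemma cell_avg_0:
  assumes "x \<in> {..<n} \<times> {..<n}" shows "cell_avg n 0 f x = f x"
proof -
  have "cell n 0 x = {x}" using assms by (auto simp: cell_def)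
  then show ?thesis by (simp add: cell_avg_def)
qed

definition detail :: "nat \<Rightarrow> nat \<Rightarrow> (nat \<times> nat \<Rightarrow> real) \<Rightarrow> nat \<times> nat \<Rightarrow> real" where
  "detail n k f x = cell_avg n k f x - cell_avg n (Suc k) f x"

lemma detail_telescope:
  assumes "x \<in> {..<n} \<times> {..<n}"
  shows "f x = (\<Sum>k<m. detail n k f x) + cell_avg n m f x"
proof -
  have "(\<Sum>k<m. detail n k f x) = cell_avg n 0 f x - cell_avg n m f x"
    unfolding detail_def by (rule sum_lessThan_telescope')
  then show ?thesis using cell_avg_0[OF assms, of f] by simp
qed

lemma detail_parseval:
  "(\<Sum>k<m. \<Sum>x\<in>{..<n} \<times> {..<n}. (detail n k f x)\<^sup>2) + (\<Sum>x\<in>{..<n} \<times> {..<n}. (cell_avg n m f x)\<^sup>2)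
    = (\<Sum>x\<in>{..<n} \<times> {..<n}. (f x)\<^sup>2)"
proof -
  let ?N = "\<lambda>k. \<Sum>x\<in>{..<n} \<times> {..<n}. (cell_avg n k f x)\<^sup>2"
  have "(\<Sum>k<m. \<Sum>x\<in>{..<n} \<times> {..<n}. (detail n k f x)\<^sup>2) = (\<Sum>k<m. ?N k - ?N (Suc k))"
    unfolding detail_def by (intro sum.cong refl cell_avg_pythagoras) simp
  also have "\<dots> = ?N 0 - ?N m" by (rule sum_lessThan_telescope')
  also have "?N 0 = (\<Sum>x\<in>{..<n} \<times> {..<n}. (f x)\<^sup>2)"
    by (intro sum.cong refl) (simp add: cell_avg_0)
  finally show ?thesis by simp
qed

lemma cell_avg_diff: "cell_avg n k (\<lambda>x. f x - g x) x = cell_avg n k f x - cell_avg n k g x"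
  unfolding cell_avg_def by (simp add: sum_subtractf diff_divide_distrib)

lemma detail_diff: "detail n k (\<lambda>x. f x - g x) x = detail n k f x - detail n k g x"
  unfolding detail_def by (simp add: cell_avg_diff)

lemma cell_avg_between:
  assumes "x \<in> {..<n} \<times> {..<n}" "\<And>y. y \<in> cell n k x \<Longrightarrow> l \<le> f y" "\<And>y. y \<in> cell n k x \<Longrightarrow> f y \<le> u"
  shows "l \<le> cell_avg n k f x" "cell_avg n k f x \<le> u"
proof -
  have "real (card (cell n k x)) * l \<le> sum f (cell n k x)"
    using sum_bounded_below[of "cell n k x" l f] assms(2) by simp
  moreover have "sum f (cell n k x) \<le> real (card (cell n k x)) * u"
    using sum_bounded_above[of "cell n k x" f u] assms(3) by simp
  ultimately show "l \<le> cell_avg n k f x" "cell_avg n k f x \<le> u"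
    unfolding cell_avg_def using card_cell_pos[OF assms(1), of k] by (simp_all add: field_simps)
qed

section \<open>Mass of the details of a bimonotone matrix\<close>

definition bimono :: "nat \<Rightarrow> (nat \<times> nat \<Rightarrow> real) \<Rightarrow> bool" where
  "bimono n B \<longleftrightarrow> (\<forall>x\<in>{..<n} \<times> {..<n}. B x \<in> {0..1}) \<and>
     (\<forall>i j i' j'. i \<le> i' \<longrightarrow> i' < n \<longrightarrow> j \<le> j' \<longrightarrow> j' < n \<longrightarrow> B (i, j) \<le> B (i', j'))"

lemma bimonoD:
  assumes "bimono n B"
  shows "i < n \<Longrightarrow> j < n \<Longrightarrow> 0 \<le> B (i, j)" "i < n \<Longrightarrow> j < n \<Longrightarrow> B (i, j) \<le> 1"
    "i \<le> i' \<Longrightarrow> i' < n \<Longrightarrow> j \<le> j' \<Longrightarrow> j' < n \<Longrightarrow> B (i, j) \<le> B (i', j')"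
  using assms unfolding bimono_def by auto

lemma sum_div_2: "(\<Sum>a<2 * K. f (a div 2 :: nat)) = 2 * (\<Sum>a<K. f a :: real)"
  by (induction K) (simp_all add: algebra_simps)

text \<open>A diagonal step splits into one step in each index. Each kind telescopes along its line
  to at most 1, and there are \<open>K\<close> lines in each direction.\<close>

lemma sum_diagonal_increments_le:
  fixes g :: "nat \<Rightarrow> nat \<Rightarrow> real"
  assumes "\<And>a b. g a b \<in> {0..1}"
  shows "(\<Sum>a<K. \<Sum>b<K. g (Suc a) (Suc b) - g a b) \<le> 2 * real K"
proof -
  have "(\<Sum>a<K. \<Sum>b<K. g (Suc a) (Suc b) - g a b)
      = (\<Sum>b<K. \<Sum>a<K. g (Suc a) (Suc b) - g a (Suc b)) + (\<Sum>a<K. \<Sum>b<K. g a (Suc b) - g a b)"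
    by (subst sum.swap[of _ "{..<K}" "{..<K}" for f], subst sum.swap)
       (simp add: sum.distrib[symmetric])
  also have "\<dots> = (\<Sum>b<K. g K (Suc b) - g 0 (Suc b)) + (\<Sum>a<K. g a K - g a 0)"
    by (intro arg_cong2[of _ _ _ _ "(+)"] sum.cong refl)
       (rule sum_lessThan_telescope[of "\<lambda>a. g a (Suc b)" K for b], rule sum_lessThan_telescope)
  also have "\<dots> \<le> (\<Sum>b<K. 1) + (\<Sum>a<K. 1)"
    using assms by (intro add_mono sum_mono) (smt (verit, best) atLeastAtMost_iff)+
  finally show ?thesis by simp
qed

definition blocks :: "nat \<Rightarrow> nat \<Rightarrow> (nat \<times> nat) set" where
  "blocks n k = {(a, b). a * 2 ^ k < n \<and> b * 2 ^ k < n}"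

definition block :: "nat \<Rightarrow> nat \<times> nat \<Rightarrow> nat \<times> nat" where
  "block k x = (fst x div 2 ^ k, snd x div 2 ^ k)"

text \<open>A representative entry of a block: a function that is constant on blocks is read off
  there as a function of the block index.\<close>

definition corner :: "nat \<Rightarrow> nat \<times> nat \<Rightarrow> nat \<times> nat" where
  "corner k q = (fst q * 2 ^ k, snd q * 2 ^ k)"

lemma blocks_subset: "blocks n k \<subseteq> {..<n} \<times> {..<n}"
proof -
  have "a < n" if "a * 2 ^ k < n" for a
    by (rule le_less_trans[OF _ that]) simp
  then show ?thesis unfolding blocks_def by auto
qed

lemma finite_blocks [simp]: "finite (blocks n k)"
  by (rule finite_subset[OF blocks_subset]) auto

lemma block_in_blocks: "x \<in> {..<n} \<times> {..<n} \<Longrightarrow> block k x \<in> blocks n k"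
  unfolding block_def blocks_def
  by (auto intro: le_less_trans[OF div_times_less_eq_dividend])

lemma corner_block_in_cell: "x \<in> {..<n} \<times> {..<n} \<Longrightarrow> corner k (block k x) \<in> cell n k x"
  unfolding block_def corner_def cell_def
  by (auto intro: le_less_trans[OF div_times_less_eq_dividend])

lemma corner_in: "q \<in> blocks n k \<Longrightarrow> corner k q \<in> {..<n} \<times> {..<n}"
  unfolding blocks_def corner_def by auto

lemma detail_block:
  assumes "x \<in> {..<n} \<times> {..<n}"
  shows "detail n k f x = detail n k f (corner k (block k x))"
  using cell_avg_cong[OF corner_block_in_cell[OF assms, of k], of f]
    cell_avg_cong[OF subsetD[OF cell_mono[of k "Suc k"] corner_block_in_cell[OF assms, of k]], of f]
  unfolding detail_def by simp

text \<open>Monotonicity places every entry of the enclosing cell of side 2^(k+1), hence both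
  averages in the detail, between \<open>B\<close> at the lowest corner of this cell and
  \<open>B\<close> at the lowest corner of its diagonal successor. The \<open>min\<close> with
  \<open>n - 1\<close> moves corners outside the square back to its border.\<close>

lemma abs_detail_le:
  fixes B n k
  defines "g \<equiv> \<lambda>a b. B (min (a * 2 ^ Suc k) (n - 1), min (b * 2 ^ Suc k) (n - 1))"
  assumes B: "bimono n B" and x: "x \<in> {..<n} \<times> {..<n}"
  shows "\<bar>detail n k B x\<bar> \<le> g (Suc (fst x div 2 ^ Suc k)) (Suc (snd x div 2 ^ Suc k))
      - g (fst x div 2 ^ Suc k) (snd x div 2 ^ Suc k)"
proof -
  define S :: nat where "S = 2 ^ Suc k"
  have S: "S > 0" by (simp add: S_def)
  define l where "l = g (fst x div S) (snd x div S)"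
  define u where "u = g (Suc (fst x div S)) (Suc (snd x div S))"
  have n: "n > 0" using x by auto
  have bounds: "l \<le> B y \<and> B y \<le> u" if y: "y \<in> cell n (Suc k) x" for y
  proof -
    obtain i j where ij: "y = (i, j)" by force
    have lt: "i < n" "j < n" and d: "i div S = fst x div S" "j div S = snd x div S"
      using y ij unfolding cell_def S_def by auto
    have lo: "a div S * S \<le> a" for a by simp
    have hi: "a \<le> Suc (a div S) * S" for a
      using dividend_less_div_times[OF S, of a] by simp
    have "l \<le> B y"
      unfolding l_def g_def S_def[symmetric] ij d[symmetric]
      by (rule bimonoD(3)[OF B]) (use lo[of i] lo[of j] lt in \<open>auto intro: min.coboundedI1\<close>)
    moreover have "B y \<le> u"
      unfolding u_def g_def S_def[symmetric] ij d[symmetric]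
      by (rule bimonoD(3)[OF B]) (use hi[of i] hi[of j] lt n in \<open>auto simp del: mult_Suc\<close>)
    ultimately show ?thesis ..
  qed
  have "l \<le> cell_avg n k B x" "cell_avg n k B x \<le> u"
    using cell_avg_between[OF x, of k l B u] bounds cell_mono[of k "Suc k" n x] by auto
  moreover have "l \<le> cell_avg n (Suc k) B x" "cell_avg n (Suc k) B x \<le> u"
    using cell_avg_between[OF x, of "Suc k" l B u] bounds by auto
  ultimately show ?thesis
    unfolding detail_def S_def[symmetric] l_def[symmetric] u_def[symmetric] by linarith
qed

text \<open>Each bound from \<open>abs_detail_le\<close> belongs to a cell of side 2^(k+1), shared
  by at most four blocks of side 2^k. Over a \<open>K\<close> by \<open>K\<close> array of such
  cells the diagonal increments add up to at most 2 K, so the total is at most 8 K, and K \<le> 3 n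
  / 2^(k+1) makes it 12 n / 2^k.\<close>

lemma sum_abs_detail_le:
  assumes B: "bimono n B" and n: "2 ^ Suc k \<le> 2 * n"
  shows "(\<Sum>q\<in>blocks n k. \<bar>detail n k B (corner k q)\<bar>) \<le> 12 * real n / 2 ^ k"
proof -
  define g where "g = (\<lambda>a b. B (min (a * 2 ^ Suc k) (n - 1), min (b * 2 ^ Suc k) (n - 1)))"
  define K where "K = n div 2 ^ Suc k + 1"
  have n0: "n > 0" using n by (cases n) auto
  have g01: "g a b \<in> {0..1}" for a b
    using B n0 unfolding g_def bimono_def by auto
  have gm: "g a b \<le> g (Suc a) (Suc b)" for a b
    unfolding g_def by (rule bimonoD(3)[OF B]) (use n0 in auto)
  define F where "F = (\<lambda>a b. g (Suc a) (Suc b) - g a b)"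
  have F0: "F a b \<ge> 0" for a b using gm[of a b] unfolding F_def by simp
  have lt: "a < 2 * K" if "a * 2 ^ k < n" for a
  proof -
    have "a \<le> n div 2 ^ k" using that by (simp add: less_eq_div_iff_mult_less_eq)
    then have "a div 2 \<le> n div 2 ^ k div 2" by (rule div_le_mono)
    also have "\<dots> = n div 2 ^ Suc k" by (simp add: div_mult2_eq[symmetric] mult.commute)
    finally have "a div 2 < K" unfolding K_def by simp
    then show ?thesis by (simp add: div_less_iff_less_mult mult.commute)
  qed
  have "(\<Sum>q\<in>blocks n k. \<bar>detail n k B (corner k q)\<bar>) \<le> (\<Sum>q\<in>blocks n k. F (fst q div 2) (snd q div 2))"
  proof (rule sum_mono)
    fix q assume q: "q \<in> blocks n k"
    have "a * 2 ^ k div 2 ^ Suc k = a div 2" for a :: nat by simp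
    with abs_detail_le[OF B corner_in[OF q], of k]
    show "\<bar>detail n k B (corner k q)\<bar> \<le> F (fst q div 2) (snd q div 2)"
      unfolding F_def g_def corner_def by (simp del: power_Suc)
  qed
  also have "\<dots> \<le> (\<Sum>q\<in>{..<2 * K} \<times> {..<2 * K}. F (fst q div 2) (snd q div 2))"
    by (rule sum_mono2) (use lt F0 in \<open>auto simp: blocks_def\<close>)
  also have "\<dots> = (\<Sum>a<2 * K. \<Sum>b<2 * K. F (a div 2) (b div 2))"
    by (simp add: sum.cartesian_product split_beta)
  also have "\<dots> = 4 * (\<Sum>a<K. \<Sum>b<K. F a b)"
    using sum_div_2[where f = "\<lambda>a. 2 * (\<Sum>b<K. F a b)" and K = K]
    by (simp only: sum_div_2) (simp add: sum_distrib_left[symmetric])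
  also have "\<dots> \<le> 4 * (2 * real K)"
    unfolding F_def using sum_diagonal_increments_le[where g = g and K = K, OF g01] by simp
  \<comment> \<open>The hypothesis gives 2^k \<le> n, so the 1 added to the quotient is at most 2 n
    / 2^(k+1).\<close>
  also have "real K \<le> 3 * real n / 2 ^ Suc k"
  proof -
    have "real (n div 2 ^ Suc k) \<le> real n / real (2 ^ Suc k)" by (rule of_nat_div_le_of_nat)
    moreover have "2 ^ k \<le> real n"
      using of_nat_mono[OF n, where 'a = real] by simp
    ultimately show ?thesis unfolding K_def by (simp add: field_simps del: numeral_power_le_of_nat_cancel_iff)
  qed
  finally show ?thesis by simp
qed

section \<open>Block coefficients of small mass\<close>

lemma exists_top_subset:
  fixes v :: "'a \<Rightarrow> real"
  assumes "finite U" "m \<le> card U"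
  shows "\<exists>S\<subseteq>U. card S = m \<and> (\<forall>x\<in>S. \<forall>y\<in>U - S. v y \<le> v x)"
  using assms(2)
proof (induction m)
  case 0
  then show ?case by (intro exI[of _ "{}"]) auto
next
  case (Suc m)
  then obtain S where S: "S \<subseteq> U" "card S = m" "\<forall>x\<in>S. \<forall>y\<in>U - S. v y \<le> v x" by auto
  have fin: "finite (U - S)" "finite S" using assms(1) S(1) finite_subset by auto
  have "U - S \<noteq> {}" using Suc.prems S(1,2) by (metis Diff_eq_empty_iff Suc_n_not_le_n subset_antisym)
  then have "Max (v ` (U - S)) \<in> v ` (U - S)" using fin by (intro Max_in) auto
  then obtain y where y: "y \<in> U - S" "v y = Max (v ` (U - S))" by auto
  then have "\<forall>z\<in>U - S. v z \<le> v y" using fin by simp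
  then show ?case using S y fin by (intro exI[of _ "insert y S"]) auto
qed

text \<open>The polytope of vectors with entries at most u in modulus and total mass at most m u has
  signed indicators of sets of size at most m, times u, as its extreme points.\<close>

lemma bounded_mass_pairing:
  fixes v :: "'a \<Rightarrow> real"
  assumes "finite U"
  obtains S where "S \<subseteq> U" "card S \<le> m"
    "\<And>c u. (\<And>x. x \<in> U \<Longrightarrow> \<bar>c x\<bar> \<le> u) \<Longrightarrow> (\<Sum>x\<in>U. \<bar>c x\<bar>) \<le> real m * u \<Longrightarrow>
       (\<Sum>x\<in>U. c x * v x) \<le> u * (\<Sum>x\<in>S. \<bar>v x\<bar>)"
proof (cases "m \<le> card U")
  case False
  have "(\<Sum>x\<in>U. c x * v x) \<le> u * (\<Sum>x\<in>U. \<bar>v x\<bar>)" if "\<And>x. x \<in> U \<Longrightarrow> \<bar>c x\<bar> \<le> u" for c u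
    unfolding sum_distrib_left
  proof (rule sum_mono)
    fix x assume "x \<in> U"
    have "c x * v x \<le> \<bar>c x\<bar> * \<bar>v x\<bar>" by (metis abs_ge_self abs_mult)
    also have "\<dots> \<le> u * \<bar>v x\<bar>" using that[OF \<open>x \<in> U\<close>] by (rule mult_right_mono) simp
    finally show "c x * v x \<le> u * \<bar>v x\<bar>" .
  qed
  with False show ?thesis by (intro that[of U]) auto
next
  case True
  obtain S where S: "S \<subseteq> U" "card S = m" "\<And>x y. x \<in> S \<Longrightarrow> y \<in> U - S \<Longrightarrow> \<bar>v y\<bar> \<le> \<bar>v x\<bar>"
    using exists_top_subset[OF assms True, of "\<lambda>x. \<bar>v x\<bar>"] by blast
  have fin: "finite S" "finite (U - S)" using assms S(1) finite_subset by auto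
  \<comment> \<open>The threshold \<open>t\<close> is the largest modulus outside \<open>S\<close>,
    and 0 if nothing is left outside.\<close>
  obtain t where t: "t \<ge> 0" "\<And>y. y \<in> U - S \<Longrightarrow> \<bar>v y\<bar> \<le> t" "\<And>x. x \<in> S \<Longrightarrow> U - S \<noteq> {} \<Longrightarrow> t \<le> \<bar>v x\<bar>"
  proof (cases "U - S = {}")
    case True
    then show ?thesis using that[of 0] by auto
  next
    case False
    have "Max ((\<lambda>y. \<bar>v y\<bar>) ` (U - S)) \<in> (\<lambda>y. \<bar>v y\<bar>) ` (U - S)"
      using False fin by (intro Max_in) auto
    then obtain y where y: "y \<in> U - S" "\<bar>v y\<bar> = Max ((\<lambda>y. \<bar>v y\<bar>) ` (U - S))" by auto
    have "\<bar>v z\<bar> \<le> \<bar>v y\<bar>" if "z \<in> U - S" for z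
      unfolding y(2) using fin(2) that by (intro Max_ge) auto
    with S(3) y(1) show ?thesis by (intro that[of "\<bar>v y\<bar>"]) (simp, blast, blast)
  qed
  have "(\<Sum>x\<in>U. c x * v x) \<le> u * (\<Sum>x\<in>S. \<bar>v x\<bar>)"
    if c: "\<And>x. x \<in> U \<Longrightarrow> \<bar>c x\<bar> \<le> u" "(\<Sum>x\<in>U. \<bar>c x\<bar>) \<le> real m * u" for c u
  proof -
    have cv: "c x * v x \<le> \<bar>c x\<bar> * \<bar>v x\<bar>" for x by (metis abs_ge_self abs_mult)
    have split: "sum f U = sum f S + sum f (U - S)" for f :: "'a \<Rightarrow> real"
      using sum.subset_diff[OF S(1) assms, of f] by simp
    have "(\<Sum>x\<in>U - S. c x * v x) \<le> (\<Sum>x\<in>U - S. \<bar>c x\<bar> * t)"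
      by (intro sum_mono order_trans[OF cv] mult_left_mono t) auto
    also have "\<dots> = t * (\<Sum>x\<in>U - S. \<bar>c x\<bar>)" by (simp add: sum_distrib_left mult.commute)
    finally have rest: "(\<Sum>x\<in>U - S. c x * v x) \<le> t * (\<Sum>x\<in>U - S. \<bar>c x\<bar>)" .
    show ?thesis
    proof (cases "U - S = {}")
      case True
      then have "U = S" using S(1) by auto
      have "c x * v x \<le> u * \<bar>v x\<bar>" if "x \<in> U" for x
        using cv[of x] mult_right_mono[OF c(1)[OF that], of "\<bar>v x\<bar>"] by simp
      then show ?thesis unfolding \<open>U = S\<close> sum_distrib_left by (intro sum_mono) (auto simp: \<open>U = S\<close>)
    next
      case False
      \<comment> \<open>The mass of \<open>c\<close> outside \<open>S\<close> is at most the slack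
        that \<open>c\<close> leaves on \<open>S\<close> below the cap \<open>u\<close>. Moving it
        onto \<open>S\<close> can only help, since a unit of mass is worth at most \<open>t\<close>
        outside and at least \<open>t\<close> inside.\<close>
      have "t * (\<Sum>x\<in>U - S. \<bar>c x\<bar>) \<le> t * (real m * u - (\<Sum>x\<in>S. \<bar>c x\<bar>))"
        using c(2) split[of "\<lambda>x. \<bar>c x\<bar>"] by (intro mult_left_mono t(1)) simp
      also have "\<dots> = (\<Sum>x\<in>S. t * (u - \<bar>c x\<bar>))"
        using S(2) by (simp add: sum_distrib_left[symmetric] sum_subtractf algebra_simps)
      also have "\<dots> \<le> (\<Sum>x\<in>S. \<bar>v x\<bar> * (u - \<bar>c x\<bar>))"
        using t(3) False c(1) S(1) by (intro sum_mono mult_right_mono) auto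
      finally have "(\<Sum>x\<in>U. c x * v x) \<le> (\<Sum>x\<in>S. c x * v x) + (\<Sum>x\<in>S. \<bar>v x\<bar> * (u - \<bar>c x\<bar>))"
        using rest split[of "\<lambda>x. c x * v x"] by simp
      also have "\<dots> \<le> (\<Sum>x\<in>S. \<bar>c x\<bar> * \<bar>v x\<bar>) + (\<Sum>x\<in>S. \<bar>v x\<bar> * (u - \<bar>c x\<bar>))"
        by (intro add_right_mono sum_mono cv)
      also have "\<dots> = u * (\<Sum>x\<in>S. \<bar>v x\<bar>)"
        by (simp add: sum.distrib[symmetric] sum_distrib_left algebra_simps)
      finally show ?thesis .
    qed
  qed
  then show ?thesis using S by (intro that[of S]) auto
qed

text \<open>The range [-2, 2] is that of a difference of two averages of entries in [-1, 1].\<close>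

definition grid :: "nat \<Rightarrow> real set" where
  "grid D = (\<lambda>z. of_int z / real D) ` {- 2 * int D..2 * int D}"

text \<open>Rounding is towards 0, so that it neither enlarges the support nor increases the squared
  norm.\<close>

lemma grid_round:
  assumes "\<bar>c\<bar> \<le> 2" "D > 0"
  obtains g where "g \<in> grid D" "\<bar>g\<bar> \<le> \<bar>c\<bar>" "\<bar>c - g\<bar> \<le> 1 / real D"
proof -
  define z where "z = \<lfloor>\<bar>c\<bar> * real D\<rfloor>"
  have z: "0 \<le> z" "of_int z \<le> \<bar>c\<bar> * real D" "\<bar>c\<bar> * real D \<le> of_int z + 1"
    unfolding z_def by (simp, linarith, linarith)
  have "\<bar>c\<bar> * real D \<le> 2 * real D" using assms by simp
  then have z2: "z \<le> 2 * int D" using z(2) by linarith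
  have zD: "of_int z / real D \<le> \<bar>c\<bar>" "\<bar>c\<bar> \<le> of_int z / real D + 1 / real D"
    using z assms(2) by (simp_all add: field_simps)
  have "of_int z / real D \<ge> 0" using z by simp
  show ?thesis
  proof (cases "c \<ge> 0")
    case True
    show ?thesis using z z2 zD True \<open>0 \<le> of_int z / real D\<close>
      by (intro that[of "of_int z / real D"]) (auto simp: grid_def)
  next
    case False
    show ?thesis using z z2 zD False \<open>0 \<le> of_int z / real D\<close>
      by (intro that[of "of_int (- z) / real D"]) (auto simp: grid_def intro!: image_eqI[of _ _ "- z"])
  qed
qed

lemma zero_in_grid: "0 \<in> grid D"
  unfolding grid_def by (rule image_eqI[of _ _ 0]) auto

text \<open>The grid and the sparsity of c make the family of test matrices finite, of size
  exp (O(n log n)).\<close>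

definition controlled :: "nat \<Rightarrow> (nat \<times> nat \<Rightarrow> real) \<Rightarrow> nat \<Rightarrow> nat \<Rightarrow> real \<Rightarrow> real \<Rightarrow> nat \<Rightarrow> bool" where
  "controlled n e m D \<epsilon> W k \<longleftrightarrow>
     (\<forall>c. range c \<subseteq> grid D \<longrightarrow> (\<forall>q. q \<notin> blocks n k \<longrightarrow> c q = 0) \<longrightarrow> card {q. c q \<noteq> 0} \<le> m \<longrightarrow>
        (\<Sum>x\<in>{..<n} \<times> {..<n}. e x * c (block k x))
          \<le> \<epsilon> * (\<Sum>x\<in>{..<n} \<times> {..<n}. (c (block k x))\<^sup>2) + W)"

lemma sum_over_blocks:
  "(\<Sum>x\<in>{..<n} \<times> {..<n}. h x * c (block k x) :: real)
    = (\<Sum>q\<in>blocks n k. c q * (\<Sum>x | x \<in> {..<n} \<times> {..<n} \<and> block k x = q. h x))"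
proof -
  have "(\<Sum>x\<in>{..<n} \<times> {..<n}. h x * c (block k x))
      = (\<Sum>q\<in>blocks n k. \<Sum>x | x \<in> {..<n} \<times> {..<n} \<and> block k x = q. h x * c (block k x))"
    by (rule sum.group[symmetric]) (auto simp del: mem_Sigma_iff intro: block_in_blocks)
  also have "\<dots> = (\<Sum>q\<in>blocks n k. c q * (\<Sum>x | x \<in> {..<n} \<times> {..<n} \<and> block k x = q. h x))"
    by (intro sum.cong refl) (simp add: sum_distrib_left mult.commute)
  finally show ?thesis .
qed

lemma card_block_le: "card {x. x \<in> {..<n} \<times> {..<n} \<and> block k x = q} \<le> 4 ^ k"
proof -
  have "{x. x \<in> {..<n} \<times> {..<n} \<and> block k x = q}
      \<subseteq> {fst q * 2 ^ k..<fst q * 2 ^ k + 2 ^ k} \<times> {snd q * 2 ^ k..<snd q * 2 ^ k + 2 ^ k}"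
    unfolding block_def
    by (auto simp: div_times_less_eq_dividend dividend_less_div_times add.commute)
  then have "card {x. x \<in> {..<n} \<times> {..<n} \<and> block k x = q}
      \<le> card ({fst q * 2 ^ k..<fst q * 2 ^ k + 2 ^ k} \<times> {snd q * 2 ^ k..<snd q * 2 ^ k + 2 ^ k})"
    by (rule card_mono[rotated]) simp
  also have "\<dots> = 4 ^ k" by (simp add: card_cartesian_product power_mult_distrib[symmetric])
  finally show ?thesis .
qed

text \<open>Rounding \<open>c\<close> to the grid gives an admissible test function. The rounding
  costs at most E / D per entry, hence at most \<open>E\<close> over the n^2 \<le> D
  entries.\<close>

lemma controlled_large_part:
  assumes ctrl: "controlled n e m D \<epsilon> W k" and \<epsilon>: "\<epsilon> \<ge> 0" and D: "D > 0" "n\<^sup>2 \<le> D"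
    and E: "\<And>x. x \<in> {..<n} \<times> {..<n} \<Longrightarrow> \<bar>e x\<bar> \<le> E" "E \<ge> 0"
    and c: "\<And>q. \<bar>c q\<bar> \<le> 2" "\<And>q. q \<notin> blocks n k \<Longrightarrow> c q = 0" "card {q. c q \<noteq> 0} \<le> m"
  shows "(\<Sum>x\<in>{..<n} \<times> {..<n}. e x * c (block k x))
    \<le> \<epsilon> * (\<Sum>x\<in>{..<n} \<times> {..<n}. (c (block k x))\<^sup>2) + W + E"
proof -
  let ?X = "{..<n} \<times> {..<n}"
  have "\<exists>g. g \<in> grid D \<and> \<bar>g\<bar> \<le> \<bar>c q\<bar> \<and> \<bar>c q - g\<bar> \<le> 1 / real D" for q
    using grid_round[OF c(1)[of q] D(1)] by blast
  then obtain g where g: "\<And>q. g q \<in> grid D" "\<And>q. \<bar>g q\<bar> \<le> \<bar>c q\<bar>" "\<And>q. \<bar>c q - g q\<bar> \<le> 1 / real D"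
    by metis
  have supp: "{q. g q \<noteq> 0} \<subseteq> {q. c q \<noteq> 0}" using g(2) by (auto simp: abs_le_zero_iff) (metis abs_le_zero_iff abs_zero)
  have fin: "finite {q. c q \<noteq> 0}"
    by (rule finite_subset[OF _ finite_blocks[of n k]]) (use c(2) in auto)
  have "card {q. g q \<noteq> 0} \<le> m" using card_mono[OF fin supp] c(3) by linarith
  moreover have "range g \<subseteq> grid D" using g(1) by auto
  moreover have "\<forall>q. q \<notin> blocks n k \<longrightarrow> g q = 0" using supp c(2) by blast
  ultimately have "(\<Sum>x\<in>?X. e x * g (block k x)) \<le> \<epsilon> * (\<Sum>x\<in>?X. (g (block k x))\<^sup>2) + W"
    using ctrl unfolding controlled_def by blast
  also have "(\<Sum>x\<in>?X. (g (block k x))\<^sup>2) \<le> (\<Sum>x\<in>?X. (c (block k x))\<^sup>2)"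
    using g(2) by (intro sum_mono) (simp add: abs_le_square_iff)
  finally have main: "(\<Sum>x\<in>?X. e x * g (block k x)) \<le> \<epsilon> * (\<Sum>x\<in>?X. (c (block k x))\<^sup>2) + W"
    using \<epsilon> by (simp add: mult_left_mono)
  have "(\<Sum>x\<in>?X. e x * (c (block k x) - g (block k x))) \<le> (\<Sum>x\<in>?X. E * (1 / real D))"
  proof (rule sum_mono)
    fix x assume "x \<in> ?X"
    have "e x * (c (block k x) - g (block k x)) \<le> \<bar>e x\<bar> * \<bar>c (block k x) - g (block k x)\<bar>"
      by (metis abs_ge_self abs_mult)
    also have "\<dots> \<le> E * (1 / real D)" using E(1)[OF \<open>x \<in> ?X\<close>] g(3) E(2) by (intro mult_mono) auto
    finally show "e x * (c (block k x) - g (block k x)) \<le> E * (1 / real D)" .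
  qed
  also have "\<dots> = E * (real (n\<^sup>2) / real D)" by (simp add: power2_eq_square)
  also have "\<dots> \<le> E * 1" using D E(2) by (intro mult_left_mono) (auto simp del: of_nat_power)
  finally show ?thesis using main by (simp add: right_diff_distrib sum_subtractf)
qed

text \<open>Under the two bounds on \<open>c\<close> the pairing is at most that of a signed
  indicator of at most \<open>m\<close> blocks, scaled by 1 / 2^k. This extreme function is itself
  an admissible test: its values lie on the grid because 2^k divides \<open>D\<close>. In this way
  coefficients spread over all blocks are controlled by sparse ones.\<close>

lemma controlled_small_part:
  assumes ctrl: "controlled n e m D \<epsilon> W k" and \<epsilon>: "\<epsilon> \<ge> 0" and D: "D > 0" "2 ^ k dvd D"
    and c: "\<And>q. \<bar>c q\<bar> \<le> 1 / 2 ^ k" "(\<Sum>q\<in>blocks n k. \<bar>c q\<bar>) \<le> real m / 2 ^ k"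
  shows "(\<Sum>x\<in>{..<n} \<times> {..<n}. e x * c (block k x)) \<le> \<epsilon> * real m + W"
proof -
  let ?X = "{..<n} \<times> {..<n}"
  define v where "v = (\<lambda>q. \<Sum>x | x \<in> ?X \<and> block k x = q. e x)"
  obtain S where S: "S \<subseteq> blocks n k" "card S \<le> m"
    and pairing: "\<And>c u. (\<And>x. x \<in> blocks n k \<Longrightarrow> \<bar>c x\<bar> \<le> u) \<Longrightarrow>
      (\<Sum>x\<in>blocks n k. \<bar>c x\<bar>) \<le> real m * u \<Longrightarrow>
      (\<Sum>x\<in>blocks n k. c x * v x) \<le> u * (\<Sum>x\<in>S. \<bar>v x\<bar>)"
    by (rule bounded_mass_pairing[OF finite_blocks[of n k], of m v]) blast
  have *: "(\<Sum>q\<in>blocks n k. c q * v q) \<le> 1 / 2 ^ k * (\<Sum>q\<in>S. \<bar>v q\<bar>)"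
    by (rule pairing) (use c in auto)
  have finS: "finite S" using S(1) by (rule finite_subset) simp
  \<comment> \<open>Taking the sign of the block sum \<open>v q\<close> as the value on block
    \<open>q\<close> turns the pairing with \<open>e\<close> into the scaled sum of the moduli of
    \<open>v\<close> over \<open>S\<close>.\<close>
  define d where "d = (\<lambda>q. if q \<in> S then sgn (v q) / 2 ^ k else 0)"
  obtain r where r: "D = 2 ^ k * r" using D(2) by auto
  have "1 / 2 ^ k = of_int (int r) / real D" using D(1) r by simp
  moreover have "int r \<in> {- 2 * int D..2 * int D}"
  proof -
    have "r \<le> D" using r by simp
    then show ?thesis by simp
  qed
  ultimately have "1 / 2 ^ k \<in> grid D" "- 1 / 2 ^ k \<in> grid D"
    unfolding grid_def by (auto intro: image_eqI[of _ _ "int r"] image_eqI[of _ _ "- int r"])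
  then have "range d \<subseteq> grid D"
    using zero_in_grid unfolding d_def sgn_real_def by auto
  moreover have "{q. d q \<noteq> 0} \<subseteq> S" unfolding d_def by auto
  then have "card {q. d q \<noteq> 0} \<le> m" using S(2) card_mono[OF finS, of "{q. d q \<noteq> 0}"] by linarith
  moreover have "\<forall>q. q \<notin> blocks n k \<longrightarrow> d q = 0" unfolding d_def using S(1) by auto
  ultimately have "(\<Sum>x\<in>?X. e x * d (block k x)) \<le> \<epsilon> * (\<Sum>x\<in>?X. (d (block k x))\<^sup>2) + W"
    using ctrl unfolding controlled_def by blast
  moreover have "(\<Sum>x\<in>?X. e x * d (block k x)) = 1 / 2 ^ k * (\<Sum>q\<in>S. \<bar>v q\<bar>)"
  proof -
    have "(\<Sum>x\<in>?X. e x * d (block k x)) = (\<Sum>q\<in>blocks n k. d q * v q)"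
      unfolding v_def by (rule sum_over_blocks)
    also have "\<dots> = (\<Sum>q\<in>S. d q * v q)"
      by (rule sum.mono_neutral_right) (use S(1) in \<open>auto simp: d_def\<close>)
    also have "\<dots> = 1 / 2 ^ k * (\<Sum>q\<in>S. \<bar>v q\<bar>)"
      unfolding sum_distrib_left by (intro sum.cong refl) (auto simp: d_def sgn_real_def)
    finally show ?thesis .
  qed
  moreover have "(\<Sum>x\<in>?X. (d (block k x))\<^sup>2) \<le> real m"
  proof -
    have "(\<Sum>x\<in>?X. (d (block k x))\<^sup>2) = (\<Sum>x\<in>?X. 1 * (d (block k x))\<^sup>2)" by simp
    also have "\<dots> = (\<Sum>q\<in>blocks n k. (d q)\<^sup>2 * (\<Sum>x | x \<in> ?X \<and> block k x = q. 1))"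
      by (rule sum_over_blocks[of "\<lambda>x. 1" "\<lambda>q. (d q)\<^sup>2"])
    also have "\<dots> = (\<Sum>q\<in>S. (d q)\<^sup>2 * (\<Sum>x | x \<in> ?X \<and> block k x = q. 1))"
      by (rule sum.mono_neutral_right) (use S(1) in \<open>auto simp: d_def\<close>)
    \<comment> \<open>A block has at most 4^k entries, each of square at most 1 / 4^k, so every
      block of \<open>S\<close> adds at most 1 to the squared norm.\<close>
    also have "\<dots> \<le> (\<Sum>q\<in>S. 1)"
    proof (rule sum_mono)
      fix q assume "q \<in> S"
      have "(2 ^ k)\<^sup>2 = (4 :: real) ^ k" by (simp add: power2_eq_square power_mult_distrib[symmetric])
      then have "(d q)\<^sup>2 \<le> 1 / 4 ^ k" unfolding d_def by (simp add: power_divide sgn_real_def)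
      moreover have "real (card {x. x \<in> ?X \<and> block k x = q}) \<le> 4 ^ k"
        using of_nat_mono[OF card_block_le[of n k q], where 'a = real] by simp
      ultimately have "(d q)\<^sup>2 * real (card {x. x \<in> ?X \<and> block k x = q}) \<le> 1 / 4 ^ k * 4 ^ k"
        by (intro mult_mono) auto
      then show "(d q)\<^sup>2 * (\<Sum>x | x \<in> ?X \<and> block k x = q. 1) \<le> 1" by simp
    qed
    also have "\<dots> \<le> real m" using S(2) by simp
    finally show ?thesis .
  qed
  ultimately have "1 / 2 ^ k * (\<Sum>q\<in>S. \<bar>v q\<bar>) \<le> \<epsilon> * real m + W"
    using mult_left_mono[OF _ \<epsilon>, of "\<Sum>x\<in>?X. (d (block k x))\<^sup>2" "real m"] by simp
  with * show ?thesis unfolding v_def using sum_over_blocks[of e c k n] by simp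
qed

lemma controlled_level:
  assumes ctrl: "controlled n e m D \<epsilon> W k" and \<epsilon>: "\<epsilon> \<ge> 0"
    and D: "D > 0" "n\<^sup>2 \<le> D" "2 ^ k dvd D"
    and E: "\<And>x. x \<in> {..<n} \<times> {..<n} \<Longrightarrow> \<bar>e x\<bar> \<le> E" "E \<ge> 0"
    and c: "\<And>q. q \<in> blocks n k \<Longrightarrow> \<bar>c q\<bar> \<le> 2" "(\<Sum>q\<in>blocks n k. \<bar>c q\<bar>) \<le> real m / 2 ^ k"
  shows "(\<Sum>x\<in>{..<n} \<times> {..<n}. e x * c (block k x))
    \<le> \<epsilon> * (\<Sum>x\<in>{..<n} \<times> {..<n}. (c (block k x))\<^sup>2) + (\<epsilon> * real m + 2 * W + E)"
proof -
  let ?X = "{..<n} \<times> {..<n}"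
  \<comment> \<open>The threshold is where the mass bound forces the large part to be sparse, while the small
    part has squared norm at most m.\<close>
  define L where "L = {q \<in> blocks n k. \<bar>c q\<bar> > 1 / 2 ^ k}"
  define c1 where "c1 = (\<lambda>q. if q \<in> L then c q else 0)"
  define c2 where "c2 = (\<lambda>q. if q \<in> blocks n k - L then c q else 0)"
  have finL: "finite L" unfolding L_def by simp
  have "real (card L) * (1 / 2 ^ k) \<le> (\<Sum>q\<in>L. \<bar>c q\<bar>)"
    by (rule sum_bounded_below) (auto simp: L_def)
  also have "\<dots> \<le> (\<Sum>q\<in>blocks n k. \<bar>c q\<bar>)" by (rule sum_mono2) (auto simp: L_def)
  finally have "card L \<le> m" using c(2) by (simp add: field_simps)
  moreover have "card {q. c1 q \<noteq> 0} \<le> card L"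
    by (rule card_mono[OF finL]) (auto simp: c1_def)
  ultimately have "card {q. c1 q \<noteq> 0} \<le> m" by linarith
  then have large: "(\<Sum>x\<in>?X. e x * c1 (block k x)) \<le> \<epsilon> * (\<Sum>x\<in>?X. (c1 (block k x))\<^sup>2) + W + E"
    using c(1) by (intro controlled_large_part[OF ctrl \<epsilon> D(1,2) E]) (auto simp: c1_def L_def)
  have "(\<Sum>q\<in>blocks n k. \<bar>c2 q\<bar>) \<le> (\<Sum>q\<in>blocks n k. \<bar>c q\<bar>)"
    by (rule sum_mono) (auto simp: c2_def)
  then have small: "(\<Sum>x\<in>?X. e x * c2 (block k x)) \<le> \<epsilon> * real m + W"
    using c(2) by (intro controlled_small_part[OF ctrl \<epsilon> D(1,3)]) (auto simp: c2_def L_def not_less)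
  have split: "c (block k x) = c1 (block k x) + c2 (block k x)" if "x \<in> ?X" for x
    using block_in_blocks[OF that, of k] by (auto simp: c1_def c2_def L_def)
  have "(\<Sum>x\<in>?X. e x * c (block k x)) = (\<Sum>x\<in>?X. e x * c1 (block k x)) + (\<Sum>x\<in>?X. e x * c2 (block k x))"
    unfolding sum.distrib[symmetric] by (intro sum.cong refl) (simp add: split distrib_left del: mem_Sigma_iff)
  moreover have "(\<Sum>x\<in>?X. (c1 (block k x))\<^sup>2) \<le> (\<Sum>x\<in>?X. (c (block k x))\<^sup>2)"
    by (rule sum_mono) (simp add: c1_def)
  ultimately show ?thesis
    using large small mult_left_mono[OF _ \<epsilon>, of "\<Sum>x\<in>?X. (c1 (block k x))\<^sup>2"
      "\<Sum>x\<in>?X. (c (block k x))\<^sup>2"] by simp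
qed

text \<open>The mass parameter 24 n is twice the 12 n of \<open>sum_abs_detail_le\<close>, once for
  each of \<open>A\<close> and \<open>B\<close>. The mesh 1 / 4^l meets both demands on
  \<open>D\<close>: n^2 \<le> 4^l, and 2^k divides 4^l at every level. There are \<open>l\<close>
  details and one coarsest average, hence the factor \<open>Suc l\<close>.\<close>

lemma bimono_diff_pairing_le:
  assumes ctrl: "\<And>k. k \<le> l \<Longrightarrow> controlled n e (24 * n) (4 ^ l) \<epsilon> W k"
    and l: "n \<le> 2 ^ l" "2 ^ l \<le> 2 * n" and \<epsilon>: "\<epsilon> \<ge> 0"
    and E: "\<And>x. x \<in> {..<n} \<times> {..<n} \<Longrightarrow> \<bar>e x\<bar> \<le> E" "E \<ge> 0"
    and A: "bimono n A" and B: "bimono n B"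
  shows "(\<Sum>x\<in>{..<n} \<times> {..<n}. e x * (B x - A x))
    \<le> \<epsilon> * (\<Sum>x\<in>{..<n} \<times> {..<n}. (B x - A x)\<^sup>2) + real (Suc l) * (24 * \<epsilon> * real n + 2 * W + E)"
proof -
  let ?X = "{..<n} \<times> {..<n}"
  define H where "H = (\<lambda>x. B x - A x)"
  define R where "R = \<epsilon> * real (24 * n) + 2 * W + E"
  have n0: "n > 0" using l(2) by (cases n) auto
  have D: "(4 :: nat) ^ l > 0" "n\<^sup>2 \<le> 4 ^ l"
    using power_mono[OF l(1), of 2] by (simp_all add: power_mult[symmetric] mult.commute[of l] power_mult[of 2 2])
  have dvd: "(2 :: nat) ^ k dvd 4 ^ l" if "k \<le> l" for k
  proof -
    have "(2 :: nat) ^ k dvd 2 ^ (2 * l)" by (rule le_imp_power_dvd) (use that in simp)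
    then show ?thesis by (simp add: power_mult)
  qed
  have H1: "- 1 \<le> H y" "H y \<le> 1" if "y \<in> ?X" for y
    using that bimonoD(1,2)[OF A, of "fst y" "snd y"] bimonoD(1,2)[OF B, of "fst y" "snd y"]
    unfolding H_def by auto
  have avg1: "\<bar>cell_avg n k H x\<bar> \<le> 1" if "x \<in> ?X" for k x
    using cell_avg_between[OF that, of k "- 1" H 1] H1 unfolding cell_def by auto
  have level: "(\<Sum>x\<in>?X. e x * detail n k H x) \<le> \<epsilon> * (\<Sum>x\<in>?X. (detail n k H x)\<^sup>2) + R" if "k < l" for k
  proof -
    define c where "c = (\<lambda>q. detail n k H (corner k q))"
    have cb: "detail n k H x = c (block k x)" if "x \<in> ?X" for x
      unfolding c_def by (rule detail_block[OF that])
    have "(2 :: nat) ^ Suc k \<le> 2 ^ l" using that by (intro power_increasing) auto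
    with l(2) have sk: "2 ^ Suc k \<le> 2 * n" by simp
    have "(\<Sum>q\<in>blocks n k. \<bar>c q\<bar>) \<le> (\<Sum>q\<in>blocks n k. \<bar>detail n k B (corner k q)\<bar> + \<bar>detail n k A (corner k q)\<bar>)"
      unfolding c_def H_def detail_diff by (intro sum_mono abs_triangle_ineq4)
    also have "\<dots> \<le> real (24 * n) / 2 ^ k"
      using sum_abs_detail_le[OF B sk] sum_abs_detail_le[OF A sk] by (simp add: sum.distrib)
    finally have mass: "(\<Sum>q\<in>blocks n k. \<bar>c q\<bar>) \<le> real (24 * n) / 2 ^ k" .
    have "\<bar>c q\<bar> \<le> 2" if "q \<in> blocks n k" for q
      using avg1[OF corner_in[OF that], of k] avg1[OF corner_in[OF that], of "Suc k"]
      unfolding c_def detail_def by linarith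
    from controlled_level[OF ctrl \<epsilon> D dvd E this mass] that
    show ?thesis unfolding R_def by (simp add: cb del: mem_Sigma_iff)
  qed
  \<comment> \<open>At level \<open>l\<close> a single block covers the square; its coefficient is
    at most 1, which is at most 24 n / 2^l.\<close>
  have top: "(\<Sum>x\<in>?X. e x * cell_avg n l H x) \<le> \<epsilon> * (\<Sum>x\<in>?X. (cell_avg n l H x)\<^sup>2) + R"
  proof -
    define c where "c = (\<lambda>q. cell_avg n l H (corner l q))"
    have cb: "cell_avg n l H x = c (block l x)" if "x \<in> ?X" for x
      unfolding c_def using cell_avg_cong[OF corner_block_in_cell[OF that]] by simp
    have bl: "blocks n l \<subseteq> {(0, 0)}"
    proof -
      have "a = 0" if "a * 2 ^ l < n" for a :: nat
        using that l(1) by (cases a) auto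
      then show ?thesis unfolding blocks_def by auto
    qed
    have c1: "\<bar>c q\<bar> \<le> 1" if "q \<in> blocks n l" for q
      using avg1[OF corner_in[OF that], of l] unfolding c_def by simp
    have "(\<Sum>q\<in>blocks n l. \<bar>c q\<bar>) \<le> real (card (blocks n l)) * 1"
      by (rule sum_bounded_above) (rule c1)
    also have "\<dots> \<le> 1" using card_mono[OF _ bl] by simp
    also have "1 \<le> real (24 * n) / 2 ^ l"
      using of_nat_mono[OF l(2), where 'a = real] by simp
    finally have mass: "(\<Sum>q\<in>blocks n l. \<bar>c q\<bar>) \<le> real (24 * n) / 2 ^ l" .
    have "\<bar>c q\<bar> \<le> 2" if "q \<in> blocks n l" for q using c1[OF that] by simp
    from controlled_level[OF ctrl \<epsilon> D dvd E this mass]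
    show ?thesis unfolding R_def by (simp add: cb del: mem_Sigma_iff)
  qed
  have "(\<Sum>x\<in>?X. e x * H x) = (\<Sum>x\<in>?X. (\<Sum>k<l. e x * detail n k H x) + e x * cell_avg n l H x)"
    by (intro sum.cong refl, subst detail_telescope[where m = l]) (auto simp: distrib_left sum_distrib_left)
  also have "\<dots> = (\<Sum>k<l. \<Sum>x\<in>?X. e x * detail n k H x) + (\<Sum>x\<in>?X. e x * cell_avg n l H x)"
    by (subst sum.distrib, subst sum.swap, rule refl)
  also have "\<dots> \<le> (\<Sum>k<l. \<epsilon> * (\<Sum>x\<in>?X. (detail n k H x)\<^sup>2) + R) + (\<epsilon> * (\<Sum>x\<in>?X. (cell_avg n l H x)\<^sup>2) + R)"
    using level by (intro add_mono sum_mono top) auto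
  also have "\<dots> = \<epsilon> * ((\<Sum>k<l. \<Sum>x\<in>?X. (detail n k H x)\<^sup>2) + (\<Sum>x\<in>?X. (cell_avg n l H x)\<^sup>2))
      + real (Suc l) * R"
    by (simp add: sum.distrib sum_distrib_left[where r = \<epsilon>] distrib_left distrib_right)
  also have "\<dots> = \<epsilon> * (\<Sum>x\<in>?X. (H x)\<^sup>2) + real (Suc l) * R"
    unfolding detail_parseval ..
  finally show ?thesis unfolding H_def R_def by (simp add: mult_ac)
qed

section \<open>Exponential tail bounds for the noise\<close>

lemma exp_le_quadratic:
  assumes "\<bar>x\<bar> \<le> (1::real)" shows "exp x \<le> 1 + x + x\<^sup>2"
proof (cases "x \<ge> 0")
  case True
  then show ?thesis using assms by (intro exp_bound) auto
next
  case False
  have pos: "1 - x > 0" using False by simp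
  have "exp x * (1 - x) \<le> exp x * exp (- x)"
    using exp_ge_add_one_self[of "- x"] by (intro mult_left_mono) auto
  also have "\<dots> = 1" by (simp add: exp_minus)
  \<comment> \<open>The product equals 1 - x^3, and \<open>x\<close> is negative.\<close>
  also have "1 \<le> (1 + x + x\<^sup>2) * (1 - x)"
    using False mult_nonneg_nonpos[of "x\<^sup>2" x] by (simp add: algebra_simps power2_eq_square)
  finally show ?thesis using pos by simp
qed

text \<open>Chernoff's method, with the exponential parameter already contained in \<open>g\<close>.
  The bounds on \<open>g\<close> and \<open>X\<close> keep the exponent of each factor in [-1, 1],
  where exp z \<le> 1 + z + z^2; the linear term has mean 0 and the quadratic one has mean at most
  g^2 / p.\<close>

lemma Pi_pmf_tail_bound:
  fixes q :: "'a \<Rightarrow> 'b::finite pmf" and X :: "'a \<Rightarrow> 'b \<Rightarrow> real"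
  assumes A: "finite A" and p: "p > 0"
    and mean: "\<And>e. e \<in> A \<Longrightarrow> measure_pmf.expectation (q e) (X e) = 0"
    and bound: "\<And>e b. e \<in> A \<Longrightarrow> \<bar>X e b\<bar> \<le> 1 / p"
    and var: "\<And>e. e \<in> A \<Longrightarrow> measure_pmf.expectation (q e) (\<lambda>b. (X e b)\<^sup>2) \<le> 1 / p"
    and g: "\<And>e. e \<in> A \<Longrightarrow> \<bar>g e\<bar> \<le> p"
  shows "measure_pmf.prob (Pi_pmf A d q) {\<omega>. t \<le> (\<Sum>e\<in>A. g e * X e (\<omega> e))}
    \<le> exp (- t + (\<Sum>e\<in>A. (g e)\<^sup>2) / p)"
proof -
  let ?P = "Pi_pmf A d q" and ?S = "\<lambda>\<omega>. \<Sum>e\<in>A. g e * X e (\<omega> e)"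
  have fin: "finite (set_pmf ?P)"
    unfolding set_Pi_pmf[OF A] by (rule finite_PiE_dflt[OF A]) auto
  have int: "integrable (measure_pmf M) f" for M :: "'b pmf" and f :: "'b \<Rightarrow> real"
    by (rule integrable_measure_pmf_finite) simp
  have factor: "measure_pmf.expectation (q e) (\<lambda>b. exp (g e * X e b)) \<le> exp ((g e)\<^sup>2 / p)" if e: "e \<in> A" for e
  proof -
    have "exp (g e * X e b) \<le> 1 + g e * X e b + (g e)\<^sup>2 * (X e b)\<^sup>2" for b
    proof -
      have "\<bar>g e\<bar> * \<bar>X e b\<bar> \<le> p * (1 / p)"
        using g[OF e] bound[OF e, of b] p by (intro mult_mono) auto
      then have "\<bar>g e * X e b\<bar> \<le> 1" using p by (simp add: abs_mult)
      from exp_le_quadratic[OF this] show ?thesis by (simp add: power_mult_distrib)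
    qed
    then have "measure_pmf.expectation (q e) (\<lambda>b. exp (g e * X e b))
        \<le> measure_pmf.expectation (q e) (\<lambda>b. 1 + g e * X e b + (g e)\<^sup>2 * (X e b)\<^sup>2)"
      by (intro integral_mono int)
    also have "\<dots> = 1 + (g e)\<^sup>2 * measure_pmf.expectation (q e) (\<lambda>b. (X e b)\<^sup>2)"
      using mean[OF e] by (simp add: int)
    also have "\<dots> \<le> 1 + (g e)\<^sup>2 * (1 / p)"
      using mult_left_mono[OF var[OF e], of "(g e)\<^sup>2"] by simp
    also have "\<dots> \<le> exp ((g e)\<^sup>2 / p)" using exp_ge_add_one_self[of "(g e)\<^sup>2 / p"] by simp
    finally show ?thesis .
  qed
  have "measure_pmf.prob ?P {\<omega>. t \<le> ?S \<omega>} = measure_pmf.prob ?P {\<omega> \<in> space (measure_pmf ?P). exp t \<le> exp (?S \<omega>)}"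
    by simp
  also have "\<dots> \<le> measure_pmf.expectation ?P (\<lambda>\<omega>. exp (?S \<omega>)) / exp t"
    by (rule integral_Markov_inequality_measure[where A = "{}"])
       (auto intro: integrable_measure_pmf_finite[OF fin])
  also have "measure_pmf.expectation ?P (\<lambda>\<omega>. exp (?S \<omega>))
      = measure_pmf.expectation ?P (\<lambda>\<omega>. \<Prod>e\<in>A. exp (g e * X e (\<omega> e)))"
    by (simp add: exp_sum[OF A])
  also have "\<dots> = (\<Prod>e\<in>A. measure_pmf.expectation (q e) (\<lambda>b. exp (g e * X e b)))"
    by (rule expectation_prod_Pi_pmf[OF A]) (auto intro: int)
  also have "\<dots> \<le> (\<Prod>e\<in>A. exp ((g e)\<^sup>2 / p))"
    by (intro prod_mono conjI factor) (auto intro: integral_nonneg)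
  also have "\<dots> = exp ((\<Sum>e\<in>A. (g e)\<^sup>2) / p)"
    by (simp add: exp_sum[OF A] sum_divide_distrib)
  finally show ?thesis by (simp add: divide_right_mono exp_diff)
qed

section \<open>The noise matrix and its tails\<close>

lemma finite_above_diag [simp]: "finite (above_diag n)"
  by (rule finite_subset[of _ "{1..n} \<times> {1..n}"]) (auto simp: above_diag_def)

lemma sum_square_split:
  fixes f :: "nat \<Rightarrow> nat \<Rightarrow> real"
  shows "(\<Sum>i=1..n. \<Sum>j=1..n. f i j) = (\<Sum>(i, j)\<in>above_diag n. f i j + f j i) + (\<Sum>i=1..n. f i i)"
proof -
  let ?U = "above_diag n" and ?L = "prod.swap ` above_diag n" and ?D = "(\<lambda>i. (i, i)) ` {1..n}"
  have sq: "{1..n} \<times> {1..n} = ?U \<union> ?L \<union> ?D"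
  proof (intro equalityI subsetI)
    fix x assume "x \<in> {1..n} \<times> {1..n}"
    moreover obtain i j where "x = (i, j)" by force
    ultimately show "x \<in> ?U \<union> ?L \<union> ?D"
      using linorder_less_linear[of i j] by (auto simp: above_diag_def image_iff)
  qed (auto simp: above_diag_def)
  have disj: "?U \<inter> ?L = {}" "(?U \<union> ?L) \<inter> ?D = {}" by (auto simp: above_diag_def)
  have "(\<Sum>i=1..n. \<Sum>j=1..n. f i j) = (\<Sum>x\<in>{1..n} \<times> {1..n}. f (fst x) (snd x))"
    by (simp add: sum.cartesian_product split_beta)
  also have "\<dots> = (\<Sum>x\<in>?U. f (fst x) (snd x)) + (\<Sum>x\<in>?L. f (fst x) (snd x)) + (\<Sum>x\<in>?D. f (fst x) (snd x))"
    unfolding sq using disj by (simp add: sum.union_disjoint)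
  also have "(\<Sum>x\<in>?L. f (fst x) (snd x)) = (\<Sum>x\<in>?U. f (snd x) (fst x))"
    by (subst sum.reindex) (auto intro: inj_on_subset[OF inj_swap])
  also have "(\<Sum>x\<in>?D. f (fst x) (snd x)) = (\<Sum>i=1..n. f i i)"
    by (subst sum.reindex) (auto intro: inj_onI)
  finally show ?thesis by (simp add: sum.distrib split_beta)
qed

definition valid_param :: "model \<Rightarrow> nat \<Rightarrow> (nat \<Rightarrow> nat \<Rightarrow> real) \<Rightarrow> bool" where
  "valid_param m n \<theta> \<longleftrightarrow> (\<forall>i\<in>{1..n}. \<forall>j\<in>{1..n}. \<theta> i j \<in> {0..1} \<and> (i \<noteq> j \<longrightarrow> \<theta> j i = reflect m (\<theta> i j)))
     \<and> (\<forall>i\<in>{1..n}. \<theta> i i = 0)"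

lemma valid_paramD:
  assumes "valid_param m n \<theta>" "i \<in> {1..n}" "j \<in> {1..n}"
  shows "0 \<le> \<theta> i j" "\<theta> i j \<le> 1" "i \<noteq> j \<Longrightarrow> \<theta> j i = reflect m (\<theta> i j)" "\<theta> i i = 0"
proof -
  have "\<theta> i j \<in> {0..1} \<and> (i \<noteq> j \<longrightarrow> \<theta> j i = reflect m (\<theta> i j))"
    using assms(1)[unfolded valid_param_def, THEN conjunct1, THEN bspec, OF assms(2), THEN bspec, OF assms(3)] .
  then show "0 \<le> \<theta> i j" "\<theta> i j \<le> 1" "i \<noteq> j \<Longrightarrow> \<theta> j i = reflect m (\<theta> i j)"
    by simp_all
  show "\<theta> i i = 0" using assms(1)[unfolded valid_param_def, THEN conjunct2, THEN bspec, OF assms(2)] .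
qed

text \<open>Missing entries are 1/2, so subtracting J / 2 sends them to 0 and y - J / 2 has mean p
  (\<theta> - J / 2). Dividing by \<open>p\<close> therefore leaves a remainder of mean 0.\<close>

definition noise :: "model \<Rightarrow> real \<Rightarrow> (nat \<Rightarrow> nat \<Rightarrow> real) \<Rightarrow> data \<Rightarrow> nat \<Rightarrow> nat \<Rightarrow> real" where
  "noise m p \<theta> \<omega> i j = (y_mat m \<omega> i j - J i j / 2) / p - (\<theta> i j - J i j / 2)"

text \<open>Centering at 1/2 turns the reflection of \<open>t\<close> to \<open>1 - t\<close> in the
  tournament model into a change of sign.\<close>

definition reflect_sign :: "model \<Rightarrow> real" where
  "reflect_sign m = (case m of Tournament \<Rightarrow> - 1 | Graph \<Rightarrow> 1)"

definition centered_entry :: "real \<Rightarrow> real \<Rightarrow> bool \<times> bool \<Rightarrow> real" where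
  "centered_entry p t b = (if snd b then (of_bool (fst b) - 1 / 2) / p else 0) - (t - 1 / 2)"

lemma noise_upper: "i < j \<Longrightarrow> noise m p \<theta> \<omega> i j = centered_entry p (\<theta> i j) (\<omega> (i, j))"
  unfolding noise_def centered_entry_def y_mat_def y_upper_def J_def by auto

lemma noise_lower:
  assumes "valid_param m n \<theta>" "i < j" "i \<in> {1..n}" "j \<in> {1..n}"
  shows "noise m p \<theta> \<omega> j i = reflect_sign m * noise m p \<theta> \<omega> i j"
proof -
  have "\<theta> j i = reflect m (\<theta> i j)" by (rule valid_paramD(3)[OF assms(1,3,4)]) (use assms(2) in simp)
  then show ?thesis
    using assms(2)
    by (cases m) (simp_all add: noise_def y_mat_def J_def reflect_sign_def diff_divide_distrib)
qed

lemma noise_diag: "valid_param m n \<theta> \<Longrightarrow> i \<in> {1..n} \<Longrightarrow> noise m p \<theta> \<omega> i i = 0"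
  unfolding noise_def y_mat_def J_def by (simp add: valid_paramD(4))

text \<open>The lower triangle repeats the upper one up to sign. Folding the square along the
  diagonal leaves a sum of independent terms, to which the tail bound applies.\<close>

lemma noise_pairing:
  assumes "valid_param m n \<theta>"
  shows "(\<Sum>i=1..n. \<Sum>j=1..n. noise m p \<theta> \<omega> i j * G i j)
    = (\<Sum>e\<in>above_diag n. (G (fst e) (snd e) + reflect_sign m * G (snd e) (fst e))
        * centered_entry p (\<theta> (fst e) (snd e)) (\<omega> e))"
proof -
  have "(\<Sum>i=1..n. \<Sum>j=1..n. noise m p \<theta> \<omega> i j * G i j)
      = (\<Sum>(i, j)\<in>above_diag n. noise m p \<theta> \<omega> i j * G i j + noise m p \<theta> \<omega> j i * G j i)"
    unfolding sum_square_split using noise_diag[OF assms] by simp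
  also have "\<dots> = (\<Sum>e\<in>above_diag n. (G (fst e) (snd e) + reflect_sign m * G (snd e) (fst e))
        * centered_entry p (\<theta> (fst e) (snd e)) (\<omega> e))"
    using noise_lower[OF assms]
    by (intro sum.cong) (auto simp: above_diag_def noise_upper algebra_simps)
  finally show ?thesis .
qed

lemma expectation_pair_bernoulli:
  assumes "0 \<le> t" "t \<le> 1" "0 \<le> p" "p \<le> (1::real)"
  shows "measure_pmf.expectation (pair_pmf (bernoulli_pmf t) (bernoulli_pmf p)) f
    = t * p * f (True, True) + t * (1 - p) * f (True, False)
      + (1 - t) * p * f (False, True) + (1 - t) * (1 - p) * (f (False, False) :: real)"
proof -
  have U: "(UNIV :: (bool \<times> bool) set) = {(True, True), (True, False), (False, True), (False, False)}"
    by (auto simp: UNIV_bool)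
  show ?thesis
    by (subst integral_measure_pmf_real[where A = UNIV])
       (use assms in \<open>auto simp: U pmf_pair mult_ac\<close>)
qed

lemma centered_entry_moments:
  assumes t: "0 \<le> t" "t \<le> 1" and p: "0 < p" "p \<le> 1"
  shows "measure_pmf.expectation (pair_pmf (bernoulli_pmf t) (bernoulli_pmf p)) (centered_entry p t) = 0"
    and "\<bar>centered_entry p t b\<bar> \<le> 1 / p"
    and "measure_pmf.expectation (pair_pmf (bernoulli_pmf t) (bernoulli_pmf p))
          (\<lambda>b. (centered_entry p t b)\<^sup>2) \<le> 1 / p"
proof -
  show "measure_pmf.expectation (pair_pmf (bernoulli_pmf t) (bernoulli_pmf p)) (centered_entry p t) = 0"
    using t p by (subst expectation_pair_bernoulli) (auto simp: centered_entry_def field_simps)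
  define u where "u = (if snd b then (of_bool (fst b) - 1 / 2) / p else 0)"
  have "1 \<le> 1 / p" using p by simp
  moreover have "\<bar>u\<bar> \<le> 1 / 2 * (1 / p)" unfolding u_def using p by auto
  moreover have "\<bar>t - 1 / 2\<bar> \<le> 1 / 2" using t unfolding abs_le_iff by simp
  ultimately show "\<bar>centered_entry p t b\<bar> \<le> 1 / p"
    unfolding centered_entry_def u_def[symmetric] by linarith
  have "measure_pmf.expectation (pair_pmf (bernoulli_pmf t) (bernoulli_pmf p)) (\<lambda>b. (centered_entry p t b)\<^sup>2)
      = 1 / (4 * p) - (t - 1 / 2)\<^sup>2"
    using t p by (subst expectation_pair_bernoulli) (auto simp: centered_entry_def field_simps power2_eq_square)
  also have "\<dots> \<le> 1 / (4 * p)" by simp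
  also have "\<dots> \<le> 1 / p" using p by (simp add: field_simps)
  finally show "measure_pmf.expectation (pair_pmf (bernoulli_pmf t) (bernoulli_pmf p))
          (\<lambda>b. (centered_entry p t b)\<^sup>2) \<le> 1 / p" .
qed

text \<open>Here \<open>l\<close> is the exponential parameter. A folded coefficient is at most 2 b
  in modulus, which gives the condition 2 b l \<le> p, and a squared sum or difference of two
  entries is at most twice the sum of their squares, which gives the factor 2 in the
  exponent.\<close>

lemma noise_tail:
  assumes v: "valid_param m n \<theta>" and p: "0 < p" "p \<le> 1"
    and G: "\<And>i j. i \<in> {1..n} \<Longrightarrow> j \<in> {1..n} \<Longrightarrow> \<bar>G i j\<bar> \<le> b" and l: "l \<ge> 0" "2 * b * l \<le> p"
  shows "measure_pmf.prob (data_pmf n p \<theta>) {\<omega>. t < (\<Sum>i=1..n. \<Sum>j=1..n. noise m p \<theta> \<omega> i j * G i j)}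
    \<le> exp (- l * t + 2 * l\<^sup>2 * (\<Sum>i=1..n. \<Sum>j=1..n. (G i j)\<^sup>2) / p)"
proof -
  define g where "g = (\<lambda>e. l * (G (fst e) (snd e) + reflect_sign m * G (snd e) (fst e)))"
  let ?q = "\<lambda>(i, j). pair_pmf (bernoulli_pmf (\<theta> i j)) (bernoulli_pmf p)"
  let ?X = "\<lambda>e. centered_entry p (\<theta> (fst e) (snd e))"
  have sgn: "\<bar>reflect_sign m\<bar> = 1" "(reflect_sign m)\<^sup>2 = 1"
    by (cases m; simp add: reflect_sign_def)+
  have th: "0 \<le> \<theta> (fst e) (snd e)" "\<theta> (fst e) (snd e) \<le> 1" if "e \<in> above_diag n" for e
    using that by (auto simp: above_diag_def intro!: valid_paramD(1,2)[OF v])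
  have "measure_pmf.prob (data_pmf n p \<theta>) {\<omega>. t < (\<Sum>i=1..n. \<Sum>j=1..n. noise m p \<theta> \<omega> i j * G i j)}
      \<le> measure_pmf.prob (data_pmf n p \<theta>) {\<omega>. l * t \<le> (\<Sum>e\<in>above_diag n. g e * ?X e (\<omega> e))}"
  proof (rule measure_pmf.finite_measure_mono)
    show "{\<omega>. t < (\<Sum>i=1..n. \<Sum>j=1..n. noise m p \<theta> \<omega> i j * G i j)}
        \<subseteq> {\<omega>. l * t \<le> (\<Sum>e\<in>above_diag n. g e * ?X e (\<omega> e))}"
      unfolding noise_pairing[OF v] g_def using l(1)
      by (auto simp: sum_distrib_left[symmetric] mult.assoc intro!: mult_left_mono)
  qed simp
  also have "\<dots> \<le> exp (- (l * t) + (\<Sum>e\<in>above_diag n. (g e)\<^sup>2) / p)"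
    unfolding data_pmf_def
  proof (rule Pi_pmf_tail_bound[OF finite_above_diag p(1)])
    fix e assume e: "e \<in> above_diag n"
    show "measure_pmf.expectation (?q e) (?X e) = 0"
      using centered_entry_moments(1)[OF th[OF e] p] by (simp add: split_beta)
    show "\<bar>?X e b\<bar> \<le> 1 / p" for b
      by (rule centered_entry_moments(2)[OF th[OF e] p])
    show "measure_pmf.expectation (?q e) (\<lambda>b. (?X e b)\<^sup>2) \<le> 1 / p"
      using centered_entry_moments(3)[OF th[OF e] p] by (simp add: split_beta)
    have "\<bar>G (fst e) (snd e)\<bar> \<le> b" "\<bar>G (snd e) (fst e)\<bar> \<le> b"
      using e by (auto simp: above_diag_def intro!: G)
    then have "\<bar>G (fst e) (snd e) + reflect_sign m * G (snd e) (fst e)\<bar> \<le> 2 * b"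
      using sgn(1) abs_triangle_ineq[of "G (fst e) (snd e)" "reflect_sign m * G (snd e) (fst e)"]
      by (simp add: abs_mult)
    then have "\<bar>g e\<bar> \<le> l * (2 * b)"
      unfolding g_def using l(1) by (simp add: abs_mult mult_left_mono)
    with l(2) show "\<bar>g e\<bar> \<le> p" by (simp add: mult.commute mult.left_commute)
  qed
  also have "(\<Sum>e\<in>above_diag n. (g e)\<^sup>2)
      \<le> 2 * l\<^sup>2 * (\<Sum>i=1..n. \<Sum>j=1..n. (G i j)\<^sup>2)"
  proof -
    have sq: "(x + reflect_sign m * y)\<^sup>2 \<le> 2 * (x\<^sup>2 + y\<^sup>2)" for x y :: real
    proof -
      have "(x + reflect_sign m * y)\<^sup>2 + (x - reflect_sign m * y)\<^sup>2 = 2 * x\<^sup>2 + 2 * ((reflect_sign m)\<^sup>2 * y\<^sup>2)"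
        by (simp add: power2_eq_square algebra_simps)
      then have "(x + reflect_sign m * y)\<^sup>2 + (x - reflect_sign m * y)\<^sup>2 = 2 * (x\<^sup>2 + y\<^sup>2)"
        using sgn(2) by simp
      then show ?thesis using zero_le_power2[of "x - reflect_sign m * y"] by linarith
    qed
    have "(\<Sum>e\<in>above_diag n. (g e)\<^sup>2) \<le> (\<Sum>e\<in>above_diag n. l\<^sup>2 * (2 * ((G (fst e) (snd e))\<^sup>2 + (G (snd e) (fst e))\<^sup>2)))"
      unfolding g_def power_mult_distrib by (intro sum_mono mult_left_mono sq) auto
    also have "\<dots> = 2 * l\<^sup>2 * (\<Sum>(i, j)\<in>above_diag n. (G i j)\<^sup>2 + (G j i)\<^sup>2)"
      by (simp add: sum_distrib_left split_beta algebra_simps)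
    also have "\<dots> \<le> 2 * l\<^sup>2 * (\<Sum>i=1..n. \<Sum>j=1..n. (G i j)\<^sup>2)"
      unfolding sum_square_split by (intro mult_left_mono) (auto intro: sum_nonneg)
    finally show ?thesis .
  qed
  finally show ?thesis using p by (simp add: divide_right_mono)
qed

text \<open>The same tail bound for the centered observation indicators. The coefficient x p / 2
  minimizes - l N x + N l^2 / p over \<open>l\<close>, where \<open>N\<close> is the number of
  positions; x \<le> 2 keeps it at most \<open>p\<close>. The two signs give the factor 2.\<close>

lemma p_hat_tail:
  assumes v: "valid_param m n \<theta>" and p: "0 < p" "p \<le> 1" and n: "n \<ge> 2" and x: "0 \<le> x" "x \<le> 2"
  shows "measure_pmf.prob (data_pmf n p \<theta>) {\<omega>. x < \<bar>p_hat n \<omega> / p - 1\<bar>}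
    \<le> 2 * exp (- (x\<^sup>2 * p * real (n choose 2) / 4))"
proof -
  define N where "N = real (n choose 2)"
  let ?P = "data_pmf n p \<theta>"
  let ?q = "\<lambda>(i, j). pair_pmf (bernoulli_pmf (\<theta> i j)) (bernoulli_pmf p)"
  let ?X = "\<lambda>e::nat\<times>nat. \<lambda>b::bool\<times>bool. (of_bool (snd b) - p) / p :: real"
  have N0: "N > 0" using n unfolding N_def by simp
  have cardN: "real (card (above_diag n)) = N"
  proof -
    have "real n * real n = 2 * real (card (above_diag n)) + real n"
      using sum_square_split[of "\<lambda>i j. 1" n] by (simp add: split_beta)
    moreover have "2 * N = real n * (real n - 1)"
    proof -
      have "even (n * (n - 1))" by (cases n) auto
      then have "2 * (n choose 2) = n * (n - 1)" by (simp add: choose_two)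
      then have "real (2 * (n choose 2)) = real (n * (n - 1))" by simp
      then show ?thesis using n unfolding N_def by (simp add: of_nat_diff)
    qed
    ultimately show ?thesis by (simp add: algebra_simps)
  qed
  have th: "0 \<le> \<theta> (fst e) (snd e)" "\<theta> (fst e) (snd e) \<le> 1" if "e \<in> above_diag n" for e
    using that by (auto simp: above_diag_def intro!: valid_paramD(1,2)[OF v])
  have side: "measure_pmf.prob ?P {\<omega>. x * p / 2 * (N * x) \<le> (\<Sum>e\<in>above_diag n. (s * (x * p / 2)) * ?X e (\<omega> e))}
      \<le> exp (- (x\<^sup>2 * p * N / 4))" if s: "\<bar>s\<bar> = 1" for s :: real
  proof -
    have "measure_pmf.prob ?P {\<omega>. x * p / 2 * (N * x) \<le> (\<Sum>e\<in>above_diag n. (s * (x * p / 2)) * ?X e (\<omega> e))}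
        \<le> exp (- (x * p / 2 * (N * x)) + (\<Sum>e\<in>above_diag n. (s * (x * p / 2))\<^sup>2) / p)"
      unfolding data_pmf_def
    proof (rule Pi_pmf_tail_bound[OF finite_above_diag p(1)])
      fix e assume e: "e \<in> above_diag n"
      show "measure_pmf.expectation (?q e) (?X e) = 0"
        using th[OF e] p by (simp add: split_beta expectation_pair_bernoulli field_simps)
      show "\<bar>?X e b\<bar> \<le> 1 / p" for b using p by (auto simp: abs_if field_simps)
      have "measure_pmf.expectation (?q e) (\<lambda>b. (?X e b)\<^sup>2) = (1 - p) / p"
        using th[OF e] p by (simp add: split_beta expectation_pair_bernoulli field_simps power2_eq_square)
      also have "\<dots> \<le> 1 / p" using p by (simp add: field_simps)
      finally show "measure_pmf.expectation (?q e) (\<lambda>b. (?X e b)\<^sup>2) \<le> 1 / p" .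
      show "\<bar>s * (x * p / 2)\<bar> \<le> p" using s x p by (simp add: abs_mult)
    qed
    also have "- (x * p / 2 * (N * x)) + (\<Sum>e\<in>above_diag n. (s * (x * p / 2))\<^sup>2) / p = - (x\<^sup>2 * p * N / 4)"
    proof -
      have "s\<^sup>2 = 1" using s by (metis power2_abs power_one)
      then show ?thesis using p(1) by (simp add: cardN power_mult_distrib field_simps power2_eq_square)
    qed
    finally show ?thesis .
  qed
  have sumX: "(\<Sum>e\<in>above_diag n. (s * (x * p / 2)) * ?X e (\<omega> e)) = s * (x * p / 2) * (N * (p_hat n \<omega> / p - 1))" for s \<omega>
  proof -
    have "(\<Sum>e\<in>above_diag n. of_bool (snd (\<omega> e)) :: real) = real (card {e \<in> above_diag n. snd (\<omega> e)})"
      by (simp add: of_bool_def sum.If_cases Int_def)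
    then have "(\<Sum>e\<in>above_diag n. of_bool (snd (\<omega> e)) :: real) = N * p_hat n \<omega>"
      using N0 unfolding p_hat_def N_def by simp
    then have "(\<Sum>e\<in>above_diag n. ?X e (\<omega> e)) = N * (p_hat n \<omega> / p - 1)"
      using p(1) by (simp add: sum_divide_distrib[symmetric] sum_subtractf cardN field_simps)
    then show ?thesis by (simp only: sum_distrib_left[symmetric])
  qed
  have "{\<omega>. x < \<bar>p_hat n \<omega> / p - 1\<bar>}
      \<subseteq> {\<omega>. x * p / 2 * (N * x) \<le> (\<Sum>e\<in>above_diag n. (1 * (x * p / 2)) * ?X e (\<omega> e))}
        \<union> {\<omega>. x * p / 2 * (N * x) \<le> (\<Sum>e\<in>above_diag n. ((- 1) * (x * p / 2)) * ?X e (\<omega> e))}"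
  proof
    fix \<omega> assume "\<omega> \<in> {\<omega>. x < \<bar>p_hat n \<omega> / p - 1\<bar>}"
    then have "x \<le> 1 * (p_hat n \<omega> / p - 1) \<or> x \<le> - 1 * (p_hat n \<omega> / p - 1)" by auto
    moreover have "x * p / 2 * (N * x) \<le> s * (x * p / 2) * (N * d)" if "x \<le> s * d" for s d :: real
    proof -
      have "x * p / 2 * N * x \<le> x * p / 2 * N * (s * d)"
        using that x p N0 by (intro mult_left_mono) auto
      then show ?thesis by (simp add: mult_ac)
    qed
    ultimately show "\<omega> \<in> {\<omega>. x * p / 2 * (N * x) \<le> (\<Sum>e\<in>above_diag n. (1 * (x * p / 2)) * ?X e (\<omega> e))}
        \<union> {\<omega>. x * p / 2 * (N * x) \<le> (\<Sum>e\<in>above_diag n. ((- 1) * (x * p / 2)) * ?X e (\<omega> e))}"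
      unfolding sumX by blast
  qed
  then have "measure_pmf.prob ?P {\<omega>. x < \<bar>p_hat n \<omega> / p - 1\<bar>}
      \<le> measure_pmf.prob ?P ({\<omega>. x * p / 2 * (N * x) \<le> (\<Sum>e\<in>above_diag n. (1 * (x * p / 2)) * ?X e (\<omega> e))}
        \<union> {\<omega>. x * p / 2 * (N * x) \<le> (\<Sum>e\<in>above_diag n. ((- 1) * (x * p / 2)) * ?X e (\<omega> e))})"
    by (intro measure_pmf.finite_measure_mono) auto
  also have "\<dots> \<le> exp (- (x\<^sup>2 * p * N / 4)) + exp (- (x\<^sup>2 * p * N / 4))"
    by (rule order_trans[OF measure_Un_le]) (use side[of 1] side[of "- 1"] in auto)
  finally show ?thesis unfolding N_def by simp
qed

section \<open>A union bound over block patterns and orderings\<close>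

definition sparse_coeffs :: "nat \<Rightarrow> nat \<Rightarrow> nat \<Rightarrow> nat \<Rightarrow> (nat \<times> nat \<Rightarrow> real) set" where
  "sparse_coeffs n m D k =
     {c. range c \<subseteq> grid D \<and> (\<forall>q. q \<notin> blocks n k \<longrightarrow> c q = 0) \<and> card {q. c q \<noteq> 0} \<le> m}"

text \<open>The maps \<open>\<rho>\<close> and \<open>\<tau>\<close> are arbitrary, so that one union bound covers every ordering that may
  be chosen in dependence on the data.\<close>

definition patterns :: "nat \<Rightarrow> nat \<Rightarrow> nat \<Rightarrow> nat \<Rightarrow> (nat \<Rightarrow> nat \<Rightarrow> real) set" where
  "patterns n m D l = {G. \<exists>k\<le>l. \<exists>\<rho>\<in>{1..n} \<rightarrow>\<^sub>E {..<n}. \<exists>\<tau>\<in>{1..n} \<rightarrow>\<^sub>E {..<n}. \<exists>c\<in>sparse_coeffs n m D k.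
     G = (\<lambda>i j. c (block k (\<rho> i, \<tau> j)))}"

text \<open>Sparse coefficients are encoded by \<open>m\<close> pairs of a position and a value, so
  that they are counted by an \<open>m\<close>-th power.\<close>

definition list_coeffs :: "nat \<Rightarrow> (nat \<Rightarrow> (nat \<times> nat) \<times> real) \<Rightarrow> nat \<times> nat \<Rightarrow> real" where
  "list_coeffs m \<phi> q = (\<Sum>r<m. if fst (\<phi> r) = q then snd (\<phi> r) else 0)"

lemma sparse_coeffs_subset:
  assumes "n > 0"
  shows "sparse_coeffs n m D k \<subseteq> list_coeffs m ` ({..<m} \<rightarrow>\<^sub>E ({..<n} \<times> {..<n}) \<times> grid D)"
proof
  fix c assume "c \<in> sparse_coeffs n m D k"
  then have c: "range c \<subseteq> grid D" "\<And>q. q \<notin> blocks n k \<Longrightarrow> c q = 0" "card {q. c q \<noteq> 0} \<le> m"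
    unfolding sparse_coeffs_def by auto
  define S where "S = {q. c q \<noteq> 0}"
  have S: "S \<subseteq> blocks n k" "card S \<le> m" using c unfolding S_def by auto
  then have fin: "finite S" by (auto intro: finite_subset)
  obtain h where h: "bij_betw h {0..<card S} S" using ex_bij_betw_nat_finite[OF fin] by blast
  \<comment> \<open>Slots beyond \<open>card S\<close> hold the position (0, 0) with the value 0,
    which adds nothing to the sum; n > 0 puts this position in the square.\<close>
  define \<phi> where "\<phi> = (\<lambda>r\<in>{..<m}. if r < card S then (h r, c (h r)) else ((0, 0), 0))"
  have "\<phi> r \<in> ({..<n} \<times> {..<n}) \<times> grid D" if "r < m" for r
  proof (cases "r < card S")
    case True
    then have "h r \<in> S" using h by (auto simp: bij_betw_def)
    then have "h r \<in> {..<n} \<times> {..<n}" using S(1) blocks_subset by blast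
    then show ?thesis using True that c(1) unfolding \<phi>_def by auto
  next
    case False
    then show ?thesis using that assms zero_in_grid unfolding \<phi>_def by auto
  qed
  then have "\<phi> \<in> {..<m} \<rightarrow>\<^sub>E ({..<n} \<times> {..<n}) \<times> grid D" unfolding \<phi>_def by auto
  moreover have "c = list_coeffs m \<phi>"
  proof
    fix q
    have "list_coeffs m \<phi> q = (\<Sum>r<m. if r < card S then (if h r = q then c (h r) else 0) else 0)"
      unfolding list_coeffs_def \<phi>_def by (intro sum.cong refl) auto
    also have "\<dots> = (\<Sum>r\<in>{0..<card S}. if h r = q then c (h r) else 0)"
      using S(2) by (intro sum.mono_neutral_cong_right) auto
    also have "\<dots> = (\<Sum>s\<in>S. if s = q then c s else 0)"
      by (rule sum.reindex_bij_betw[OF h])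
    also have "\<dots> = c q" using fin by (auto simp: S_def)
    finally show "c q = list_coeffs m \<phi> q" ..
  qed
  ultimately show "c \<in> list_coeffs m ` ({..<m} \<rightarrow>\<^sub>E ({..<n} \<times> {..<n}) \<times> grid D)" by blast
qed

lemma card_grid_le: "card (grid D) \<le> 4 * D + 1"
  unfolding grid_def by (rule order_trans[OF card_image_le]) auto

lemma finite_grid [simp]: "finite (grid D)"
  unfolding grid_def by simp

lemma grid_abs_le: "g \<in> grid D \<Longrightarrow> \<bar>g\<bar> \<le> 2"
proof -
  assume "g \<in> grid D"
  then obtain z where z: "g = of_int z / real D" "z \<in> {- 2 * int D..2 * int D}" unfolding grid_def by blast
  then have "\<bar>of_int z :: real\<bar> \<le> 2 * real D" by auto
  then show ?thesis unfolding z(1) by (cases "D = 0") (simp_all add: abs_divide divide_le_eq)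
qed

lemma power2_less_iff_less_abs:
  assumes "0 \<le> (x::real)" shows "x\<^sup>2 < d\<^sup>2 \<longleftrightarrow> x < \<bar>d\<bar>"
proof
  assume "x\<^sup>2 < d\<^sup>2"
  then have "x\<^sup>2 < \<bar>d\<bar>\<^sup>2" by simp
  then show "x < \<bar>d\<bar>" by (rule power2_less_imp_less) simp
next
  assume "x < \<bar>d\<bar>"
  then have "x\<^sup>2 < \<bar>d\<bar>\<^sup>2" using assms by (intro power_strict_mono) auto
  then show "x\<^sup>2 < d\<^sup>2" by simp
qed

lemma patterns_card:
  assumes "n > 0"
  shows "finite (patterns n m D l)"
    and "card (patterns n m D l) \<le> Suc l * (n ^ n * (n ^ n * (n\<^sup>2 * (4 * D + 1)) ^ m))"
proof -
  let ?R = "{1..n} \<rightarrow>\<^sub>E {..<n}" and ?\<Phi> = "{..<m} \<rightarrow>\<^sub>E ({..<n} \<times> {..<n}) \<times> grid D"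
  let ?f = "\<lambda>(k, \<rho>, \<tau>, \<phi>) i j. list_coeffs m \<phi> (block k (\<rho> i, \<tau> j))"
  let ?P = "{..l} \<times> ?R \<times> ?R \<times> ?\<Phi>"
  have sub: "patterns n m D l \<subseteq> ?f ` ?P"
  proof
    fix G assume "G \<in> patterns n m D l"
    then obtain k \<rho> \<tau> c where *: "k \<le> l" "\<rho> \<in> ?R" "\<tau> \<in> ?R" "c \<in> sparse_coeffs n m D k"
      "G = (\<lambda>i j. c (block k (\<rho> i, \<tau> j)))"
      unfolding patterns_def by blast
    then obtain \<phi> where "\<phi> \<in> ?\<Phi>" "c = list_coeffs m \<phi>" using sparse_coeffs_subset[OF assms] by blast
    with * show "G \<in> ?f ` ?P" by (intro image_eqI[of _ _ "(k, \<rho>, \<tau>, \<phi>)"]) auto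
  qed
  have fin: "finite ?P" by (intro finite_cartesian_product finite_PiE) auto
  show "finite (patterns n m D l)" by (rule finite_subset[OF sub]) (use fin in blast)
  have "card (patterns n m D l) \<le> card (?f ` ?P)" by (rule card_mono[OF _ sub]) (use fin in blast)
  also have "\<dots> \<le> card ?P" by (rule card_image_le[OF fin])
  also have "\<dots> = Suc l * (n ^ n * (n ^ n * (n * n * card (grid D)) ^ m))"
    by (simp add: card_cartesian_product card_PiE)
  also have "\<dots> \<le> Suc l * (n ^ n * (n ^ n * (n\<^sup>2 * (4 * D + 1)) ^ m))"
    using card_grid_le[of D]
    by (intro mult_left_mono power_mono) (simp_all add: power2_eq_square del: mult_Suc_right)
  finally show "card (patterns n m D l) \<le> Suc l * (n ^ n * (n ^ n * (n\<^sup>2 * (4 * D + 1)) ^ m))" .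
qed

lemma pattern_abs_le: "G \<in> patterns n m D l \<Longrightarrow> \<bar>G i j\<bar> \<le> 2"
  unfolding patterns_def sparse_coeffs_def using grid_abs_le by blast

text \<open>The exponential parameter is p / 64. For a test matrix of squared norm \<open>Q\<close>
  the quadratic term 2 (p / 64)^2 Q / p = p Q / 2048 is cancelled exactly by p / 64 times the Q / 32
  in the threshold, so exp (- u) remains whatever the norm is.\<close>

lemma patterns_tail:
  assumes v: "valid_param m n \<theta>" and p: "0 < p" "p \<le> 1" and n: "n > 0"
  shows "measure_pmf.prob (data_pmf n p \<theta>) {\<omega>. \<exists>G\<in>patterns n s D l.
      (\<Sum>i=1..n. \<Sum>j=1..n. (G i j)\<^sup>2) / 32 + 64 * u / p < (\<Sum>i=1..n. \<Sum>j=1..n. noise m p \<theta> \<omega> i j * G i j)}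
    \<le> real (card (patterns n s D l)) * exp (- u)"
proof -
  let ?A = "\<lambda>G. {\<omega>. (\<Sum>i=1..n. \<Sum>j=1..n. (G i j)\<^sup>2) / 32 + 64 * u / p < (\<Sum>i=1..n. \<Sum>j=1..n. noise m p \<theta> \<omega> i j * G i j)}"
  have "measure_pmf.prob (data_pmf n p \<theta>) {\<omega>. \<exists>G\<in>patterns n s D l.
      (\<Sum>i=1..n. \<Sum>j=1..n. (G i j)\<^sup>2) / 32 + 64 * u / p < (\<Sum>i=1..n. \<Sum>j=1..n. noise m p \<theta> \<omega> i j * G i j)}
    = measure_pmf.prob (data_pmf n p \<theta>) (\<Union>G\<in>patterns n s D l. ?A G)"
    by (rule arg_cong[where f = "measure_pmf.prob _"]) auto
  also have "\<dots> \<le> (\<Sum>G\<in>patterns n s D l. measure_pmf.prob (data_pmf n p \<theta>) (?A G))"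
    by (rule measure_pmf.finite_measure_subadditive_finite) (auto intro: patterns_card(1)[OF n])
  also have "\<dots> \<le> (\<Sum>G\<in>patterns n s D l. exp (- u))"
  proof (rule sum_mono)
    fix G assume G: "G \<in> patterns n s D l"
    define Q where "Q = (\<Sum>i=1..n. \<Sum>j=1..n. (G i j)\<^sup>2)"
    have "measure_pmf.prob (data_pmf n p \<theta>) (?A G)
        \<le> exp (- (p / 64) * (Q / 32 + 64 * u / p) + 2 * (p / 64)\<^sup>2 * Q / p)"
      unfolding Q_def by (rule noise_tail[OF v p, of G 2]) (use p pattern_abs_le[OF G] in auto)
    also have "- (p / 64) * (Q / 32 + 64 * u / p) + 2 * (p / 64)\<^sup>2 * Q / p = - u"
      using p(1) by (simp add: field_simps power2_eq_square)
    finally show "measure_pmf.prob (data_pmf n p \<theta>) (?A G) \<le> exp (- u)" .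
  qed
  finally show ?thesis by simp
qed

text \<open>A row sum is the pairing with the indicator of the row, of squared norm
  \<open>n\<close>. Failure probability 1 / n^2 for each row and sign adds up to 2 / n.\<close>

lemma row_noise_tail:
  assumes v: "valid_param m n \<theta>" and p: "2 * ln (real n) / real n \<le> p" "p \<le> 1" and n: "n \<ge> 2"
  shows "measure_pmf.prob (data_pmf n p \<theta>)
      {\<omega>. \<exists>i\<in>{1..n}. 18 * real n * ln (real n) / p < (\<Sum>j=1..n. noise m p \<theta> \<omega> i j)\<^sup>2} \<le> 2 / real n"
proof -
  let ?P = "data_pmf n p \<theta>"
  have ln0: "ln (real n) > 0" using n by simp
  have p0: "p > 0" by (rule less_le_trans[OF _ p(1)]) (use n ln0 in simp)
  \<comment> \<open>With l^2 = p ln n / (2 n) and l t = 3 ln n the exponent is - 3 ln n + ln n = - 2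
    ln n. The side condition 2 l \<le> p amounts to 2 ln n / n \<le> p, the assumed lower bound on
    \<open>p\<close>.\<close>
  define l where "l = sqrt (p * ln (real n) / (2 * real n))"
  have l2: "l\<^sup>2 = p * ln (real n) / (2 * real n)" unfolding l_def using p0 ln0 by simp
  have l0: "l > 0" unfolding l_def using p0 ln0 n by simp
  define t where "t = 3 * ln (real n) / l"
  have t0: "t > 0" unfolding t_def using l0 ln0 by simp
  have t2: "t\<^sup>2 = 18 * real n * ln (real n) / p"
    unfolding t_def power_divide l2 using ln0 p0 n by (simp add: field_simps power2_eq_square)
  have lp: "2 * 1 * l \<le> p"
  proof -
    have "(2 * l)\<^sup>2 = p * (2 * ln (real n) / real n)" unfolding power_mult_distrib l2 by simp
    also have "\<dots> \<le> p * p" using p(1) p0 by (intro mult_left_mono) auto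
    finally have "(2 * l)\<^sup>2 \<le> p\<^sup>2" by (simp add: power2_eq_square)
    then have "2 * l \<le> p" by (rule power2_le_imp_le) (use p0 in simp)
    then show ?thesis by simp
  qed
  have one: "measure_pmf.prob ?P {\<omega>. t < (\<Sum>j=1..n. noise m p \<theta> \<omega> i j * s)} \<le> 1 / (real n)\<^sup>2"
    if i: "i \<in> {1..n}" and s: "\<bar>s\<bar> = 1" for i s
  proof -
    define G where "G = (\<lambda>i' (j::nat). if i' = i then s else 0)"
    have "measure_pmf.prob ?P {\<omega>. t < (\<Sum>i=1..n. \<Sum>j=1..n. noise m p \<theta> \<omega> i j * G i j)}
        \<le> exp (- l * t + 2 * l\<^sup>2 * (\<Sum>i=1..n. \<Sum>j=1..n. (G i j)\<^sup>2) / p)"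
      by (rule noise_tail[OF v p0 p(2), of G 1]) (use s l0 lp in \<open>auto simp: G_def\<close>)
    moreover have "(\<Sum>a=1..n. \<Sum>j=1..n. h a j * G a j) = (\<Sum>j=1..n. h i j * s)" for h
    proof -
      have "(\<Sum>a=1..n. \<Sum>j=1..n. h a j * G a j) = (\<Sum>a=1..n. if a = i then \<Sum>j=1..n. h i j * s else 0)"
        by (intro sum.cong refl) (auto simp: G_def)
      then show ?thesis using i by simp
    qed
    moreover have "(\<Sum>a=1..n. \<Sum>j=1..n. (G a j)\<^sup>2) = real n"
    proof -
      have "s\<^sup>2 = 1" using s by (metis power2_abs power_one)
      then have "(\<Sum>a=1..n. \<Sum>j=1..n. (G a j)\<^sup>2) = (\<Sum>a=1..n. if a = i then real n else 0)"
        by (intro sum.cong refl) (auto simp: G_def)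
      then show ?thesis using i by simp
    qed
    moreover have "- l * t + 2 * l\<^sup>2 * real n / p = - (2 * ln (real n))"
      unfolding l2 t_def using l0 p0 n by (simp add: field_simps)
    moreover have "exp (- (2 * ln (real n))) = 1 / (real n)\<^sup>2"
      using n by (simp add: exp_minus exp_double[symmetric] ln_realpow[symmetric] inverse_eq_divide power2_eq_square exp_double)
    ultimately show ?thesis by simp
  qed
  let ?B = "\<lambda>(i, s). {\<omega>. t < (\<Sum>j=1..n. noise m p \<theta> \<omega> i j * s)}"
  let ?I = "{1..n} \<times> {1, - 1 :: real}"
  have "{\<omega>. \<exists>i\<in>{1..n}. 18 * real n * ln (real n) / p < (\<Sum>j=1..n. noise m p \<theta> \<omega> i j)\<^sup>2} \<subseteq> (\<Union>x\<in>?I. ?B x)"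
  proof
    fix \<omega> assume "\<omega> \<in> {\<omega>. \<exists>i\<in>{1..n}. 18 * real n * ln (real n) / p < (\<Sum>j=1..n. noise m p \<theta> \<omega> i j)\<^sup>2}"
    then obtain i where i: "i \<in> {1..n}" "t\<^sup>2 < (\<Sum>j=1..n. noise m p \<theta> \<omega> i j)\<^sup>2" unfolding t2 by auto
    then have "t < \<bar>\<Sum>j=1..n. noise m p \<theta> \<omega> i j\<bar>"
      using t0 by (simp add: power2_less_iff_less_abs)
    then have "\<omega> \<in> ?B (i, 1) \<or> \<omega> \<in> ?B (i, - 1)" by (auto simp: sum_negf abs_if split: if_splits)
    then show "\<omega> \<in> (\<Union>x\<in>?I. ?B x)" using i(1) by blast
  qed
  then have "measure_pmf.prob ?P {\<omega>. \<exists>i\<in>{1..n}. 18 * real n * ln (real n) / p < (\<Sum>j=1..n. noise m p \<theta> \<omega> i j)\<^sup>2}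
      \<le> measure_pmf.prob ?P (\<Union>x\<in>?I. ?B x)"
    by (rule measure_pmf.finite_measure_mono) simp
  also have "\<dots> \<le> (\<Sum>x\<in>?I. measure_pmf.prob ?P (?B x))"
    by (rule measure_pmf.finite_measure_subadditive_finite) auto
  also have "\<dots> \<le> (\<Sum>x\<in>?I. 1 / (real n)\<^sup>2)"
  proof (rule sum_mono)
    fix x assume "x \<in> ?I"
    then obtain i s where "x = (i, s)" "i \<in> {1..n}" "\<bar>s\<bar> = 1" by auto
    then show "measure_pmf.prob ?P (?B x) \<le> 1 / (real n)\<^sup>2" using one[of i s] by simp
  qed
  also have "\<dots> = 2 / real n" using n by (simp add: card_cartesian_product power2_eq_square field_simps)
  finally show ?thesis .
qed

text \<open>With this threshold the exponent in \<open>p_hat_tail\<close> is 4 ln n (n choose 2) /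
  n^2, which is at least ln n; the lower bound on \<open>p\<close> keeps the threshold at most
  2.\<close>

lemma p_hat_deviation:
  assumes v: "valid_param m n \<theta>" and p: "2 * ln (real n) / real n \<le> p" "p \<le> 1" and n: "n \<ge> 32"
  shows "measure_pmf.prob (data_pmf n p \<theta>)
      {\<omega>. 16 * ln (real n) / ((real n)\<^sup>2 * p) < (p_hat n \<omega> / p - 1)\<^sup>2} \<le> 2 / real n"
proof -
  have ln0: "ln (real n) > 0" using n by simp
  have p0: "p > 0" by (rule less_le_trans[OF _ p(1)]) (use n ln0 in simp)
  define x where "x = sqrt (16 * ln (real n) / ((real n)\<^sup>2 * p))"
  have x2: "x\<^sup>2 = 16 * ln (real n) / ((real n)\<^sup>2 * p)" and x0: "x \<ge> 0"
    unfolding x_def using p0 ln0 by simp_all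
  have "x\<^sup>2 \<le> 2\<^sup>2"
  proof -
    have "2 * ln (real n) \<le> p * real n" using p(1) n by (simp add: field_simps)
    then have "16 * ln (real n) \<le> 8 * (p * real n)" by simp
    also have "\<dots> \<le> real n * (p * real n)" using n p0 by (intro mult_right_mono) auto
    also have "\<dots> \<le> 4 * ((real n)\<^sup>2 * p)" using p0 by (simp add: power2_eq_square)
    finally show ?thesis unfolding x2 using p0 n by (simp add: field_simps)
  qed
  then have "x \<le> 2" by (rule power2_le_imp_le) simp
  have sub: "{\<omega>. 16 * ln (real n) / ((real n)\<^sup>2 * p) < (p_hat n \<omega> / p - 1)\<^sup>2} = {\<omega>. x < \<bar>p_hat n \<omega> / p - 1\<bar>}"
    unfolding x2[symmetric] power2_less_iff_less_abs[OF x0] ..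
  have "measure_pmf.prob (data_pmf n p \<theta>) {\<omega>. x < \<bar>p_hat n \<omega> / p - 1\<bar>}
      \<le> 2 * exp (- (x\<^sup>2 * p * real (n choose 2) / 4))"
    by (rule p_hat_tail[OF v p0 p(2)]) (use n x0 \<open>x \<le> 2\<close> in auto)
  also have "\<dots> \<le> 2 * exp (- ln (real n))"
  proof -
    have "even (n * (n - 1))" by (cases n) auto
    then have "2 * (n choose 2) = n * (n - 1)" by (simp add: choose_two)
    then have "real (2 * (n choose 2)) = real (n * (n - 1))" by simp
    then have N: "2 * real (n choose 2) = real n * (real n - 1)" using n by (simp add: of_nat_diff)
    have "real n * (real n / 2) \<le> real n * (real n - 1)" using n by (intro mult_left_mono) auto
    then have "(real n)\<^sup>2 \<le> 4 * real (n choose 2)" using N by (simp add: power2_eq_square)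
    then have "ln (real n) * (real n)\<^sup>2 \<le> ln (real n) * (4 * real (n choose 2))"
      using ln0 by (intro mult_left_mono) auto
    then have "ln (real n) \<le> x\<^sup>2 * p * real (n choose 2) / 4"
      unfolding x2 using p0 n by (simp add: field_simps)
    then show ?thesis by simp
  qed
  also have "\<dots> = 2 / real n" using n by (simp add: exp_minus inverse_eq_divide)
  finally show ?thesis unfolding sub .
qed

text \<open>All that the deterministic part of the argument needs from the random data. The constant
  is 7936 = 64 times 124: the choice u = 124 n ln n exceeds 123 n ln n, a bound on the logarithm of
  the number of patterns, by n ln n.\<close>

definition good_data :: "model \<Rightarrow> nat \<Rightarrow> real \<Rightarrow> (nat \<Rightarrow> nat \<Rightarrow> real) \<Rightarrow> nat \<Rightarrow> data \<Rightarrow> bool" where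
  "good_data m n p \<theta> l \<omega> \<longleftrightarrow>
     (p_hat n \<omega> / p - 1)\<^sup>2 \<le> 16 * ln (real n) / ((real n)\<^sup>2 * p) \<and>
     (\<forall>i\<in>{1..n}. (\<Sum>j=1..n. noise m p \<theta> \<omega> i j)\<^sup>2 \<le> 18 * real n * ln (real n) / p) \<and>
     (\<forall>G\<in>patterns n (24 * n) (4 ^ l) l. (\<Sum>i=1..n. \<Sum>j=1..n. noise m p \<theta> \<omega> i j * G i j)
        \<le> (\<Sum>i=1..n. \<Sum>j=1..n. (G i j)\<^sup>2) / 32 + 7936 * real n * ln (real n) / p)"

text \<open>Each of the 24 n slots costs at most n^2 times 17 n^2, which is at most n^5; the two
  maps cost n^n each, and the level costs n^2. The exponent 2 + 2 n + 120 n is at most 123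
  n.\<close>

lemma card_patterns_le:
  assumes n: "n \<ge> 32" and l: "2 ^ l \<le> 2 * n"
  shows "card (patterns n (24 * n) (4 ^ l) l) \<le> n ^ (123 * n)"
proof -
  have n0: "n > 0" using n by simp
  have "Suc l \<le> 2 ^ l" by (rule Suc_leI[OF less_exp])
  also have "\<dots> \<le> n\<^sup>2" by (rule order_trans[OF l]) (use n in \<open>simp add: power2_eq_square\<close>)
  finally have 1: "Suc l \<le> n\<^sup>2" .
  have "(4 :: nat) ^ l = (2 ^ l)\<^sup>2" by (simp add: power2_eq_square power_mult_distrib[symmetric])
  also have "\<dots> \<le> (2 * n)\<^sup>2" using l by (rule power_mono) simp
  finally have "(4 :: nat) ^ l \<le> 4 * n\<^sup>2" by (simp add: power_mult_distrib)
  moreover have "1 \<le> n\<^sup>2" using n by simp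
  ultimately have "4 * (4 :: nat) ^ l + 1 \<le> 16 * n\<^sup>2 + n\<^sup>2" by linarith
  also have "\<dots> = 17 * n\<^sup>2" by simp
  also have "\<dots> \<le> n * n\<^sup>2" using n by (intro mult_right_mono) auto
  finally have "n\<^sup>2 * (4 * 4 ^ l + 1) \<le> n\<^sup>2 * (n * n\<^sup>2)" by (rule mult_left_mono) simp
  also have "\<dots> = n ^ 5" by (simp add: power_numeral_reduce)
  finally have 2: "(n\<^sup>2 * (4 * 4 ^ l + 1)) ^ (24 * n) \<le> (n ^ 5) ^ (24 * n)" by (rule power_mono) simp
  have "card (patterns n (24 * n) (4 ^ l) l) \<le> n\<^sup>2 * (n ^ n * (n ^ n * (n ^ 5) ^ (24 * n)))"
    by (rule order_trans[OF patterns_card(2)[OF n0]]) (intro mult_mono 1 2 order_refl, auto)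
  also have "\<dots> = n ^ (2 + (n + (n + 5 * (24 * n))))" by (simp only: power_add power_mult)
  also have "\<dots> \<le> n ^ (123 * n)" using n by (intro power_increasing) auto
  finally show ?thesis .
qed

lemma prob_not_good:
  assumes v: "valid_param m n \<theta>" and p: "2 * ln (real n) / real n \<le> p" "p \<le> 1" and n: "n \<ge> 32"
    and l: "2 ^ l \<le> 2 * n"
  shows "measure_pmf.prob (data_pmf n p \<theta>) {\<omega>. \<not> good_data m n p \<theta> l \<omega>} \<le> 5 / real n"
proof -
  let ?P = "data_pmf n p \<theta>"
  have ln0: "ln (real n) > 0" using n by simp
  have p0: "p > 0" by (rule less_le_trans[OF _ p(1)]) (use n ln0 in simp)
  let ?A = "{\<omega>. 16 * ln (real n) / ((real n)\<^sup>2 * p) < (p_hat n \<omega> / p - 1)\<^sup>2}"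
  let ?B = "{\<omega>. \<exists>i\<in>{1..n}. 18 * real n * ln (real n) / p < (\<Sum>j=1..n. noise m p \<theta> \<omega> i j)\<^sup>2}"
  let ?C = "{\<omega>. \<exists>G\<in>patterns n (24 * n) (4 ^ l) l. (\<Sum>i=1..n. \<Sum>j=1..n. (G i j)\<^sup>2) / 32
      + 7936 * real n * ln (real n) / p < (\<Sum>i=1..n. \<Sum>j=1..n. noise m p \<theta> \<omega> i j * G i j)}"
  have "{\<omega>. \<not> good_data m n p \<theta> l \<omega>} \<subseteq> ?A \<union> (?B \<union> ?C)"
    unfolding good_data_def not_le[symmetric] by blast
  then have "measure_pmf.prob ?P {\<omega>. \<not> good_data m n p \<theta> l \<omega>} \<le> measure_pmf.prob ?P (?A \<union> (?B \<union> ?C))"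
    by (rule measure_pmf.finite_measure_mono) simp
  also have "\<dots> \<le> measure_pmf.prob ?P ?A + (measure_pmf.prob ?P ?B + measure_pmf.prob ?P ?C)"
    by (rule order_trans[OF measure_Un_le]) (auto intro: measure_Un_le)
  also have "measure_pmf.prob ?P ?C \<le> 1 / real n"
  proof -
    have "measure_pmf.prob ?P ?C \<le> real (card (patterns n (24 * n) (4 ^ l) l)) * exp (- (124 * real n * ln (real n)))"
      using patterns_tail[OF v p0 p(2), where u = "124 * real n * ln (real n)"] n by (simp add: mult.assoc)
    also have "\<dots> \<le> real (n ^ (123 * n)) * exp (- (124 * real n * ln (real n)))"
      using card_patterns_le[OF n l] by (intro mult_right_mono) (simp_all del: of_nat_power)
    also have "real (n ^ (123 * n)) = exp (real (123 * n) * ln (real n))"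
      using n by (simp only: exp_of_nat_mult of_nat_power) simp
    also have "\<dots> * exp (- (124 * real n * ln (real n))) = exp (- (real n * ln (real n)))"
      by (simp add: exp_add[symmetric] algebra_simps)
    also have "\<dots> \<le> exp (- ln (real n))" using ln0 n by simp
    also have "\<dots> = 1 / real n" using n by (simp add: exp_minus inverse_eq_divide)
    finally show ?thesis .
  qed
  finally show ?thesis
    using p_hat_deviation[OF v p n] row_noise_tail[OF v p] n by simp
qed

section \<open>The model sets\<close>

text \<open>Tychonoff's theorem, restated for the topology that function types carry.\<close>

lemma compact_pointwise:
  fixes S :: "'i \<Rightarrow> 'a::topological_space set"
  assumes "\<And>i. compact (S i)"
  shows "compact {f. \<forall>i. f i \<in> S i}"
proof -
  have "compactin (product_topology (\<lambda>i::'i. euclidean :: 'a topology) UNIV) (PiE UNIV S)"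
    unfolding compactin_PiE using assms by simp
  then have "compact (PiE UNIV S)" unfolding euclidean_product_topology compactin_euclidean_iff .
  also have "PiE UNIV S = {f. \<forall>i. f i \<in> S i}" unfolding PiE_UNIV_domain Pi_def by blast
  finally show ?thesis .
qed

lemma continuous_on_entry: "continuous_on UNIV (\<lambda>\<theta> :: nat \<Rightarrow> nat \<Rightarrow> real. \<theta> i j)"
proof -
  have "continuous_on UNIV (\<lambda>\<theta> :: nat \<Rightarrow> nat \<Rightarrow> real. \<theta> i)"
    by (rule continuous_on_product_then_coordinatewise[where f = "\<lambda>\<theta>. \<theta>"]) (rule continuous_on_id)
  then show ?thesis
    by (rule continuous_on_product_then_coordinatewise[where f = "\<lambda>\<theta>. \<theta> i"])
qed

text \<open>A product of unit intervals over the square of indices and of singletons elsewhere,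
  since extensionality fixes the values outside. A row beyond the index range is
  \<open>undefined\<close> as a function, so its entries are \<open>undefined j\<close>.\<close>

lemma compact_matrices: "compact (matrices n {0..1})"
proof -
  define T where "T = (\<lambda>i j. if i \<in> {1..n} then (if j \<in> {1..n} then {0..1::real} else {undefined})
    else {(undefined :: nat \<Rightarrow> real) j})"
  have "compact {\<theta>. \<forall>i. \<theta> i \<in> {g. \<forall>j. g j \<in> T i j}}"
    by (intro compact_pointwise) (auto simp: T_def)
  moreover have "matrices n {0..1} = {\<theta>. \<forall>i. \<theta> i \<in> {g. \<forall>j. g j \<in> T i j}}"
  proof (intro equalityI subsetI)
    fix \<theta> assume "\<theta> \<in> matrices n {0..1}"
    then show "\<theta> \<in> {\<theta>. \<forall>i. \<theta> i \<in> {g. \<forall>j. g j \<in> T i j}}"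
      unfolding matrices_def T_def by (auto simp: PiE_def extensional_def Pi_def)
  next
    fix \<theta> assume *: "\<theta> \<in> {\<theta>. \<forall>i. \<theta> i \<in> {g. \<forall>j. g j \<in> T i j}}"
    have "\<theta> i = undefined" if "i \<notin> {1..n}" for i
    proof (rule ext)
      fix j
      have "\<theta> i j \<in> T i j" using * by simp
      then show "\<theta> i j = undefined j" using that by (simp add: T_def del: atLeastAtMost_iff)
    qed
    moreover have "\<theta> i \<in> {1..n} \<rightarrow>\<^sub>E {0..1}" if "i \<in> {1..n}" for i
    proof (rule PiE_I)
      have "\<theta> i j \<in> T i j" for j using * by simp
      then have "\<theta> i j \<in> (if j \<in> {1..n} then {0..1} else {undefined})" for j
        using that unfolding T_def by metis
      then show "j \<in> {1..n} \<Longrightarrow> \<theta> i j \<in> {0..1}" "j \<notin> {1..n} \<Longrightarrow> \<theta> i j = undefined" for j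
        by (metis, metis singletonD)
    qed
    ultimately show "\<theta> \<in> matrices n {0..1}" unfolding matrices_def by (intro PiE_I) blast+
  qed
  ultimately show ?thesis by simp
qed

lemma compact_model_set: "compact (model_set m n)"
proof -
  note cl = closed_Collect_conj closed_Collect_all closed_Collect_imp open_Collect_const
    closed_Collect_le closed_Collect_eq continuous_on_entry continuous_on_const continuous_on_diff
  show ?thesis
  proof (cases m)
    case Tournament
    have "tournament_set n = matrices n {0..1} \<inter> {\<theta>.
     (\<forall>i\<in>{1..n}. \<forall>j\<in>{1..n}. \<forall>k\<in>{1..n}. i \<noteq> k \<and> i \<noteq> j \<and> k < j \<longrightarrow> \<theta> i j \<le> \<theta> i k) \<and>
     (\<forall>i\<in>{1..n}. \<forall>j\<in>{1..n}. i \<noteq> j \<longrightarrow> \<theta> j i = 1 - \<theta> i j) \<and>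
     (\<forall>i\<in>{1..n}. \<theta> i i = 0) \<and>
     (\<forall>i\<in>{1..n}. \<forall>j\<in>{1..n}. i < j \<longrightarrow> \<theta> i j \<le> 1 / 2)}"
      unfolding tournament_set_def by blast
    also have "compact \<dots>"
      unfolding Ball_def by (intro compact_Int_closed compact_matrices cl)
    finally show ?thesis using Tournament by simp
  next
    case Graph
    have "graph_set n = matrices n {0..1} \<inter> {\<theta>.
     (\<forall>i\<in>{1..n}. \<forall>j\<in>{1..n}. \<forall>k\<in>{1..n}. i \<noteq> k \<and> i \<noteq> j \<and> j < k \<longrightarrow> \<theta> i j \<le> \<theta> i k) \<and>
     (\<forall>i\<in>{1..n}. \<forall>j\<in>{1..n}. i \<noteq> j \<longrightarrow> \<theta> j i = \<theta> i j) \<and>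
     (\<forall>i\<in>{1..n}. \<theta> i i = 0)}"
      unfolding graph_set_def by blast
    also have "compact \<dots>"
      unfolding Ball_def by (intro compact_Int_closed compact_matrices cl)
    finally show ?thesis using Graph by simp
  qed
qed

lemma model_set_nonempty: "model_set m n \<noteq> {}"
proof -
  have "(\<lambda>i\<in>{1..n}. \<lambda>j\<in>{1..n}. J i j / 2) \<in> model_set m n"
    by (cases m) (auto simp: tournament_set_def graph_set_def matrices_def J_def)
  then show ?thesis by blast
qed

lemma frob_norm_sq: "(frob_norm n A)\<^sup>2 = (\<Sum>i=1..n. \<Sum>j=1..n. (A i j)\<^sup>2)"
  unfolding frob_norm_def L2_set_def
  by (simp add: sum_nonneg sum.cartesian_product split_beta)

lemma frob_norm_nonneg: "0 \<le> frob_norm n A"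
  unfolding frob_norm_def by (rule L2_set_nonneg)

text \<open>On a compact set the continuous distance attains its minimum, so the choice operator in
  \<open>frob_proj\<close> picks a minimizer.\<close>

lemma frob_proj_minimizes:
  assumes "compact K" "K \<noteq> {}"
  shows "frob_proj n K Z \<in> K"
    and "A \<in> K \<Longrightarrow> (\<Sum>i=1..n. \<Sum>j=1..n. (Z i j - frob_proj n K Z i j)\<^sup>2) \<le> (\<Sum>i=1..n. \<Sum>j=1..n. (Z i j - A i j)\<^sup>2)"
proof -
  have "continuous_on K (\<lambda>B. frob_dist n Z B)"
    unfolding frob_dist_def frob_norm_def L2_set_def split_beta
    by (intro continuous_intros continuous_on_subset[OF continuous_on_entry] subset_UNIV)
  from continuous_attains_inf[OF assms this]
  have "\<exists>B. B \<in> K \<and> (\<forall>B'\<in>K. frob_dist n Z B \<le> frob_dist n Z B')" by blast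
  from someI_ex[OF this]
  have *: "frob_proj n K Z \<in> K" "\<forall>B'\<in>K. frob_dist n Z (frob_proj n K Z) \<le> frob_dist n Z B'"
    unfolding frob_proj_def by auto
  then show "frob_proj n K Z \<in> K" by simp
  assume "A \<in> K"
  then have "(frob_dist n Z (frob_proj n K Z))\<^sup>2 \<le> (frob_dist n Z A)\<^sup>2"
    using * by (intro power_mono) (auto simp: frob_dist_def frob_norm_nonneg)
  then show "(\<Sum>i=1..n. \<Sum>j=1..n. (Z i j - frob_proj n K Z i j)\<^sup>2) \<le> (\<Sum>i=1..n. \<Sum>j=1..n. (Z i j - A i j)\<^sup>2)"
    unfolding frob_dist_def frob_norm_sq .
qed

text \<open>The zero diagonal breaks monotonicity. Replacing it as follows restores it, at the cost
  of at most doubling squared distances.\<close>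

definition fill_diag :: "model \<Rightarrow> nat \<Rightarrow> (nat \<Rightarrow> nat \<Rightarrow> real) \<Rightarrow> nat \<Rightarrow> nat \<Rightarrow> real" where
  "fill_diag m n B i j = (if i \<noteq> j then B i j else
     case m of Tournament \<Rightarrow> 1 / 2 | Graph \<Rightarrow> if i < n then B i (Suc i) else B n (n - 1))"

text \<open>Tournament matrices decrease along rows, so their columns are listed backwards to make
  them nondecreasing in both indices. Both formulas also pass from 0-based positions to 1-based
  indices.\<close>

definition column :: "model \<Rightarrow> nat \<Rightarrow> nat \<Rightarrow> nat" where
  "column m n l = (case m of Tournament \<Rightarrow> n - l | Graph \<Rightarrow> Suc l)"

lemma model_setD:
  assumes "B \<in> model_set m n" "i \<in> {1..n}" "j \<in> {1..n}"
  shows "0 \<le> B i j" "B i j \<le> 1" "B i i = 0"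
proof -
  have "B \<in> matrices n {0..1} \<and> (\<forall>i\<in>{1..n}. B i i = 0)"
  proof (cases m)
    case Tournament
    then have "B \<in> tournament_set n" using assms(1) by simp
    then show ?thesis unfolding tournament_set_def by blast
  next
    case Graph
    then have "B \<in> graph_set n" using assms(1) by simp
    then show ?thesis unfolding graph_set_def by blast
  qed
  then have "B i j \<in> {0..1}" "B i i = 0"
    unfolding matrices_def using assms(2,3) by (blast dest: PiE_mem)+
  then show "0 \<le> B i j" "B i j \<le> 1" "B i i = 0" by auto
qed

text \<open>In each row the entries left of the diagonal are at least 1/2 and those right of it at
  most 1/2, so the value 1/2 fits in between. The relation \<open>B b a = 1 - B a b\<close> carries
  monotonicity along rows over to columns.\<close>

lemma fill_diag_tournament_mono:
  assumes B: "B \<in> tournament_set n" and ij: "i \<in> {1..n}" "i' \<in> {1..n}" "j \<in> {1..n}" "j' \<in> {1..n}"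
    and le: "i \<le> i'" "j' \<le> j"
  shows "fill_diag Tournament n B i j \<le> fill_diag Tournament n B i' j'"
proof -
  have row: "B a b \<le> B a c" if "a \<in> {1..n}" "b \<in> {1..n}" "c \<in> {1..n}" "a \<noteq> b" "a \<noteq> c" "c \<le> b" for a b c
  proof (cases "c = b")
    case False
    then have "c < b" using that by simp
    moreover have "\<forall>i\<in>{1..n}. \<forall>j\<in>{1..n}. \<forall>k\<in>{1..n}. i \<noteq> k \<and> i \<noteq> j \<and> k < j \<longrightarrow> B i j \<le> B i k"
      using B unfolding tournament_set_def by blast
    ultimately show ?thesis using that by blast
  qed simp
  have sym: "B b a = 1 - B a b" if "a \<in> {1..n}" "b \<in> {1..n}" "a \<noteq> b" for a b
    using B that unfolding tournament_set_def by blast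
  have half: "B a b \<le> 1 / 2" if "a \<in> {1..n}" "b \<in> {1..n}" "a < b" for a b
    using B that unfolding tournament_set_def by blast
  have half': "1 / 2 \<le> B a b" if "a \<in> {1..n}" "b \<in> {1..n}" "b < a" for a b
    using half[of b a] sym[of b a] that by simp
  have "fill_diag Tournament n B i j \<le> fill_diag Tournament n B i j'"
    using row[of i j j'] half[of i j] half'[of i j'] ij le(2) unfolding fill_diag_def by auto
  also have "\<dots> \<le> fill_diag Tournament n B i' j'"
    using row[of j' i' i] sym[of j' i] sym[of j' i'] half[of i j'] half'[of i' j'] ij le(1)
    unfolding fill_diag_def by auto
  finally show ?thesis .
qed

text \<open>The diagonal entry copies its right neighbour, or its left one in the last row, so each
  row stays monotone across the gap. The filled matrix is still symmetric, which gives monotone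
  columns as well.\<close>

lemma fill_diag_graph_mono:
  assumes B: "B \<in> graph_set n" and ij: "i \<in> {1..n}" "i' \<in> {1..n}" "j \<in> {1..n}" "j' \<in> {1..n}"
    and le: "i \<le> i'" "j \<le> j'"
  shows "fill_diag Graph n B i j \<le> fill_diag Graph n B i' j'"
proof -
  have row: "B a b \<le> B a c" if "a \<in> {1..n}" "b \<in> {1..n}" "c \<in> {1..n}" "a \<noteq> b" "a \<noteq> c" "b \<le> c" for a b c
  proof (cases "c = b")
    case False
    then have "b < c" using that by simp
    moreover have "\<forall>i\<in>{1..n}. \<forall>j\<in>{1..n}. \<forall>k\<in>{1..n}. i \<noteq> k \<and> i \<noteq> j \<and> j < k \<longrightarrow> B i j \<le> B i k"
      using B unfolding graph_set_def by blast
    ultimately show ?thesis using that by blast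
  qed simp
  have sym: "B b a = B a b" if "a \<in> {1..n}" "b \<in> {1..n}" "a \<noteq> b" for a b
    using B that unfolding graph_set_def by blast
  have fsym: "fill_diag Graph n B a b = fill_diag Graph n B b a" if "a \<in> {1..n}" "b \<in> {1..n}" for a b
    using sym[OF that] unfolding fill_diag_def by auto
  have frow: "fill_diag Graph n B a b \<le> fill_diag Graph n B a c"
    if abc: "a \<in> {1..n}" "b \<in> {1..n}" "c \<in> {1..n}" "b \<le> c" for a b c
  proof (cases "b = c \<or> (a \<noteq> b \<and> a \<noteq> c)")
    case True
    then show ?thesis using row[OF abc(1-3)] abc(4) unfolding fill_diag_def by auto
  next
    case False
    show ?thesis
    proof (cases "a = b")
      case True
      then have "a < c" "a < n" using False abc by auto
      then show ?thesis using row[of a "Suc a" c] abc True unfolding fill_diag_def by auto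
    next
      case ne: False
      then have "a = c" "b < a" using False abc by auto
      then show ?thesis
        using row[of a b "Suc a"] row[of a b "n - 1"] abc unfolding fill_diag_def by (cases "a < n") auto
    qed
  qed
  have "fill_diag Graph n B i j \<le> fill_diag Graph n B i j'" by (rule frow) (use ij le in auto)
  also have "\<dots> \<le> fill_diag Graph n B i' j'"
    using frow[of j' i i'] fsym[of j' i] fsym[of j' i'] ij le by simp
  finally show ?thesis .
qed

lemma fill_diag_01:
  assumes "B \<in> model_set m n" "i \<in> {1..n}" "j \<in> {1..n}" "n \<ge> 2"
  shows "fill_diag m n B i j \<in> {0..1}"
proof -
  have "Suc i \<in> {1..n}" if "i < n" using that by simp
  moreover have "n - 1 \<in> {1..n}" "n \<in> {1..n}" using assms(4) by auto
  ultimately show ?thesis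
    using model_setD(1,2)[OF assms(1)] assms(2,3) unfolding fill_diag_def by (cases m) auto
qed

definition embed :: "model \<Rightarrow> nat \<Rightarrow> (nat \<Rightarrow> nat \<Rightarrow> real) \<Rightarrow> nat \<times> nat \<Rightarrow> real" where
  "embed m n B x = fill_diag m n B (Suc (fst x)) (column m n (snd x))"

lemma bij_betw_Suc: "bij_betw Suc {..<n} {1..n}"
  by (rule bij_betw_byWitness[where f' = "\<lambda>i. i - 1"]) auto

lemma bij_betw_column: "bij_betw (column m n) {..<n} {1..n}"
proof (cases m)
  case Tournament
  then show ?thesis
    by (intro bij_betw_byWitness[where f' = "\<lambda>i. n - i"]) (auto simp: column_def)
next
  case Graph
  then have "column m n = Suc" by (auto simp: column_def)
  then show ?thesis using bij_betw_Suc by simp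
qed

lemma bimono_embed:
  assumes B: "B \<in> model_set m n" and n: "n \<ge> 2"
  shows "bimono n (embed m n B)"
proof -
  have col: "column m n l \<in> {1..n}" if "l < n" for l
    using bij_betw_column[of m n] that by (auto simp: bij_betw_def)
  have "embed m n B (i, j) \<le> embed m n B (i', j')" if "i \<le> i'" "i' < n" "j \<le> j'" "j' < n" for i j i' j'
  proof (cases m)
    case Tournament
    then show ?thesis using B that col[of j] col[of j'] unfolding embed_def column_def
      by (auto intro!: fill_diag_tournament_mono)
  next
    case Graph
    then show ?thesis using B that col[of j] col[of j'] unfolding embed_def column_def
      by (auto intro!: fill_diag_graph_mono)
  qed
  moreover have "embed m n B x \<in> {0..1}" if "x \<in> {..<n} \<times> {..<n}" for x
    unfolding embed_def by (rule fill_diag_01[OF B _ _ n]) (use col that in auto)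
  ultimately show ?thesis unfolding bimono_def by blast
qed

lemma sum_square_reindex:
  assumes "bij_betw a {..<n} {1..n}" "bij_betw b {..<n} {1..n}"
  shows "(\<Sum>x\<in>{..<n} \<times> {..<n}. f (a (fst x)) (b (snd x))) = (\<Sum>i=1..n. \<Sum>j=1..n. f i j :: real)"
proof -
  have "(\<Sum>x\<in>{..<n} \<times> {..<n}. f (a (fst x)) (b (snd x))) = (\<Sum>k<n. \<Sum>l<n. f (a k) (b l))"
    by (simp add: sum.cartesian_product split_beta)
  also have "\<dots> = (\<Sum>k<n. \<Sum>j=1..n. f (a k) j)"
    by (intro sum.cong refl sum.reindex_bij_betw[OF assms(2)])
  also have "\<dots> = (\<Sum>i=1..n. \<Sum>j=1..n. f i j)" by (rule sum.reindex_bij_betw[OF assms(1)])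
  finally show ?thesis .
qed

text \<open>In the tournament model the filled diagonals agree. In the graph model each diagonal
  difference repeats an off-diagonal difference of the same row, so the squared sum of a row at most
  doubles.\<close>

lemma fill_diag_dist:
  assumes "A \<in> model_set m n" "B \<in> model_set m n" "n \<ge> 2"
  shows "(\<Sum>i=1..n. \<Sum>j=1..n. (fill_diag m n B i j - fill_diag m n A i j)\<^sup>2)
    \<le> 2 * (\<Sum>i=1..n. \<Sum>j=1..n. (B i j - A i j)\<^sup>2)"
proof -
  define H where "H = (\<lambda>i j. fill_diag m n B i j - fill_diag m n A i j)"
  define D where "D = (\<lambda>i j. B i j - A i j)"
  have off: "H i j = D i j" if "i \<noteq> j" for i j using that unfolding H_def D_def fill_diag_def by simp
  have diag: "(H i i)\<^sup>2 \<le> (\<Sum>j=1..n. (D i j)\<^sup>2)" if i: "i \<in> {1..n}" for i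
  proof (cases m)
    case Tournament
    then show ?thesis unfolding H_def fill_diag_def by (simp add: sum_nonneg)
  next
    case Graph
    define j where "j = (if i < n then Suc i else n - 1)"
    have j: "j \<in> {1..n}" "H i i = D i j"
      using i assms(3) Graph unfolding j_def H_def D_def fill_diag_def by auto
    have "(D i j)\<^sup>2 \<le> (\<Sum>j=1..n. (D i j)\<^sup>2)" by (rule member_le_sum) (use j in auto)
    then show ?thesis using j(2) by simp
  qed
  have "(\<Sum>i=1..n. \<Sum>j=1..n. (H i j)\<^sup>2)
      \<le> (\<Sum>i=1..n. (\<Sum>j=1..n. (D i j)\<^sup>2) + (\<Sum>j=1..n. (D i j)\<^sup>2))"
  proof (rule sum_mono)
    fix i assume i: "i \<in> {1..n}"
    have "(\<Sum>j=1..n. (H i j)\<^sup>2) = (\<Sum>j\<in>{1..n} - {i}. (H i j)\<^sup>2) + (H i i)\<^sup>2"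
      using i by (simp add: sum.remove)
    also have "(\<Sum>j\<in>{1..n} - {i}. (H i j)\<^sup>2) = (\<Sum>j\<in>{1..n} - {i}. (D i j)\<^sup>2)"
      by (intro sum.cong refl) (simp add: off)
    also have "\<dots> \<le> (\<Sum>j=1..n. (D i j)\<^sup>2)" by (rule sum_mono2) auto
    finally show "(\<Sum>j=1..n. (H i j)\<^sup>2) \<le> (\<Sum>j=1..n. (D i j)\<^sup>2) + (\<Sum>j=1..n. (D i j)\<^sup>2)"
      using diag[OF i] by simp
  qed
  then show ?thesis unfolding H_def D_def by (simp only: sum.distrib mult_2)
qed

lemma noise_abs_le:
  assumes v: "valid_param m n \<theta>" and p: "0 < p" "p \<le> 1" and ij: "i \<in> {1..n}" "j \<in> {1..n}"
  shows "\<bar>noise m p \<theta> \<omega> i j\<bar> \<le> 1 / p"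
proof -
  have up: "\<bar>noise m p \<theta> \<omega> a b\<bar> \<le> 1 / p" if "a \<in> {1..n}" "b \<in> {1..n}" "a < b" for a b
    unfolding noise_upper[OF that(3)]
    by (rule centered_entry_moments(2)[OF valid_paramD(1,2)[OF v that(1,2)] p])
  consider "i < j" | "j < i" | "i = j" by linarith
  then show ?thesis
  proof cases
    case 1
    then show ?thesis by (rule up[OF ij])
  next
    case 2
    have "\<bar>reflect_sign m\<bar> = 1" by (cases m) (auto simp: reflect_sign_def)
    then show ?thesis
      using up[OF ij(2,1) 2] noise_lower[OF v 2 ij(2,1)] by (simp add: abs_mult)
  next
    case 3
    then show ?thesis using noise_diag[OF v ij(1)] p by simp
  qed
qed

text \<open>Positions of rows and of columns reach the original indices by different maps when the
  columns are reversed, hence the two maps in a pattern. The constants are 3 / 4 = 24 / 32 and 1 /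
  16 = 2 / 32, the 2 coming from \<open>fill_diag_dist\<close>.\<close>

lemma noise_pairing_le:
  assumes v: "valid_param m n \<theta>" and p: "0 < p" "p \<le> 1" and n: "n \<ge> 2"
    and l: "n \<le> 2 ^ l" "2 ^ l \<le> 2 * n" and good: "good_data m n p \<theta> l \<omega>"
    and \<sigma>: "\<sigma> permutes {1..n}" and A: "A \<in> model_set m n" and B: "B \<in> model_set m n"
  shows "(\<Sum>i=1..n. \<Sum>j=1..n. noise m p \<theta> \<omega> (\<sigma> i) (\<sigma> j) * (B i j - A i j))
    \<le> (\<Sum>i=1..n. \<Sum>j=1..n. (B i j - A i j)\<^sup>2) / 16
      + real (Suc l) * (3 / 4 * real n + 2 * (7936 * real n * ln (real n) / p) + 1 / p)"
proof -
  let ?X = "{..<n} \<times> {..<n}"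
  define W where "W = 7936 * real n * ln (real n) / p"
  define a where "a = (\<lambda>k. \<sigma> (Suc k))"
  define b where "b = (\<lambda>k. \<sigma> (column m n k))"
  have ab: "bij_betw a {..<n} {1..n}" "bij_betw b {..<n} {1..n}"
    using bij_betw_trans[OF bij_betw_Suc permutes_imp_bij[OF \<sigma>]]
      bij_betw_trans[OF bij_betw_column permutes_imp_bij[OF \<sigma>], of m]
    unfolding a_def b_def comp_def by auto
  \<comment> \<open>The inverses of \<open>a\<close> and \<open>b\<close> carry a block function
    from positions back to the original indices: the reordered noise paired with it is the original
    noise paired with a pattern.\<close>
  define \<rho> where "\<rho> = (\<lambda>i\<in>{1..n}. inv_into {..<n} a i)"
  define \<tau> where "\<tau> = (\<lambda>i\<in>{1..n}. inv_into {..<n} b i)"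
  have inv_in: "inv_into {..<n} h i \<in> {..<n}" if "bij_betw h {..<n} {1..n}" "i \<in> {1..n}" for h i
    by (rule inv_into_into) (use that in \<open>simp add: bij_betw_def\<close>)
  have \<rho>\<tau>: "\<rho> \<in> {1..n} \<rightarrow>\<^sub>E {..<n}" "\<tau> \<in> {1..n} \<rightarrow>\<^sub>E {..<n}"
    unfolding \<rho>_def \<tau>_def restrict_PiE_iff using inv_in[OF ab(1)] inv_in[OF ab(2)] by blast+
  have inv: "\<rho> (a k) = k" "\<tau> (b k) = k" if "k < n" for k
    using ab that unfolding \<rho>_def \<tau>_def bij_betw_def by (auto simp: inv_into_f_f)
  define e where "e = (\<lambda>x. noise m p \<theta> \<omega> (a (fst x)) (b (snd x)))"
  have ctrl: "controlled n e (24 * n) (4 ^ l) (1 / 32) W k" if "k \<le> l" for k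
    unfolding controlled_def
  proof (intro allI impI)
    fix c assume c: "range c \<subseteq> grid (4 ^ l)" "\<forall>q. q \<notin> blocks n k \<longrightarrow> c q = 0" "card {q. c q \<noteq> 0} \<le> 24 * n"
    define G where "G = (\<lambda>i j. c (block k (\<rho> i, \<tau> j)))"
    have "G \<in> patterns n (24 * n) (4 ^ l) l"
      unfolding patterns_def G_def sparse_coeffs_def using \<rho>\<tau> c that by blast
    then have "(\<Sum>i=1..n. \<Sum>j=1..n. noise m p \<theta> \<omega> i j * G i j) \<le> (\<Sum>i=1..n. \<Sum>j=1..n. (G i j)\<^sup>2) / 32 + W"
      using good unfolding good_data_def W_def by blast
    moreover have Gx: "G (a (fst x)) (b (snd x)) = c (block k x)" if "x \<in> ?X" for x
      using that inv unfolding G_def by auto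
    have "(\<Sum>i=1..n. \<Sum>j=1..n. noise m p \<theta> \<omega> i j * G i j) = (\<Sum>x\<in>?X. e x * c (block k x))"
      unfolding sum_square_reindex[OF ab, symmetric] e_def by (intro sum.cong refl) (simp add: Gx del: mem_Sigma_iff)
    moreover have "(\<Sum>i=1..n. \<Sum>j=1..n. (G i j)\<^sup>2) = (\<Sum>x\<in>?X. (c (block k x))\<^sup>2)"
      unfolding sum_square_reindex[OF ab, symmetric] by (intro sum.cong refl) (simp add: Gx del: mem_Sigma_iff)
    ultimately show "(\<Sum>x\<in>?X. e x * c (block k x)) \<le> 1 / 32 * (\<Sum>x\<in>?X. (c (block k x))\<^sup>2) + W" by simp
  qed
  have E: "\<bar>e x\<bar> \<le> 1 / p" if "x \<in> ?X" for x
    unfolding e_def by (rule noise_abs_le[OF v p]) (use ab that in \<open>auto simp: bij_betw_def\<close>)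
  have "(\<Sum>x\<in>?X. e x * (embed m n B x - embed m n A x))
    \<le> 1 / 32 * (\<Sum>x\<in>?X. (embed m n B x - embed m n A x)\<^sup>2)
      + real (Suc l) * (24 * (1 / 32) * real n + 2 * W + 1 / p)"
    by (rule bimono_diff_pairing_le[OF ctrl l _ E _ bimono_embed[OF A n] bimono_embed[OF B n]]) (use p in auto)
  also have "(\<Sum>x\<in>?X. (embed m n B x - embed m n A x)\<^sup>2)
      = (\<Sum>i=1..n. \<Sum>j=1..n. (fill_diag m n B i j - fill_diag m n A i j)\<^sup>2)"
    unfolding embed_def by (rule sum_square_reindex[OF bij_betw_Suc bij_betw_column])
  also have "(\<Sum>x\<in>?X. e x * (embed m n B x - embed m n A x))
      = (\<Sum>i=1..n. \<Sum>j=1..n. noise m p \<theta> \<omega> (\<sigma> i) (\<sigma> j) * (fill_diag m n B i j - fill_diag m n A i j))"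
    unfolding embed_def e_def a_def b_def
    by (rule sum_square_reindex[OF bij_betw_Suc bij_betw_column,
          of "\<lambda>i j. noise m p \<theta> \<omega> (\<sigma> i) (\<sigma> j) * (fill_diag m n B i j - fill_diag m n A i j)"])
  \<comment> \<open>The noise vanishes on the diagonal, so filling the diagonals does not change the
    pairing.\<close>
  also have "\<dots> = (\<Sum>i=1..n. \<Sum>j=1..n. noise m p \<theta> \<omega> (\<sigma> i) (\<sigma> j) * (B i j - A i j))"
  proof (intro sum.cong refl)
    fix i j assume "i \<in> {1..n}" "j \<in> {1..n}"
    then show "noise m p \<theta> \<omega> (\<sigma> i) (\<sigma> j) * (fill_diag m n B i j - fill_diag m n A i j)
        = noise m p \<theta> \<omega> (\<sigma> i) (\<sigma> j) * (B i j - A i j)"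
      using noise_diag[OF v, of "\<sigma> i"] permutes_in_image[OF \<sigma>] by (cases "i = j") (auto simp: fill_diag_def)
  qed
  finally show ?thesis
    using fill_diag_dist[OF A B n] unfolding W_def by simp
qed

text \<open>This makes the uniform choice by \<open>pmf_of_set\<close> meaningful, and it also
  provides an ordering of the true weights to compare with.\<close>

lemma sorting_perms_nonempty: "sorting_perms n r \<noteq> {}"
proof -
  define xs where "xs = sort_key r [1..<Suc n]"
  have len: "length xs = n" and set: "set xs = {1..n}" and dist: "distinct xs" and sorted: "sorted (map r xs)"
    unfolding xs_def by auto
  define \<sigma> where "\<sigma> = (\<lambda>k. if k \<in> {1..n} then xs ! (k - 1) else k)"
  have "bij_betw (\<lambda>k. xs ! k) {..<n} {1..n}"
    using bij_betw_nth[OF dist, of "{..<n}" "{1..n}"] len set by auto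
  moreover have "bij_betw (\<lambda>k. k - 1) {1..n} {..<n}"
    by (rule bij_betw_byWitness[where f' = Suc]) auto
  ultimately have "bij_betw (\<lambda>k. xs ! (k - 1)) {1..n} {1..n}"
    using bij_betw_trans by (fastforce simp: comp_def)
  then have "bij_betw \<sigma> {1..n} {1..n}" by (subst bij_betw_cong[where g = "\<lambda>k. xs ! (k - 1)"]) (auto simp: \<sigma>_def)
  then have "\<sigma> permutes {1..n}" by (rule bij_imp_permutes) (auto simp: \<sigma>_def)
  moreover have "mono_on {1..n} (\<lambda>k. r (\<sigma> k))"
  proof (rule mono_onI)
    fix k l assume "k \<in> {1..n}" "l \<in> {1..n}" "k \<le> l"
    then show "r (\<sigma> k) \<le> r (\<sigma> l)"
      using sorted_nth_mono[OF sorted, of "k - 1" "l - 1"] len unfolding \<sigma>_def by auto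
  qed
  ultimately show ?thesis unfolding sorting_perms_def by blast
qed

lemma finite_sorting_perms: "finite (sorting_perms n r)"
  by (rule finite_subset[OF _ finite_permutations[of "{1..n}"]]) (auto simp: sorting_perms_def)

text \<open>Pigeonhole: the last n - k + 1 positions of one ordering and the first k positions of the
  other share an index.\<close>

lemma sorting_perms_close:
  assumes \<sigma>: "\<sigma> \<in> sorting_perms n r" and \<pi>: "\<pi> \<in> sorting_perms n w"
    and gap: "\<And>i j. i \<in> {1..n} \<Longrightarrow> j \<in> {1..n} \<Longrightarrow> w j + \<gamma> < w i \<Longrightarrow> r j < r i"
    and k: "k \<in> {1..n}"
  shows "\<bar>w (\<sigma> k) - w (\<pi> k)\<bar> \<le> \<gamma>"
proof -
  have perm: "\<sigma> permutes {1..n}" "\<pi> permutes {1..n}"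
    and mono: "mono_on {1..n} (\<lambda>k. r (\<sigma> k))" "mono_on {1..n} (\<lambda>k. w (\<pi> k))"
    using \<sigma> \<pi> unfolding sorting_perms_def by auto
  have common: "\<exists>a\<in>S. \<exists>b\<in>T. \<sigma> a = \<pi> b" if S: "S \<subseteq> {1..n}" and T: "T \<subseteq> {1..n}" and c: "n < card S + card T" for S T
  proof (rule ccontr)
    assume "\<not> ?thesis"
    then have disj: "\<sigma> ` S \<inter> \<pi> ` T = {}" by auto
    have fin: "finite S" "finite T" using S T finite_subset by auto
    have "\<sigma> ` S \<union> \<pi> ` T \<subseteq> {1..n}"
      using S T permutes_in_image[OF perm(1)] permutes_in_image[OF perm(2)] by blast
    then have "card (\<sigma> ` S \<union> \<pi> ` T) \<le> n" using card_mono[of "{1..n}"] by fastforce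
    moreover have "card (\<sigma> ` S \<union> \<pi> ` T) = card S + card T"
      using card_Un_disjoint[OF _ _ disj] fin
        card_image[OF inj_on_subset[OF permutes_inj[OF perm(1)] subset_UNIV]]
        card_image[OF inj_on_subset[OF permutes_inj[OF perm(2)] subset_UNIV]] by simp
    ultimately show False using c by simp
  qed
  have \<sigma>in: "\<sigma> l \<in> {1..n}" if "l \<in> {1..n}" for l using permutes_in_image[OF perm(1)] that by simp
  have "\<not> w (\<pi> k) + \<gamma> < w (\<sigma> k)"
  proof
    assume gt: "w (\<pi> k) + \<gamma> < w (\<sigma> k)"
    obtain l j where lj: "l \<in> {k..n}" "j \<in> {1..k}" "\<sigma> l = \<pi> j"
      using common[of "{k..n}" "{1..k}"] k by auto
    have "w (\<sigma> l) \<le> w (\<pi> k)" unfolding lj(3) using lj k by (intro mono_onD[OF mono(2)]) auto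
    then have "r (\<sigma> l) < r (\<sigma> k)" using gt lj k by (intro gap \<sigma>in) auto
    moreover have "r (\<sigma> k) \<le> r (\<sigma> l)" using lj k by (intro mono_onD[OF mono(1)]) auto
    ultimately show False by simp
  qed
  moreover have "\<not> w (\<sigma> k) + \<gamma> < w (\<pi> k)"
  proof
    assume gt: "w (\<sigma> k) + \<gamma> < w (\<pi> k)"
    obtain l j where lj: "l \<in> {1..k}" "j \<in> {k..n}" "\<sigma> l = \<pi> j"
      using common[of "{1..k}" "{k..n}"] k by auto
    have "w (\<pi> k) \<le> w (\<sigma> l)" unfolding lj(3) using lj k by (intro mono_onD[OF mono(2)]) auto
    then have "r (\<sigma> k) < r (\<sigma> l)" using gt lj k by (intro gap \<sigma>in) auto
    moreover have "r (\<sigma> l) \<le> r (\<sigma> k)" using lj k by (intro mono_onD[OF mono(1)]) auto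
    ultimately show False by simp
  qed
  ultimately show ?thesis by linarith
qed

section \<open>Increments of the link function\<close>

text \<open>The increment is the integral of \<open>f\<close> over \<open>{x<..y}\<close>, an
  interval inside the range where the density bounds hold.\<close>

lemma cdf_increment_bounds:
  assumes F: "cdf_with_cont_pos_density F f" and xy: "x \<le> y" "x \<in> {- K..K}" "y \<in> {- K..K}"
    and b: "\<And>z. \<bar>z\<bar> \<le> K \<Longrightarrow> a \<le> f z" "\<And>z. \<bar>z\<bar> \<le> K \<Longrightarrow> f z \<le> b" "a \<ge> 0"
  shows "a * (y - x) \<le> F y - F x" "F y - F x \<le> b * (y - x)"
proof -
  obtain \<mu> where \<mu>: "real_distribution \<mu>" "F = cdf \<mu>" "\<mu> = density lborel (\<lambda>x. ennreal (f x))"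
    and f: "continuous_on UNIV f"
    using F unfolding cdf_with_cont_pos_density_def by blast
  interpret real_distribution \<mu> by (rule \<mu>(1))
  have [measurable]: "f \<in> borel_measurable borel" using f by (rule borel_measurable_continuous_onI)
  have b0: "b \<ge> 0" using b(1)[of x] b(2)[of x] b(3) xy(2) by (auto simp: abs_le_iff)
  have Fd: "F y - F x = measure \<mu> {x<..y}"
    using xy(1) unfolding \<mu>(2) by (cases "x = y") (auto intro: cdf_diff_eq)
  have em: "emeasure \<mu> {x<..y} = (\<integral>\<^sup>+ z. ennreal (f z) * indicator {x<..y} z \<partial>lborel)"
    unfolding \<mu>(3) by (rule emeasure_density) auto
  have const: "(\<integral>\<^sup>+ z. ennreal c * indicator {x<..y} z \<partial>lborel) = ennreal (c * (y - x))" if "c \<ge> 0" for c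
    using xy(1) that by (simp add: nn_integral_cmult_indicator ennreal_mult)
  have in_range: "\<bar>z\<bar> \<le> K" if "z \<in> {x<..y}" for z using that xy by auto
  have "ennreal (a * (y - x)) \<le> emeasure \<mu> {x<..y}"
    unfolding em const[OF b(3), symmetric]
    by (intro nn_integral_mono) (auto simp: indicator_def intro!: ennreal_leI b(1) in_range)
  then show "a * (y - x) \<le> F y - F x"
    unfolding Fd emeasure_eq_measure using measure_nonneg by (simp add: ennreal_le_iff)
  have "emeasure \<mu> {x<..y} \<le> ennreal (b * (y - x))"
    unfolding em const[OF b0, symmetric]
    by (intro nn_integral_mono) (auto simp: indicator_def intro!: ennreal_leI b(2) in_range)
  then show "F y - F x \<le> b * (y - x)"
    unfolding Fd emeasure_eq_measure using b0 xy(1) by (simp add: ennreal_le_iff)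
qed

lemma cdf_01:
  assumes "cdf_with_cont_pos_density F f" shows "0 \<le> F x" "F x \<le> 1"
proof -
  obtain \<mu> where \<mu>: "real_distribution \<mu>" "F = cdf \<mu>"
    using assms unfolding cdf_with_cont_pos_density_def by blast
  interpret real_distribution \<mu> by (rule \<mu>(1))
  show "0 \<le> F x" "F x \<le> 1" unfolding \<mu>(2) by (simp_all add: cdf_nonneg cdf_bounded_prob)
qed

text \<open>The infimum is positive because the continuous positive \<open>f\<close> attains its
  minimum on the compact interval.\<close>

lemma density_extrema:
  assumes F: "cdf_with_cont_pos_density F f" and M: "M > 0"
    and L: "L = (SUP x\<in>{x. \<bar>x\<bar> \<le> 2 * M}. f x)" and L': "L' = (INF x\<in>{x. \<bar>x\<bar> \<le> 2 * M}. f x)"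
  shows "0 < L'" "\<And>z. \<bar>z\<bar> \<le> 2 * M \<Longrightarrow> L' \<le> f z" "\<And>z. \<bar>z\<bar> \<le> 2 * M \<Longrightarrow> f z \<le> L"
proof -
  have f: "continuous_on UNIV f" "\<And>x. f x > 0"
    using F unfolding cdf_with_cont_pos_density_def by auto
  have I: "{x. \<bar>x\<bar> \<le> 2 * M} = {- (2 * M)..2 * M}" by auto
  have cf: "continuous_on {- (2 * M)..2 * M} f" using f(1) by (rule continuous_on_subset) simp
  have ne: "{- (2 * M)..2 * M} \<noteq> {}" using M by simp
  have bdd: "bdd_above (f ` {- (2 * M)..2 * M})" "bdd_below (f ` {- (2 * M)..2 * M})"
    using compact_imp_bounded[OF compact_continuous_image[OF cf compact_Icc]]
    by (simp_all add: bounded_imp_bdd_above bounded_imp_bdd_below)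
  obtain x0 where x0: "\<forall>y\<in>{- (2 * M)..2 * M}. f x0 \<le> f y"
    using continuous_attains_inf[OF compact_Icc ne cf] by blast
  have "f x0 \<le> L'" unfolding L' I using x0 ne by (intro cINF_greatest) auto
  then show "0 < L'" using f(2)[of x0] by simp
  show "L' \<le> f z" if "\<bar>z\<bar> \<le> 2 * M" for z
    unfolding L' I by (rule cINF_lower[OF bdd(2)]) (use that in auto)
  show "f z \<le> L" if "\<bar>z\<bar> \<le> 2 * M" for z
    unfolding L I by (rule cSUP_upper[OF _ bdd(1)]) (use that in auto)
qed

section \<open>Error of the projection\<close>

lemma J_perm: "\<sigma> permutes S \<Longrightarrow> J (\<sigma> i) (\<sigma> j) = J i j"
  unfolding J_def by (auto dest: permutes_inj injD)

lemma sum_square_permutes: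
  assumes "\<sigma> permutes {1..n}"
  shows "(\<Sum>i=1..n. \<Sum>j=1..n. f (\<sigma> i) (\<sigma> j)) = (\<Sum>i=1..n. \<Sum>j=1..n. f i j :: real)"
proof -
  note b = permutes_imp_bij[OF assms]
  have "(\<Sum>i=1..n. \<Sum>j=1..n. f (\<sigma> i) (\<sigma> j)) = (\<Sum>i=1..n. \<Sum>j=1..n. f (\<sigma> i) j)"
    by (intro sum.cong refl sum.reindex_bij_betw[OF b])
  also have "\<dots> = (\<Sum>i=1..n. \<Sum>j=1..n. f i j)" by (rule sum.reindex_bij_betw[OF b])
  finally show ?thesis .
qed

lemma y_mat_noise: "p \<noteq> 0 \<Longrightarrow> y_mat m \<omega> i j = p * (noise m p \<theta> \<omega> i j + (\<theta> i j - J i j / 2)) + J i j / 2"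
  unfolding noise_def by simp

text \<open>As A itself competes in the minimization, the squared error is at most twice the pairing of
  the error with Z - A.\<close>

lemma projection_error:
  assumes K: "compact K" and A: "A \<in> K"
    and Z: "\<And>i j. i \<in> {1..n} \<Longrightarrow> j \<in> {1..n} \<Longrightarrow> Z i j - A i j = U i j + V i j + c * E i j"
    and c: "0 \<le> c" "c \<le> 2" and R: "R \<ge> 0"
    and pair: "\<And>B. B \<in> K \<Longrightarrow> (\<Sum>i=1..n. \<Sum>j=1..n. E i j * (B i j - A i j))
        \<le> (\<Sum>i=1..n. \<Sum>j=1..n. (B i j - A i j)\<^sup>2) / 16 + R"
  shows "(\<Sum>i=1..n. \<Sum>j=1..n. (frob_proj n K Z i j - A i j)\<^sup>2)
    \<le> 16 * (\<Sum>i=1..n. \<Sum>j=1..n. (U i j)\<^sup>2) + 16 * (\<Sum>i=1..n. \<Sum>j=1..n. (V i j)\<^sup>2) + 8 * R"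
proof -
  define S where "S = (\<lambda>f :: nat \<Rightarrow> nat \<Rightarrow> real. \<Sum>i=1..n. \<Sum>j=1..n. f i j)"
  define B where "B = frob_proj n K Z"
  have BK: "B \<in> K" and min: "S (\<lambda>i j. (Z i j - B i j)\<^sup>2) \<le> S (\<lambda>i j. (Z i j - A i j)\<^sup>2)"
    using frob_proj_minimizes[OF K, where n = n and Z = Z] A unfolding B_def S_def by blast+
  define T where "T = S (\<lambda>i j. (B i j - A i j)\<^sup>2)"
  have add: "S (\<lambda>i j. f i j + g i j) = S f + S g" and scale: "S (\<lambda>i j. r * f i j) = r * S f"
    and diff: "S (\<lambda>i j. f i j - g i j) = S f - S g" for f g r
    unfolding S_def by (simp_all add: sum.distrib sum_distrib_left sum_subtractf)
  have mono: "S f \<le> S g" if "\<And>i j. i \<in> {1..n} \<Longrightarrow> j \<in> {1..n} \<Longrightarrow> f i j \<le> g i j" for f g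
    unfolding S_def using that by (intro sum_mono) auto
  \<comment> \<open>Expand the square of Z - B = (Z - A) - (B - A). Minimality of \<open>B\<close>
    makes the difference of the first two sums nonpositive.\<close>
  have "T = S (\<lambda>i j. (Z i j - B i j)\<^sup>2 - (Z i j - A i j)\<^sup>2 + 2 * ((Z i j - A i j) * (B i j - A i j)))"
    unfolding T_def by (rule arg_cong[where f = S]) (auto simp: fun_eq_iff power2_eq_square algebra_simps)
  also have "\<dots> \<le> 2 * S (\<lambda>i j. (Z i j - A i j) * (B i j - A i j))"
    unfolding add diff scale using min by simp
  also have "S (\<lambda>i j. (Z i j - A i j) * (B i j - A i j))
      \<le> S (\<lambda>i j. 4 * (U i j)\<^sup>2 + 4 * (V i j)\<^sup>2 + (1 / 8) * (B i j - A i j)\<^sup>2 + c * (E i j * (B i j - A i j)))"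
  proof (rule mono)
    have amgm: "u * h \<le> 4 * u\<^sup>2 + (1 / 16) * h\<^sup>2" for u h :: real
      using zero_le_power2[of "2 * u - h / 4"] by (simp add: power2_eq_square algebra_simps)
    fix i j assume "i \<in> {1..n}" "j \<in> {1..n}"
    note zij = Z[OF this]
    show "(Z i j - A i j) * (B i j - A i j)
      \<le> 4 * (U i j)\<^sup>2 + 4 * (V i j)\<^sup>2 + (1 / 8) * (B i j - A i j)\<^sup>2 + c * (E i j * (B i j - A i j))"
      using amgm[of "U i j" "B i j - A i j"] amgm[of "V i j" "B i j - A i j"]
      unfolding zij by (simp add: distrib_right mult.assoc)
  qed
  also have "\<dots> = 4 * S (\<lambda>i j. (U i j)\<^sup>2) + 4 * S (\<lambda>i j. (V i j)\<^sup>2) + (1 / 8) * T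
      + c * S (\<lambda>i j. E i j * (B i j - A i j))"
    unfolding add scale T_def ..
  also have "c * S (\<lambda>i j. E i j * (B i j - A i j)) \<le> 2 * (T / 16 + R)"
  proof -
    have T0: "T \<ge> 0" unfolding T_def S_def by (intro sum_nonneg) auto
    have "c * S (\<lambda>i j. E i j * (B i j - A i j)) \<le> c * (T / 16 + R)"
      using pair[OF BK] c(1) unfolding T_def S_def by (rule mult_left_mono)
    also have "\<dots> \<le> 2 * (T / 16 + R)" using c(2) T0 R by (intro mult_right_mono) auto
    finally show ?thesis .
  qed
  \<comment> \<open>The terms in \<open>T\<close> on the right add up to 2 (1/8 + 2/16) = 1/2 of
    \<open>T\<close>, so half of it remains on the left.\<close>
  finally have "T \<le> 16 * S (\<lambda>i j. (U i j)\<^sup>2) + 16 * S (\<lambda>i j. (V i j)\<^sup>2) + 8 * R" by simp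
  then show ?thesis unfolding T_def S_def B_def .
qed

text \<open>Both models at once: \<^const>\<open>reflect_sign\<close> is the sign of the second weight.\<close>

definition weight_model :: "model \<Rightarrow> nat \<Rightarrow> (real \<Rightarrow> real) \<Rightarrow> real \<Rightarrow> (nat \<Rightarrow> real) \<Rightarrow> (nat \<Rightarrow> nat \<Rightarrow> real) \<Rightarrow> bool" where
  "weight_model m n F M w \<theta> \<longleftrightarrow> (\<forall>i\<in>{1..n}. \<bar>w i\<bar> \<le> M) \<and> (\<forall>i\<in>{1..n}. \<theta> i i = 0) \<and>
     (\<forall>i\<in>{1..n}. \<forall>j\<in>{1..n}. i \<noteq> j \<longrightarrow> \<theta> i j = F (w i + reflect_sign m * w j)) \<and>
     (\<forall>x. F x \<in> {0..1}) \<and> (m = Tournament \<longrightarrow> (\<forall>x. F x + F (- x) = 1))"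

lemma weight_modelD:
  assumes "weight_model m n F M w \<theta>"
  shows "i \<in> {1..n} \<Longrightarrow> \<bar>w i\<bar> \<le> M" "i \<in> {1..n} \<Longrightarrow> \<theta> i i = 0"
    "i \<in> {1..n} \<Longrightarrow> j \<in> {1..n} \<Longrightarrow> i \<noteq> j \<Longrightarrow> \<theta> i j = F (w i + reflect_sign m * w j)"
    "0 \<le> F x" "F x \<le> 1" "m = Tournament \<Longrightarrow> F (- x) = 1 - F x"
  using assms unfolding weight_model_def by (auto simp: eq_diff_eq add.commute)

lemma weight_model_valid:
  assumes "weight_model m n F M w \<theta>" shows "valid_param m n \<theta>"
proof -
  have "\<theta> j i = reflect m (\<theta> i j)" if "i \<in> {1..n}" "j \<in> {1..n}" "i \<noteq> j" for i j
    using that weight_modelD(3)[OF assms, of i j] weight_modelD(3)[OF assms, of j i]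
      weight_modelD(6)[OF assms, of "w i - w j"]
    by (cases m) (auto simp: reflect_sign_def add.commute)
  moreover have "\<theta> i j \<in> {0..1}" if "i \<in> {1..n}" "j \<in> {1..n}" for i j
    using that weight_modelD(2-5)[OF assms] by (cases "i = j") auto
  ultimately show ?thesis unfolding valid_param_def using weight_modelD(2)[OF assms] by blast
qed

text \<open>This is the competitor in the minimization: ordered by the true weights, the parameter
  inherits the monotonicity of \<open>F\<close>. In the tournament model the bound 1/2 comes from F
  0 = 1/2.\<close>

lemma sorted_param_in_model_set:
  assumes wm: "weight_model m n F M w \<theta>" and mono: "mono F" and \<pi>: "\<pi> \<in> sorting_perms n w"
  shows "(\<lambda>i\<in>{1..n}. \<lambda>j\<in>{1..n}. \<theta> (\<pi> i) (\<pi> j)) \<in> model_set m n"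
proof -
  define A where "A = (\<lambda>i\<in>{1..n}. \<lambda>j\<in>{1..n}. \<theta> (\<pi> i) (\<pi> j))"
  have perm: "\<pi> permutes {1..n}" and wmono: "mono_on {1..n} (\<lambda>k. w (\<pi> k))"
    using \<pi> unfolding sorting_perms_def by auto
  have \<pi>in: "\<pi> i \<in> {1..n}" if "i \<in> {1..n}" for i using permutes_in_image[OF perm] that by simp
  have \<pi>ne: "\<pi> i \<noteq> \<pi> j" if "i \<noteq> j" for i j using permutes_inj[OF perm] that by (auto dest: injD)
  have v: "valid_param m n \<theta>" by (rule weight_model_valid[OF wm])
  have Aij: "A i j = \<theta> (\<pi> i) (\<pi> j)" if "i \<in> {1..n}" "j \<in> {1..n}" for i j
    using that unfolding A_def by simp
  have AF: "A i j = F (w (\<pi> i) + reflect_sign m * w (\<pi> j))" if "i \<in> {1..n}" "j \<in> {1..n}" "i \<noteq> j" for i j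
    unfolding Aij[OF that(1,2)]
    by (rule weight_modelD(3)[OF wm \<pi>in[OF that(1)] \<pi>in[OF that(2)] \<pi>ne[OF that(3)]])
  have mat: "A \<in> matrices n {0..1}"
    unfolding matrices_def A_def using valid_paramD(1,2)[OF v \<pi>in \<pi>in] by auto
  have diag: "A i i = 0" if "i \<in> {1..n}" for i
    unfolding Aij[OF that that] by (rule valid_paramD(4)[OF v \<pi>in[OF that] \<pi>in[OF that]])
  have refl: "A j i = reflect m (A i j)" if "i \<in> {1..n}" "j \<in> {1..n}" "i \<noteq> j" for i j
    unfolding Aij[OF that(1,2)] Aij[OF that(2,1)]
    by (rule valid_paramD(3)[OF v \<pi>in[OF that(1)] \<pi>in[OF that(2)] \<pi>ne[OF that(3)]])
  have wle: "w (\<pi> i) \<le> w (\<pi> j)" if "i \<in> {1..n}" "j \<in> {1..n}" "i \<le> j" for i j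
    using mono_onD[OF wmono that(1,2,3)] .
  have tmono: "A i j \<le> A i k" if "m = Tournament" "i \<in> {1..n}" "j \<in> {1..n}" "k \<in> {1..n}" "i \<noteq> k" "i \<noteq> j" "k < j" for i j k
    using that wle[of k j] by (auto simp: AF reflect_sign_def intro!: monoD[OF mono])
  have gmono: "A i j \<le> A i k" if "m = Graph" "i \<in> {1..n}" "j \<in> {1..n}" "k \<in> {1..n}" "i \<noteq> k" "i \<noteq> j" "j < k" for i j k
    using that wle[of j k] by (auto simp: AF reflect_sign_def intro!: monoD[OF mono])
  have half: "A i j \<le> 1 / 2" if "m = Tournament" "i \<in> {1..n}" "j \<in> {1..n}" "i < j" for i j
  proof -
    have "F 0 = 1 / 2" using weight_modelD(6)[OF wm that(1), of 0] by simp
    moreover have "A i j \<le> F 0"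
      using that wle[of i j] by (auto simp: AF reflect_sign_def intro!: monoD[OF mono])
    ultimately show ?thesis by simp
  qed
  show ?thesis unfolding A_def[symmetric]
  proof (cases m)
    case Tournament
    have "A j i = 1 - A i j" if "i \<in> {1..n}" "j \<in> {1..n}" "i \<noteq> j" for i j
      using refl[OF that] unfolding Tournament reflect.simps .
    then show "A \<in> model_set m n"
      unfolding Tournament model_set.simps tournament_set_def mem_Collect_eq
      using mat diag tmono[OF Tournament] half[OF Tournament] by blast
  next
    case Graph
    have "A j i = A i j" if "i \<in> {1..n}" "j \<in> {1..n}" "i \<noteq> j" for i j
      using refl[OF that] unfolding Graph reflect.simps .
    then show "A \<in> model_set m n"
      unfolding Graph model_set.simps graph_set_def mem_Collect_eq
      using mat diag gmono[OF Graph] by blast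
  qed
qed

text \<open>Each column other than \<open>i\<close> and \<open>j\<close> contributes at least a (w i
  - w j), which gives the factor n - 2. Of the remaining entries the diagonal ones are 0, and
  \<open>\<theta> j i \<le> \<theta> i j\<close>.\<close>

lemma row_mean_gap:
  assumes wm: "weight_model m n F M w \<theta>" and a: "a \<ge> 0"
    and lip: "\<And>x y. x \<le> y \<Longrightarrow> \<bar>x\<bar> \<le> 2 * M \<Longrightarrow> \<bar>y\<bar> \<le> 2 * M \<Longrightarrow> a * (y - x) \<le> F y - F x"
    and ij: "i \<in> {1..n}" "j \<in> {1..n}" and le: "w j \<le> w i" and n: "n \<ge> 2"
  shows "(real n - 2) * a * (w i - w j) \<le> (\<Sum>k=1..n. \<theta> i k) - (\<Sum>k=1..n. \<theta> j k)"
proof (cases "i = j")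
  case False
  define s where "s = reflect_sign m"
  have s: "\<bar>s\<bar> = 1" unfolding s_def by (cases m) (auto simp: reflect_sign_def)
  have arg: "\<bar>w x + s * w y\<bar> \<le> 2 * M" if "x \<in> {1..n}" "y \<in> {1..n}" for x y
    using weight_modelD(1)[OF wm that(1)] weight_modelD(1)[OF wm that(2)] s
      abs_triangle_ineq[of "w x" "s * w y"] by (simp add: abs_mult)
  have split: "(\<Sum>k=1..n. f k) = f i + f j + (\<Sum>k\<in>{1..n} - {i, j}. f k)" for f :: "nat \<Rightarrow> real"
  proof -
    have "(\<Sum>k=1..n. f k) = (\<Sum>k\<in>{i, j}. f k) + (\<Sum>k\<in>{1..n} - {i, j}. f k)"
      using ij by (subst sum.subset_diff[of "{i, j}"]) auto
    then show ?thesis using False by simp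
  qed
  have card: "real (card ({1..n} - {i, j})) = real n - 2"
    using ij False n by (simp add: card_Diff_subset of_nat_diff)
  have "(real n - 2) * a * (w i - w j) = (\<Sum>k\<in>{1..n} - {i, j}. a * (w i - w j))"
    by (simp only: sum_constant card mult.assoc)
  also have "\<dots> \<le> (\<Sum>k\<in>{1..n} - {i, j}. \<theta> i k - \<theta> j k)"
  proof (rule sum_mono)
    fix k assume k: "k \<in> {1..n} - {i, j}"
    have "a * ((w i + s * w k) - (w j + s * w k)) \<le> F (w i + s * w k) - F (w j + s * w k)"
      by (rule lip) (use le arg ij k in auto)
    then show "a * (w i - w j) \<le> \<theta> i k - \<theta> j k"
      using weight_modelD(3)[OF wm, of i k] weight_modelD(3)[OF wm, of j k] ij k unfolding s_def by simp
  qed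
  also have "\<dots> \<le> (\<theta> i j - \<theta> j i) + (\<Sum>k\<in>{1..n} - {i, j}. \<theta> i k - \<theta> j k)"
  proof -
    have "\<theta> j i \<le> \<theta> i j"
    proof (cases m)
      case Graph
      then show ?thesis
        using weight_modelD(3)[OF wm, of i j] weight_modelD(3)[OF wm, of j i] ij False
        by (simp add: reflect_sign_def add.commute)
    next
      case Tournament
      have le': "w j + s * w i \<le> w i + s * w j"
        using le Tournament by (simp add: s_def reflect_sign_def)
      have "a * ((w i + s * w j) - (w j + s * w i)) \<le> F (w i + s * w j) - F (w j + s * w i)"
        by (rule lip[OF le' arg[OF ij(2,1)] arg[OF ij]])
      moreover have "0 \<le> a * ((w i + s * w j) - (w j + s * w i))" using a le' by simp
      ultimately show ?thesis
        using weight_modelD(3)[OF wm, of i j] weight_modelD(3)[OF wm, of j i] ij False unfolding s_def by simp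
    qed
    then show ?thesis by simp
  qed
  also have "\<dots> = (\<Sum>k=1..n. \<theta> i k) - (\<Sum>k=1..n. \<theta> j k)"
    unfolding split[of "\<theta> i"] split[of "\<theta> j"]
    using weight_modelD(2)[OF wm ij(1)] weight_modelD(2)[OF wm ij(2)] by (simp add: sum_subtractf)
  finally show ?thesis .
qed simp

section \<open>The risk bound\<close>

text \<open>Up to the factor \<open>p\<close> and a constant common to all rows, an observed row sum
  is the true row sum plus noise; this is all that matters for sorting.\<close>

lemma row_sum_noise:
  assumes "p \<noteq> 0" "i \<in> {1..n}"
  shows "row_sum n (y_mat m \<omega>) i
    = p * ((\<Sum>j=1..n. noise m p \<theta> \<omega> i j) + (\<Sum>j=1..n. \<theta> i j)) + (1 - p) * ((real n - 1) / 2)"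
proof -
  have J: "(\<Sum>j=1..n. J i j) = real n - 1"
  proof -
    have "(\<Sum>j=1..n. J i j) = (\<Sum>j=1..n. 1 - (if j = i then 1 else 0))"
      by (intro sum.cong) (auto simp: J_def)
    then show ?thesis using assms(2) by (simp add: sum_subtractf)
  qed
  have "row_sum n (y_mat m \<omega>) i = (\<Sum>j=1..n. p * (noise m p \<theta> \<omega> i j + \<theta> i j) + (1 - p) / 2 * J i j)"
    unfolding row_sum_def
    by (intro sum.cong refl) (subst y_mat_noise[OF assms(1), where \<theta> = \<theta>], simp add: field_simps)
  also have "\<dots> = p * ((\<Sum>j=1..n. noise m p \<theta> \<omega> i j) + (\<Sum>j=1..n. \<theta> i j)) + (1 - p) / 2 * (\<Sum>j=1..n. J i j)"
    by (simp only: sum.distrib sum_distrib_left distrib_left)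
  finally show ?thesis unfolding J by simp
qed

text \<open>If two weights differ by more than \<gamma>, the true row sums differ by more than 2
  \<Delta>, and noise of at most \<Delta> in each row cannot reverse their order. By
  \<open>sorting_perms_close\<close> the weights at equal positions then differ by at most \<gamma>,
  so the arguments of \<open>F\<close> differ by at most 2 \<gamma> and the entries by at most 2 b
  \<gamma>.\<close>

lemma sorting_error:
  assumes wm: "weight_model m n F M w \<theta>" and a: "a > 0"
    and lip: "\<And>x y. x \<le> y \<Longrightarrow> \<bar>x\<bar> \<le> 2 * M \<Longrightarrow> \<bar>y\<bar> \<le> 2 * M \<Longrightarrow> a * (y - x) \<le> F y - F x"
      "\<And>x y. x \<le> y \<Longrightarrow> \<bar>x\<bar> \<le> 2 * M \<Longrightarrow> \<bar>y\<bar> \<le> 2 * M \<Longrightarrow> F y - F x \<le> b * (y - x)"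
    and n: "n \<ge> 32" and p: "p > 0" and b: "b \<ge> 0" and \<Delta>: "\<Delta> \<ge> 0"
    and rows: "\<And>i. i \<in> {1..n} \<Longrightarrow> \<bar>\<Sum>j=1..n. noise m p \<theta> \<omega> i j\<bar> \<le> \<Delta>"
    and \<sigma>: "\<sigma> \<in> sorting_perms n (row_sum n (y_mat m \<omega>))" and \<pi>: "\<pi> \<in> sorting_perms n w"
  shows "(\<Sum>i=1..n. \<Sum>j=1..n. (\<theta> (\<sigma> i) (\<sigma> j) - \<theta> (\<pi> i) (\<pi> j))\<^sup>2) \<le> 32 * (b / a)\<^sup>2 * \<Delta>\<^sup>2"
proof -
  define \<gamma> where "\<gamma> = 2 * \<Delta> / ((real n - 2) * a)"
  have n2: "real n - 2 > 0" using n by simp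
  have \<gamma>0: "\<gamma> \<ge> 0" unfolding \<gamma>_def using \<Delta> n2 a by simp
  have perm: "\<sigma> permutes {1..n}" "\<pi> permutes {1..n}" using \<sigma> \<pi> unfolding sorting_perms_def by auto
  have in_n: "\<sigma> i \<in> {1..n}" "\<pi> i \<in> {1..n}" if "i \<in> {1..n}" for i
    using permutes_in_image[OF perm(1)] permutes_in_image[OF perm(2)] that by simp_all
  have ne: "\<sigma> i \<noteq> \<sigma> j" "\<pi> i \<noteq> \<pi> j" if "i \<noteq> j" for i j
    using permutes_inj[OF perm(1)] permutes_inj[OF perm(2)] that by (auto dest: injD)
  have close: "\<bar>w (\<sigma> k) - w (\<pi> k)\<bar> \<le> \<gamma>" if k: "k \<in> {1..n}" for k
  proof (rule sorting_perms_close[OF \<sigma> \<pi> _ k])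
    fix i j assume ij: "i \<in> {1..n}" "j \<in> {1..n}" and gt: "w j + \<gamma> < w i"
    have "2 * \<Delta> = (real n - 2) * a * \<gamma>" unfolding \<gamma>_def using n2 a by simp
    also have "\<dots> < (real n - 2) * a * (w i - w j)" using gt n2 a by (intro mult_strict_left_mono) auto
    also have "\<dots> \<le> (\<Sum>k=1..n. \<theta> i k) - (\<Sum>k=1..n. \<theta> j k)"
      by (rule row_mean_gap[OF wm _ lip(1) ij]) (use a gt \<gamma>0 n in auto)
    finally have "(\<Sum>k=1..n. noise m p \<theta> \<omega> j k) + (\<Sum>k=1..n. \<theta> j k)
        < (\<Sum>k=1..n. noise m p \<theta> \<omega> i k) + (\<Sum>k=1..n. \<theta> i k)"
      using rows[OF ij(1)] rows[OF ij(2)] unfolding abs_le_iff by linarith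
    then show "row_sum n (y_mat m \<omega>) j < row_sum n (y_mat m \<omega>) i"
      unfolding row_sum_noise[OF less_imp_neq[OF p, symmetric] ij(1), where \<theta> = \<theta>]
        row_sum_noise[OF less_imp_neq[OF p, symmetric] ij(2), where \<theta> = \<theta>]
      using p by simp
  qed
  have entry: "(\<theta> (\<sigma> i) (\<sigma> j) - \<theta> (\<pi> i) (\<pi> j))\<^sup>2 \<le> (2 * b * \<gamma>)\<^sup>2" if ij: "i \<in> {1..n}" "j \<in> {1..n}" for i j
  proof (cases "i = j")
    case True
    then show ?thesis using weight_modelD(2)[OF wm in_n(1)[OF ij(1)]] weight_modelD(2)[OF wm in_n(2)[OF ij(1)]] by simp
  next
    case False
    define s where "s = reflect_sign m"
    have s: "\<bar>s\<bar> = 1" unfolding s_def by (cases m) (auto simp: reflect_sign_def)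
    define x where "x = w (\<sigma> i) + s * w (\<sigma> j)"
    define y where "y = w (\<pi> i) + s * w (\<pi> j)"
    have arg: "\<bar>w k + s * w l\<bar> \<le> 2 * M" if "k \<in> {1..n}" "l \<in> {1..n}" for k l
      using weight_modelD(1)[OF wm that(1)] weight_modelD(1)[OF wm that(2)] s
        abs_triangle_ineq[of "w k" "s * w l"] by (simp add: abs_mult)
    have bd: "\<bar>x\<bar> \<le> 2 * M" "\<bar>y\<bar> \<le> 2 * M" unfolding x_def y_def using arg in_n ij by auto
    have "x - y = (w (\<sigma> i) - w (\<pi> i)) + s * (w (\<sigma> j) - w (\<pi> j))" unfolding x_def y_def by (simp add: algebra_simps)
    then have "\<bar>x - y\<bar> \<le> \<bar>w (\<sigma> i) - w (\<pi> i)\<bar> + \<bar>w (\<sigma> j) - w (\<pi> j)\<bar>"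
      using abs_triangle_ineq[of "w (\<sigma> i) - w (\<pi> i)" "s * (w (\<sigma> j) - w (\<pi> j))"] s by (simp add: abs_mult)
    then have xy: "\<bar>x - y\<bar> \<le> 2 * \<gamma>" using close[OF ij(1)] close[OF ij(2)] by simp
    have "\<bar>F x - F y\<bar> \<le> b * \<bar>x - y\<bar>"
    proof (cases "x \<le> y")
      case True
      then show ?thesis using lip(2)[OF True bd] lip(1)[OF True bd] a by (smt (verit) mult_nonneg_nonneg)
    next
      case False
      then have "y \<le> x" by simp
      then show ?thesis using lip(2)[OF _ bd(2,1)] lip(1)[OF _ bd(2,1)] a by (smt (verit) mult_nonneg_nonneg)
    qed
    also have "\<dots> \<le> b * (2 * \<gamma>)" by (rule mult_left_mono[OF xy b])
    finally have "\<bar>F x - F y\<bar> \<le> \<bar>2 * b * \<gamma>\<bar>" using b \<gamma>0 by (simp add: mult_ac)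
    then have "(F x - F y)\<^sup>2 \<le> (2 * b * \<gamma>)\<^sup>2" by (simp only: abs_le_square_iff)
    moreover have "\<theta> (\<sigma> i) (\<sigma> j) = F x" "\<theta> (\<pi> i) (\<pi> j) = F y"
      unfolding x_def y_def s_def using False in_n ne ij by (auto intro!: weight_modelD(3)[OF wm])
    ultimately show ?thesis by simp
  qed
  have "(\<Sum>i=1..n. \<Sum>j=1..n. (\<theta> (\<sigma> i) (\<sigma> j) - \<theta> (\<pi> i) (\<pi> j))\<^sup>2) \<le> (\<Sum>i=1..n. \<Sum>j=1..n. (2 * b * \<gamma>)\<^sup>2)"
    using entry by (intro sum_mono) auto
  also have "\<dots> = 16 * (b / a)\<^sup>2 * \<Delta>\<^sup>2 * (real n / (real n - 2))\<^sup>2"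
    unfolding \<gamma>_def by (simp add: power2_eq_square mult_ac)
  also have "(real n / (real n - 2))\<^sup>2 \<le> 2"
  proof -
    have "real n / (real n - 2) \<le> 32 / 30" using n n2 by (simp add: field_simps)
    then have "(real n / (real n - 2))\<^sup>2 \<le> (32 / 30)\<^sup>2" using n2 by (intro power_mono) auto
    also have "\<dots> \<le> 2" by (simp add: power2_eq_square)
    finally show ?thesis .
  qed
  finally show ?thesis by (simp add: mult_left_mono)
qed

lemma ln_ge_3: "n \<ge> 32 \<Longrightarrow> 3 \<le> ln (real n)"
proof -
  assume "n \<ge> 32"
  then have "ln (2 ^ 5 :: real) \<le> ln (real n)" by (subst ln_le_cancel_iff) auto
  moreover have "ln (2 ^ 5 :: real) = 5 * ln 2" by (subst ln_realpow) auto
  ultimately show ?thesis using ln2_ge_two_thirds by simp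
qed

lemma loss_good:
  assumes wm: "weight_model m n F M w \<theta>" and mono: "mono F" and a: "a > 0" and b: "b \<ge> 0"
    and lip: "\<And>x y. x \<le> y \<Longrightarrow> \<bar>x\<bar> \<le> 2 * M \<Longrightarrow> \<bar>y\<bar> \<le> 2 * M \<Longrightarrow> a * (y - x) \<le> F y - F x"
      "\<And>x y. x \<le> y \<Longrightarrow> \<bar>x\<bar> \<le> 2 * M \<Longrightarrow> \<bar>y\<bar> \<le> 2 * M \<Longrightarrow> F y - F x \<le> b * (y - x)"
    and p: "2 * ln (real n) / real n \<le> p" "p \<le> 1" and n: "n \<ge> 32"
    and l: "n \<le> 2 ^ l" "2 ^ l \<le> 2 * n" and good: "good_data m n p \<theta> l \<omega>"
    and \<sigma>: "\<sigma> \<in> sorting_perms n (row_sum n (y_mat m \<omega>))"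
  shows "(frob_norm n (\<lambda>i j. estimate m n \<omega> \<sigma> i j - \<theta> i j))\<^sup>2
    \<le> 1000000 * ((b / a)\<^sup>2 * (real n * ln (real n) / p) + real n * (ln (real n))\<^sup>2 / p)"
proof -
  have ln3: "3 \<le> ln (real n)" by (rule ln_ge_3[OF n])
  have n0: "real n \<ge> 32" using n by simp
  have p0: "p > 0" by (rule less_le_trans[OF _ p(1)]) (use n ln3 in simp)
  have v: "valid_param m n \<theta>" by (rule weight_model_valid[OF wm])
  have perm: "\<sigma> permutes {1..n}" using \<sigma> unfolding sorting_perms_def by auto
  have \<sigma>in: "\<sigma> i \<in> {1..n}" if "i \<in> {1..n}" for i using permutes_in_image[OF perm] that by simp
  obtain \<pi> where \<pi>: "\<pi> \<in> sorting_perms n w" using sorting_perms_nonempty by blast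
  define A where "A = (\<lambda>i\<in>{1..n}. \<lambda>j\<in>{1..n}. \<theta> (\<pi> i) (\<pi> j))"
  have AK: "A \<in> model_set m n" unfolding A_def by (rule sorted_param_in_model_set[OF wm mono \<pi>])
  define q where "q = p_hat n \<omega>"
  define \<delta> where "\<delta> = q / p - 1"
  have \<delta>2: "\<delta>\<^sup>2 \<le> 16 * ln (real n) / ((real n)\<^sup>2 * p)"
    using good unfolding good_data_def \<delta>_def q_def by blast
  have np: "2 * ln (real n) \<le> p * real n" using p(1) n0 by (simp add: field_simps)
  have "16 * ln (real n) / ((real n)\<^sup>2 * p) \<le> (1 / 2)\<^sup>2"
  proof -
    have "64 * ln (real n) \<le> 32 * (p * real n)" using np by simp
    also have "\<dots> \<le> real n * (p * real n)" using n0 p0 by (intro mult_right_mono) auto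
    finally show ?thesis using n0 p0 by (simp add: field_simps power2_eq_square)
  qed
  with \<delta>2 have "\<bar>\<delta>\<bar>\<^sup>2 \<le> (1 / 2)\<^sup>2" by simp
  then have \<delta>: "\<bar>\<delta>\<bar> \<le> 1 / 2" by (rule power2_le_imp_le) simp
  have qp: "q = p * (1 + \<delta>)" unfolding \<delta>_def using p0 by simp
  have "p * (1 / 2) \<le> p * (1 + \<delta>)" using \<delta> p0 by (intro mult_left_mono) auto
  then have q2: "p / 2 \<le> q" unfolding qp by simp
  then have q0: "q > 0" using p0 by linarith
  have qn: "1 / real n \<le> q"
  proof -
    have "1 \<le> p * real n / 2" using np ln3 by simp
    then have "1 / real n \<le> p / 2" using n0 by (simp add: field_simps)
    with q2 show ?thesis by simp
  qed
  \<comment> \<open>The data are divided by \<open>q\<close>, whereas the noise is normalised by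
    \<open>p\<close>; the ratio \<open>c\<close> accounts for this and is at most 2 because p / 2
    \<le> q.\<close>
  define c where "c = p / q"
  have c: "0 \<le> c" "c \<le> 2" unfolding c_def using p0 q0 q2 by (simp_all add: field_simps)
  have c1: "(c - 1)\<^sup>2 \<le> 64 * ln (real n) / ((real n)\<^sup>2 * p)"
  proof -
    have "c - 1 = - (c * \<delta>)" unfolding c_def \<delta>_def using p0 q0 by (simp add: field_simps)
    then have "(c - 1)\<^sup>2 = c\<^sup>2 * \<delta>\<^sup>2" by (simp add: power_mult_distrib)
    also have "\<dots> \<le> 2\<^sup>2 * (16 * ln (real n) / ((real n)\<^sup>2 * p))"
      by (intro mult_mono power_mono c \<delta>2) auto
    finally show ?thesis by simp
  qed
  define Z where "Z = mat_perm (\<lambda>i j. (y_mat m \<omega> i j - J i j / 2) / p_hat n \<omega> + J i j / 2) \<sigma>"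
  define B where "B = frob_proj n (model_set m n) Z"
  \<comment> \<open>\<open>U\<close> is the error of the ordering, \<open>V\<close> the bias from
    dividing by \<open>q\<close> in place of \<open>p\<close>, and \<open>E\<close> the reordered
    noise.\<close>
  define U where "U = (\<lambda>i j. \<theta> (\<sigma> i) (\<sigma> j) - A i j)"
  define V where "V = (\<lambda>i j. (c - 1) * (\<theta> (\<sigma> i) (\<sigma> j) - J i j / 2))"
  define E where "E = (\<lambda>i j. noise m p \<theta> \<omega> (\<sigma> i) (\<sigma> j))"
  define R where "R = real (Suc l) * (3 / 4 * real n + 2 * (7936 * real n * ln (real n) / p) + 1 / p)"
  define SU where "SU = (\<Sum>i=1..n. \<Sum>j=1..n. (U i j)\<^sup>2)"
  define SV where "SV = (\<Sum>i=1..n. \<Sum>j=1..n. (V i j)\<^sup>2)"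
  define X where "X = real n * (ln (real n))\<^sup>2 / p"
  have Zd: "Z i j - A i j = U i j + V i j + c * E i j" for i j
  proof -
    have "(y_mat m \<omega> (\<sigma> i) (\<sigma> j) - J (\<sigma> i) (\<sigma> j) / 2) / q
        = c * (E i j + (\<theta> (\<sigma> i) (\<sigma> j) - J (\<sigma> i) (\<sigma> j) / 2))"
      unfolding E_def c_def using y_mat_noise[of p m \<omega> "\<sigma> i" "\<sigma> j" \<theta>] p0 q0 by simp
    then show ?thesis
      unfolding Z_def mat_perm_def U_def V_def q_def[symmetric] J_perm[OF perm]
      by (simp add: algebra_simps diff_divide_distrib)
  qed
  have R0: "R \<ge> 0" unfolding R_def using n0 ln3 p0 by simp
  have pair: "(\<Sum>i=1..n. \<Sum>j=1..n. E i j * (B i j - A i j))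
        \<le> (\<Sum>i=1..n. \<Sum>j=1..n. (B i j - A i j)\<^sup>2) / 16 + R" if "B \<in> model_set m n" for B
    unfolding E_def R_def by (rule noise_pairing_le[OF v p0 p(2) _ l good perm AK that]) (use n in simp)
  have proj: "(\<Sum>i=1..n. \<Sum>j=1..n. (B i j - A i j)\<^sup>2) \<le> 16 * SU + 16 * SV + 8 * R"
    unfolding B_def SU_def SV_def
    by (rule projection_error[OF compact_model_set AK Zd c R0 pair])
  have est: "estimate m n \<omega> \<sigma> = mat_perm B (inv \<sigma>)"
    unfolding estimate_def B_def Z_def using qn unfolding q_def by simp
  have "(frob_norm n (\<lambda>i j. estimate m n \<omega> \<sigma> i j - \<theta> i j))\<^sup>2
      = (\<Sum>i=1..n. \<Sum>j=1..n. (B (inv \<sigma> (\<sigma> i)) (inv \<sigma> (\<sigma> j)) - \<theta> (\<sigma> i) (\<sigma> j))\<^sup>2)"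
    unfolding frob_norm_sq est mat_perm_def
    by (rule sum_square_permutes[OF perm, of "\<lambda>i j. (B (inv \<sigma> i) (inv \<sigma> j) - \<theta> i j)\<^sup>2", symmetric])
  \<comment> \<open>In sorted positions the error of the estimate is (B - A) - U.\<close>
  also have "\<dots> \<le> (\<Sum>i=1..n. \<Sum>j=1..n. 2 * (B i j - A i j)\<^sup>2 + 2 * (U i j)\<^sup>2)"
  proof (intro sum_mono)
    fix i j
    have "(x - y)\<^sup>2 \<le> 2 * x\<^sup>2 + 2 * y\<^sup>2" for x y :: real
      using zero_le_power2[of "x + y"] by (simp add: power2_eq_square algebra_simps)
    from this[of "B i j - A i j" "U i j"]
    show "(B (inv \<sigma> (\<sigma> i)) (inv \<sigma> (\<sigma> j)) - \<theta> (\<sigma> i) (\<sigma> j))\<^sup>2 \<le> 2 * (B i j - A i j)\<^sup>2 + 2 * (U i j)\<^sup>2"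
      unfolding permutes_inverses(2)[OF perm] by (simp add: U_def)
  qed
  also have "\<dots> = 2 * (\<Sum>i=1..n. \<Sum>j=1..n. (B i j - A i j)\<^sup>2) + 2 * SU"
    unfolding SU_def by (simp only: sum.distrib sum_distrib_left)
  also have "\<dots> \<le> 34 * SU + 32 * SV + 16 * R" using proj by simp
  finally have loss: "(frob_norm n (\<lambda>i j. estimate m n \<omega> \<sigma> i j - \<theta> i j))\<^sup>2 \<le> 34 * SU + 32 * SV + 16 * R" .
  have SU: "SU \<le> 576 * ((b / a)\<^sup>2 * (real n * ln (real n) / p))"
  proof -
    define \<Delta> where "\<Delta> = sqrt (18 * real n * ln (real n) / p)"
    have \<Delta>2: "\<Delta>\<^sup>2 = 18 * real n * ln (real n) / p" and \<Delta>0: "\<Delta> \<ge> 0"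
      unfolding \<Delta>_def using n0 ln3 p0 by simp_all
    have rows: "\<bar>\<Sum>j=1..n. noise m p \<theta> \<omega> i j\<bar> \<le> \<Delta>" if "i \<in> {1..n}" for i
      using good that unfolding good_data_def \<Delta>_def by (intro real_le_rsqrt) simp
    have "SU = (\<Sum>i=1..n. \<Sum>j=1..n. (\<theta> (\<sigma> i) (\<sigma> j) - \<theta> (\<pi> i) (\<pi> j))\<^sup>2)"
      unfolding SU_def U_def A_def by (intro sum.cong refl) simp
    also have "\<dots> \<le> 32 * (b / a)\<^sup>2 * \<Delta>\<^sup>2"
      by (rule sorting_error[OF wm a lip n p0 b \<Delta>0 rows \<sigma> \<pi>])
    finally show ?thesis unfolding \<Delta>2 by (simp add: mult_ac)
  qed
  define T where "T = real n * ln (real n) / p"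
  have nln: "real n \<le> real n * ln (real n)" using mult_left_mono[of 1 "ln (real n)" "real n"] ln3 by simp
  have T: "real n \<le> T" "1 / p \<le> T" "ln (real n) / p \<le> T" "T \<le> X"
  proof -
    have "real n * p \<le> real n * ln (real n)" using nln p(2) n0 mult_left_mono[of p 1 "real n"] by linarith
    then show "real n \<le> T" unfolding T_def using p0 by (simp add: field_simps)
    have "1 \<le> real n * ln (real n)" using nln n0 by linarith
    then show "1 / p \<le> T" unfolding T_def using p0 by (intro divide_right_mono) auto
    have "1 * ln (real n) \<le> real n * ln (real n)" using n0 ln3 by (intro mult_right_mono) auto
    then show "ln (real n) / p \<le> T" unfolding T_def using p0 by (simp add: divide_right_mono)
    have "ln (real n) \<le> (ln (real n))\<^sup>2" using ln3 by (simp add: power2_eq_square)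
    then have "real n * ln (real n) \<le> real n * (ln (real n))\<^sup>2" using n0 by simp
    then show "T \<le> X" unfolding X_def T_def using p0 by (simp add: divide_right_mono)
  qed
  have SV: "SV \<le> 16 * X"
  proof -
    have "SV \<le> (\<Sum>i=1..n. \<Sum>j=1..n. (c - 1)\<^sup>2 * (1 / 4))"
      unfolding SV_def V_def power_mult_distrib
    proof (intro sum_mono mult_left_mono)
      fix i j assume ij: "i \<in> {1..n}" "j \<in> {1..n}"
      have "\<bar>\<theta> (\<sigma> i) (\<sigma> j) - J i j / 2\<bar> \<le> 1 / 2"
        using valid_paramD(1,2,4)[OF v \<sigma>in[OF ij(1)] \<sigma>in[OF ij(2)]] unfolding J_def abs_le_iff by auto
      then have "\<bar>\<theta> (\<sigma> i) (\<sigma> j) - J i j / 2\<bar>\<^sup>2 \<le> (1 / 2)\<^sup>2" by (intro power_mono) auto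
      then show "(\<theta> (\<sigma> i) (\<sigma> j) - J i j / 2)\<^sup>2 \<le> 1 / 4" by (simp add: power2_eq_square)
    qed simp
    also have "\<dots> = (real n)\<^sup>2 / 4 * (c - 1)\<^sup>2" by (simp add: power2_eq_square)
    also have "\<dots> \<le> (real n)\<^sup>2 / 4 * (64 * ln (real n) / ((real n)\<^sup>2 * p))" by (intro mult_left_mono c1) simp
    also have "\<dots> = 16 * (ln (real n) / p)" using n0 p0 by (simp add: field_simps)
    finally show ?thesis using T(3,4) by linarith
  qed
  have R: "R \<le> 48000 * X"
  proof -
    have "ln (2 ^ l :: real) \<le> ln (2 * real n)"
      using of_nat_mono[OF l(2), where 'a = real] n0 by (subst ln_le_cancel_iff) auto
    then have "real l * ln 2 \<le> ln 2 + ln (real n)" using n0 by (simp add: ln_realpow ln_mult)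
    moreover have "real l * (2 / 3) \<le> real l * ln 2" using ln2_ge_two_thirds by (intro mult_left_mono) auto
    moreover have "ln 2 \<le> (1 :: real)" using ln_2_less_1 by simp
    \<comment> \<open>The number of levels is at most (3/2) (1 + ln n) + 1, and ln n \<ge> 3 turns
      this into 3 ln n. This factor is the source of the second logarithm in the bound.\<close>
    ultimately have l3: "real (Suc l) \<le> 3 * ln (real n)" using ln3 by simp
    have "3 / 4 * real n + 2 * (7936 * real n * ln (real n) / p) + 1 / p \<le> 16000 * T"
    proof -
      have eq: "2 * (7936 * real n * ln (real n) / p) = 15872 * T" unfolding T_def by simp
      show ?thesis unfolding eq using T(1,2) n0 by linarith
    qed
    moreover have "0 \<le> 3 / 4 * real n + 2 * (7936 * real n * ln (real n) / p) + 1 / p"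
      using n0 ln3 p0 by simp
    ultimately have "R \<le> (3 * ln (real n)) * (16000 * T)"
      unfolding R_def using l3 ln3 by (intro mult_mono) auto
    also have "\<dots> = 48000 * X" unfolding T_def X_def by (simp add: power2_eq_square)
    finally show ?thesis .
  qed
  define Q where "Q = (b / a)\<^sup>2 * (real n * ln (real n) / p)"
  have "0 \<le> Q" unfolding Q_def using n0 ln3 p0 by simp
  moreover have "X \<ge> 0" using T(1,4) n0 by linarith
  \<comment> \<open>The coefficient of \<open>Q\<close> is 34 times 576 = 19584, and that of
    \<open>X\<close> is 32 times 16 plus 16 times 48000, which is 768512.\<close>
  ultimately have "34 * SU + 32 * SV + 16 * R \<le> 1000000 * (Q + X)"
    using SU[folded Q_def] SV R by simp
  from order_trans[OF loss this] show ?thesis unfolding X_def Q_def .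
qed

text \<open>For use where no concentration is available: on all data the estimate has entries in
  [0, 1], being a reordered member of the model set or J / 2 off the diagonal.\<close>

lemma loss_le:
  assumes v: "valid_param m n \<theta>" and \<sigma>: "\<sigma> permutes {1..n}"
  shows "(frob_norm n (\<lambda>i j. estimate m n \<omega> \<sigma> i j - \<theta> i j))\<^sup>2 \<le> (real n)\<^sup>2"
proof -
  have "(\<Sum>i=1..n. \<Sum>j=1..n. (estimate m n \<omega> \<sigma> i j - \<theta> i j)\<^sup>2) \<le> (\<Sum>i=1..n. \<Sum>j=1..n. 1)"
  proof (intro sum_mono)
    fix i j assume ij: "i \<in> {1..n}" "j \<in> {1..n}"
    have inv: "inv \<sigma> k \<in> {1..n}" if "k \<in> {1..n}" for k
      using permutes_in_image[OF permutes_inv[OF \<sigma>]] that by simp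
    have "0 \<le> estimate m n \<omega> \<sigma> i j \<and> estimate m n \<omega> \<sigma> i j \<le> 1"
    proof (cases "1 / real n \<le> p_hat n \<omega>")
      case True
      note B = frob_proj_minimizes(1)[OF compact_model_set model_set_nonempty]
      show ?thesis using True unfolding estimate_def mat_perm_def
        by (simp only: if_True) (intro conjI model_setD(1,2)[OF B inv[OF ij(1)] inv[OF ij(2)]])
    qed (simp add: estimate_def J_def)
    then have "\<bar>estimate m n \<omega> \<sigma> i j - \<theta> i j\<bar> \<le> 1"
      using valid_paramD(1,2)[OF v ij] unfolding abs_le_iff by linarith
    then show "(estimate m n \<omega> \<sigma> i j - \<theta> i j)\<^sup>2 \<le> 1" by (simp add: abs_square_le_1)
  qed
  then show ?thesis unfolding frob_norm_sq by (simp add: power2_eq_square)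
qed

text \<open>The assumed bound on good data holds for every sorting permutation, so averaging over
  ties preserves it; on the remaining data \<open>loss_le\<close> applies.\<close>

lemma mse_le:
  assumes v: "valid_param m n \<theta>" and b: "b \<ge> 0"
    and good: "\<And>\<omega> \<sigma>. G \<omega> \<Longrightarrow> \<sigma> \<in> sorting_perms n (row_sum n (y_mat m \<omega>)) \<Longrightarrow>
      (frob_norm n (\<lambda>i j. estimate m n \<omega> \<sigma> i j - \<theta> i j))\<^sup>2 \<le> b"
    and bad: "measure_pmf.prob (data_pmf n p \<theta>) {\<omega>. \<not> G \<omega>} \<le> \<epsilon>"
  shows "mse m n p \<theta> \<le> b + (real n)\<^sup>2 * \<epsilon>"
proof -
  let ?P = "data_pmf n p \<theta>" and ?S = "\<lambda>\<omega>. sorting_perms n (row_sum n (y_mat m \<omega>))"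
  let ?h = "\<lambda>\<theta>'. (frob_norm n (\<lambda>i j. \<theta>' i j - \<theta> i j))\<^sup>2"
  let ?b = "\<lambda>\<omega>. b + (real n)\<^sup>2 * indicator {\<omega>. \<not> G \<omega>} \<omega>"
  have fin: "finite (set_pmf ?P)"
    unfolding data_pmf_def set_Pi_pmf[OF finite_above_diag] by (rule finite_PiE_dflt[OF finite_above_diag]) auto
  have set_S: "set_pmf (pmf_of_set (?S \<omega>)) = ?S \<omega>" for \<omega>
    by (rule set_pmf_of_set[OF sorting_perms_nonempty finite_sorting_perms])
  have inner: "measure_pmf.expectation (map_pmf (estimate m n \<omega>) (pmf_of_set (?S \<omega>))) ?h \<le> ?b \<omega>" for \<omega>
    unfolding integral_map_pmf
  proof (rule measure_pmf.integral_le_const)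
    show "integrable (measure_pmf (pmf_of_set (?S \<omega>))) (\<lambda>\<sigma>. ?h (estimate m n \<omega> \<sigma>))"
      by (rule integrable_measure_pmf_finite) (simp add: set_S finite_sorting_perms)
    show "AE \<sigma> in measure_pmf (pmf_of_set (?S \<omega>)). ?h (estimate m n \<omega> \<sigma>) \<le> ?b \<omega>"
    proof (rule AE_pmfI)
      fix \<sigma> assume "\<sigma> \<in> set_pmf (pmf_of_set (?S \<omega>))"
      then have \<sigma>: "\<sigma> \<in> ?S \<omega>" unfolding set_S .
      show "?h (estimate m n \<omega> \<sigma>) \<le> ?b \<omega>"
      proof (cases "G \<omega>")
        case True
        then show ?thesis using good[OF True \<sigma>] by simp
      next
        case False
        have "\<sigma> permutes {1..n}" using \<sigma> unfolding sorting_perms_def by simp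
        from loss_le[OF v this, of \<omega>] False b show ?thesis by simp
      qed
    qed
  qed
  have "mse m n p \<theta> = (\<Sum>\<omega>\<in>set_pmf ?P. pmf ?P \<omega> *\<^sub>R
      measure_pmf.expectation (map_pmf (estimate m n \<omega>) (pmf_of_set (?S \<omega>))) ?h)"
    unfolding mse_def estimator_pmf_def
    by (rule pmf_expectation_bind[OF fin]) (simp_all add: set_S finite_sorting_perms)
  also have "\<dots> \<le> (\<Sum>\<omega>\<in>set_pmf ?P. ?b \<omega> * pmf ?P \<omega>)"
  proof (rule sum_mono)
    fix \<omega>
    show "pmf ?P \<omega> *\<^sub>R measure_pmf.expectation (map_pmf (estimate m n \<omega>) (pmf_of_set (?S \<omega>))) ?h
        \<le> ?b \<omega> * pmf ?P \<omega>"
      unfolding real_scaleR_def mult.commute[of "?b \<omega>"] by (rule mult_left_mono[OF inner]) simp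
  qed
  also have "\<dots> = measure_pmf.expectation ?P ?b"
    by (rule integral_measure_pmf_real[OF fin, symmetric])
  also have "\<dots> = b + (real n)\<^sup>2 * measure_pmf.prob ?P {\<omega>. \<not> G \<omega>}"
    by (simp add: integrable_measure_pmf_finite[OF fin])
  also have "\<dots> \<le> b + (real n)\<^sup>2 * \<epsilon>" using bad by (intro add_left_mono mult_left_mono) auto
  finally show ?thesis .
qed

lemma power_of_two_between: "n \<ge> 1 \<Longrightarrow> \<exists>l. n \<le> 2 ^ l \<and> 2 ^ l \<le> 2 * (n :: nat)"
proof (induction n rule: nat_induct_at_least)
  case base
  show ?case by (intro exI[of _ 0]) simp
next
  case (Suc n)
  then obtain l where l: "n \<le> 2 ^ l" "2 ^ l \<le> 2 * n" by blast
  show ?case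
  proof (cases "n = 2 ^ l")
    case True
    then show ?thesis using Suc.hyps by (intro exI[of _ "Suc l"]) auto
  next
    case False
    then show ?thesis using l by (intro exI[of _ l]) auto
  qed
qed

lemma risk_bound:
  assumes wm: "weight_model m n F M w \<theta>" and F: "cdf_with_cont_pos_density F f" and M: "M > 0"
    and L: "L = (SUP x\<in>{x. \<bar>x\<bar> \<le> 2 * M}. f x)" and L': "L' = (INF x\<in>{x. \<bar>x\<bar> \<le> 2 * M}. f x)"
    and p: "2 * ln (real n) / real n \<le> p" "p \<le> 1" and n: "n \<ge> 2"
  shows "1 / (real n)\<^sup>2 * mse m n p \<theta> \<le> 2000000 * ((L / L')\<^sup>2 * (ln (real n) / (real n * p))
      + (ln (real n))\<^sup>2 / (real n * p))"
proof -
  define X where "X = (L / L')\<^sup>2 * (ln (real n) / (real n * p))"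
  define Y where "Y = (ln (real n))\<^sup>2 / (real n * p)"
  have ln2: "2 / 3 \<le> ln (real n)"
  proof -
    have "ln 2 \<le> ln (real n)" using n by (subst ln_le_cancel_iff) auto
    then show ?thesis using ln2_ge_two_thirds by linarith
  qed
  have p0: "p > 0" by (rule less_le_trans[OF _ p(1)]) (use n ln2 in simp)
  have XY: "X \<ge> 0" "Y \<ge> 0" unfolding X_def Y_def using ln2 p0 by simp_all
  have v: "valid_param m n \<theta>" by (rule weight_model_valid[OF wm])
  note dens = density_extrema[OF F M L L']
  have Lpos: "L \<ge> 0" using dens(1) dens(2)[of 0] dens(3)[of 0] M by simp
  have lip: "L' * (y - x) \<le> F y - F x" "F y - F x \<le> L * (y - x)"
    if "x \<le> y" "\<bar>x\<bar> \<le> 2 * M" "\<bar>y\<bar> \<le> 2 * M" for x y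
  proof -
    have "x \<in> {- (2 * M)..2 * M}" "y \<in> {- (2 * M)..2 * M}" using that by auto
    from cdf_increment_bounds[OF F that(1) this, of L' L] dens
    show "L' * (y - x) \<le> F y - F x" "F y - F x \<le> L * (y - x)" by auto
  qed
  show ?thesis
  proof (cases "n \<ge> 32")
    \<comment> \<open>For small \<open>n\<close> the trivial loss n^2 suffices: n p \<le> 32 and ln
      n \<ge> 2/3 make the right-hand side at least 1.\<close>
    case False
    have "mse m n p \<theta> \<le> 0 + (real n)\<^sup>2 * 1"
      by (rule mse_le[OF v, where G = "\<lambda>_. False"]) auto
    then have "1 / (real n)\<^sup>2 * mse m n p \<theta> \<le> 1" using n by (simp add: field_simps)
    also have "1 \<le> 2000000 * Y"
    proof -
      have "real n * p \<le> 32 * 1" using False p p0 by (intro mult_mono) auto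
      moreover have "(2 / 3)\<^sup>2 \<le> (ln (real n))\<^sup>2" using ln2 by (intro power_mono) auto
      ultimately have "real n * p \<le> 2000000 * (ln (real n))\<^sup>2" by (simp add: power2_eq_square)
      then show ?thesis unfolding Y_def using n p0 by (simp add: field_simps)
    qed
    finally show ?thesis using XY unfolding X_def[symmetric] Y_def[symmetric] by simp
  next
    case True
    obtain l where l: "n \<le> 2 ^ l" "2 ^ l \<le> 2 * n" using power_of_two_between[of n] n by auto
    have monoF: "mono F"
    proof -
      obtain \<mu> where \<mu>: "real_distribution \<mu>" "F = cdf \<mu>"
        using F unfolding cdf_with_cont_pos_density_def by blast
      interpret real_distribution \<mu> by (rule \<mu>(1))
      show ?thesis unfolding \<mu>(2) by (intro monoI cdf_nondecreasing)
    qed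
    define b where "b = 1000000 * ((L / L')\<^sup>2 * (real n * ln (real n) / p) + real n * (ln (real n))\<^sup>2 / p)"
    have b: "b = (real n)\<^sup>2 * (1000000 * (X + Y))"
      unfolding b_def X_def Y_def using n p0 by (simp add: field_simps power2_eq_square)
    have "mse m n p \<theta> \<le> b + (real n)\<^sup>2 * (5 / real n)"
    proof (rule mse_le[OF v, where G = "good_data m n p \<theta> l"])
      show "b \<ge> 0" unfolding b using XY by simp
      show "(frob_norm n (\<lambda>i j. estimate m n \<omega> \<sigma> i j - \<theta> i j))\<^sup>2 \<le> b"
        if "good_data m n p \<theta> l \<omega>" "\<sigma> \<in> sorting_perms n (row_sum n (y_mat m \<omega>))" for \<omega> \<sigma>
        unfolding b_def by (rule loss_good[OF wm monoF dens(1) Lpos lip p True l that])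
      show "measure_pmf.prob (data_pmf n p \<theta>) {\<omega>. \<not> good_data m n p \<theta> l \<omega>} \<le> 5 / real n"
        by (rule prob_not_good[OF v p True l(2)])
    qed
    then have "1 / (real n)\<^sup>2 * mse m n p \<theta> \<le> 1000000 * (X + Y) + 5 / real n"
      unfolding b using n by (simp add: field_simps)
    \<comment> \<open>The contribution of the failure event is absorbed because p \<le> 1 \<le> (ln
      n)^2.\<close>
    also have "5 / real n \<le> 5 * Y"
    proof -
      have "3\<^sup>2 \<le> (ln (real n))\<^sup>2" using ln_ge_3[OF True] by (intro power_mono) auto
      then have "p \<le> (ln (real n))\<^sup>2" using p(2) by simp
      then show ?thesis unfolding Y_def using n p0 by (simp add: field_simps)
    qed
    finally have "1 / (real n)\<^sup>2 * mse m n p \<theta> \<le> 2000000 * (X + Y)" using XY by simp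
    then show ?thesis unfolding X_def Y_def .
  qed
qed

lemma bradley_terry_weight_model:
  assumes "\<theta> \<in> gen_bradley_terry n F M" "cdf_with_cont_pos_density F f" "\<forall>x. F x + F (- x) = 1"
  shows "\<exists>w. weight_model Tournament n F M w \<theta>"
proof -
  obtain w where w: "w \<in> {1..n} \<rightarrow> {-M..M}" "\<forall>i\<in>{1..n}. \<theta> i i = 0"
    "\<forall>i\<in>{1..n}. \<forall>j\<in>{1..n}. i \<noteq> j \<longrightarrow> \<theta> i j = F (w i - w j)"
    using assms(1) unfolding gen_bradley_terry_def by blast
  have "\<forall>i\<in>{1..n}. \<bar>w i\<bar> \<le> M" using w(1) by (auto simp: Pi_iff abs_le_iff)
  then show ?thesis using w(2,3) assms(3) cdf_01[OF assms(2)]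
    unfolding weight_model_def reflect_sign_def by (intro exI[of _ w]) simp
qed

lemma beta_weight_model:
  assumes "\<theta> \<in> gen_beta n F M" "cdf_with_cont_pos_density F f"
  shows "\<exists>w. weight_model Graph n F M w \<theta>"
proof -
  obtain w where w: "w \<in> {1..n} \<rightarrow> {-M..M}" "\<forall>i\<in>{1..n}. \<theta> i i = 0"
    "\<forall>i\<in>{1..n}. \<forall>j\<in>{1..n}. i \<noteq> j \<longrightarrow> \<theta> i j = F (w i + w j)"
    using assms(1) unfolding gen_beta_def by blast
  have "\<forall>i\<in>{1..n}. \<bar>w i\<bar> \<le> M" using w(1) by (auto simp: Pi_iff abs_le_iff)
  then show ?thesis using w(2,3) cdf_01[OF assms(2)]
    unfolding weight_model_def reflect_sign_def by (intro exI[of _ w]) simp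
qed

text \<open>The suprema are taken in the extended reals, where every set has one, so it suffices to
  bound the risk at each \<theta> separately.\<close>

theorem corollary2p3:
  "\<exists>C::real. \<forall>(n::nat) (p::real) (M::real).
     2 \<le> n \<longrightarrow> p \<in> {0..1} \<longrightarrow> 2 * ln (real n) / real n \<le> p \<longrightarrow> 0 < M \<longrightarrow>
     (\<forall>F f L L'.
        cdf_with_cont_pos_density F f \<longrightarrow> (\<forall>x. F x + F (- x) = 1) \<longrightarrow>
        L = (SUP x\<in>{x. \<bar>x\<bar> \<le> 2 * M}. f x) \<longrightarrow> L' = (INF x\<in>{x. \<bar>x\<bar> \<le> 2 * M}. f x) \<longrightarrow>
        (SUP \<theta>\<in>gen_bradley_terry n F M. ereal (1 / (real n)\<^sup>2 * mse Tournament n p \<theta>))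
          \<le> ereal (C * ((L / L')\<^sup>2 * (ln (real n) / (real n * p))
                       + (ln (real n))\<^sup>2 / (real n * p)))) \<and>
     (\<forall>F f L L'.
        cdf_with_cont_pos_density F f \<longrightarrow>
        L = (SUP x\<in>{x. \<bar>x\<bar> \<le> 2 * M}. f x) \<longrightarrow> L' = (INF x\<in>{x. \<bar>x\<bar> \<le> 2 * M}. f x) \<longrightarrow>
        (SUP \<theta>\<in>gen_beta n F M. ereal (1 / (real n)\<^sup>2 * mse Graph n p \<theta>))
          \<le> ereal (C * ((L / L')\<^sup>2 * (ln (real n) / (real n * p))
                       + (ln (real n))\<^sup>2 / (real n * p))))"
proof (intro exI[of _ 2000000] allI impI conjI SUP_least)
  fix n :: nat and p M :: real and F f :: "real \<Rightarrow> real" and L L' \<theta>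
  assume n: "2 \<le> n" and p: "p \<in> {0..1}" "2 * ln (real n) / real n \<le> p" and M: "0 < M"
    and F: "cdf_with_cont_pos_density F f"
    and L: "L = (SUP x\<in>{x. \<bar>x\<bar> \<le> 2 * M}. f x)" and L': "L' = (INF x\<in>{x. \<bar>x\<bar> \<le> 2 * M}. f x)"
  have p1: "p \<le> 1" using p(1) by simp
  {
    assume "\<forall>x. F x + F (- x) = 1" "\<theta> \<in> gen_bradley_terry n F M"
    then obtain w where "weight_model Tournament n F M w \<theta>"
      using bradley_terry_weight_model[OF _ F] by blast
    from risk_bound[OF this F M L L' p(2) p1 n]
    show "ereal (1 / (real n)\<^sup>2 * mse Tournament n p \<theta>)
      \<le> ereal (2000000 * ((L / L')\<^sup>2 * (ln (real n) / (real n * p)) + (ln (real n))\<^sup>2 / (real n * p)))"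
      by simp
  }
  {
    assume "\<theta> \<in> gen_beta n F M"
    then obtain w where "weight_model Graph n F M w \<theta>"
      using beta_weight_model[OF _ F] by blast
    from risk_bound[OF this F M L L' p(2) p1 n]
    show "ereal (1 / (real n)\<^sup>2 * mse Graph n p \<theta>)
      \<le> ereal (2000000 * ((L / L')\<^sup>2 * (ln (real n) / (real n * p)) + (ln (real n))\<^sup>2 / (real n * p)))"
      by simp
  }
qed

end
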